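(* Let $\mathbf{x}:T^2\to\mathbb{E}^3$ be a smooth immersion of the (oriented) torus whose mean curvature $H$ and Gaussian curvature $K$ satisfy $H=f(H^2-K)$, where $f$ is a smooth function on some interval $(-\epsilon,\infty)$ with $\epsilon>0$. Then $\mathbf{x}$ has no umbilic points and there exists a global positive principal frame field on $T^2$.
   Context: A point is umbilic if the principal curvatures coincide. A positive principal frame field is a smooth oriented orthonormal tangent frame field $(e_1,e_2)$ (together with the oriented unit normal $e_3$) that diagonalizes the second fundamental form, with the principal curvature in direction $e_1$ strictly greater than that in direction $e_2$. *)

theory Defs
  imports "HOL-Analysis.Analysis"
begin

primrec diter :: "'a list \<Rightarrow> ('a::real_normed_vector \<Rightarrow> 'b::real_normed_vector) \<Rightarrow> 'a \<Rightarrow> 'b" where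
  "diter [] f = f"
| "diter (v # vs) f = (\<lambda>p. frechet_derivative (diter vs f) (at p) v)"

definition smooth_on :: "'a set \<Rightarrow> ('a::real_normed_vector \<Rightarrow> 'b::real_normed_vector) \<Rightarrow> bool" where
  "smooth_on U f \<longleftrightarrow> open U \<and> (\<forall>vs p. p \<in> U \<longrightarrow> diter vs f differentiable (at p))"

text \<open>The torus T^2 = R^2 / Z^2 (with its standard orientation); maps on T^2 are
  doubly periodic maps on R^2.\<close>
definition torus_periodic :: "(real \<times> real \<Rightarrow> 'b) \<Rightarrow> bool" where
  "torus_periodic g \<longleftrightarrow> (\<forall>u v. g (u + 1, v) = g (u, v) \<and> g (u, v + 1) = g (u, v))"

definition dx :: "(real \<times> real \<Rightarrow> real^3) \<Rightarrow> real \<times> real \<Rightarrow> real \<times> real \<Rightarrow> real^3" where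
  "dx x p c = frechet_derivative x (at p) c"

definition xu where "xu x p = dx x p (1, 0)"
definition xv where "xv x p = dx x p (0, 1)"

definition torus_immersion :: "(real \<times> real \<Rightarrow> real^3) \<Rightarrow> bool" where
  "torus_immersion x \<longleftrightarrow> smooth_on UNIV x \<and> torus_periodic x \<and>
     (\<forall>p. inj (dx x p))"

definition unit_normal :: "(real \<times> real \<Rightarrow> real^3) \<Rightarrow> real \<times> real \<Rightarrow> real^3" where
  "unit_normal x p = (1 / norm (cross3 (xu x p) (xv x p))) *\<^sub>R cross3 (xu x p) (xv x p)"

definition fff :: "(real \<times> real \<Rightarrow> real^3) \<Rightarrow> real \<times> real \<Rightarrow> real \<times> real \<Rightarrow> real \<times> real \<Rightarrow> real" where
  "fff x p c d = dx x p c \<bullet> dx x p d"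

definition sff :: "(real \<times> real \<Rightarrow> real^3) \<Rightarrow> real \<times> real \<Rightarrow> real \<times> real \<Rightarrow> real \<times> real \<Rightarrow> real" where
  "sff x p c d = diter [c, d] x p \<bullet> unit_normal x p"

definition mean_curv :: "(real \<times> real \<Rightarrow> real^3) \<Rightarrow> real \<times> real \<Rightarrow> real" where
  "mean_curv x p =
    (let E = fff x p (1,0) (1,0); F = fff x p (1,0) (0,1); G = fff x p (0,1) (0,1);
         L = sff x p (1,0) (1,0); M = sff x p (1,0) (0,1); N = sff x p (0,1) (0,1)
     in (E * N - 2 * F * M + G * L) / (2 * (E * G - F\<^sup>2)))"

definition gauss_curv :: "(real \<times> real \<Rightarrow> real^3) \<Rightarrow> real \<times> real \<Rightarrow> real" where
  "gauss_curv x p =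
    (let E = fff x p (1,0) (1,0); F = fff x p (1,0) (0,1); G = fff x p (0,1) (0,1);
         L = sff x p (1,0) (1,0); M = sff x p (1,0) (0,1); N = sff x p (0,1) (0,1)
     in (L * N - M\<^sup>2) / (E * G - F\<^sup>2))"

text \<open>Normal curvature in tangent direction dx(c); principal curvatures are its max and min
  over tangent directions (Euler); a point is umbilic iff they coincide.\<close>
definition normal_curv where
  "normal_curv x p c = sff x p c c / fff x p c c"

definition kappa1 where "kappa1 x p = Sup {normal_curv x p c | c. c \<noteq> 0}"
definition kappa2 where "kappa2 x p = Inf {normal_curv x p c | c. c \<noteq> 0}"

definition umbilic :: "(real \<times> real \<Rightarrow> real^3) \<Rightarrow> real \<times> real \<Rightarrow> bool" where
  "umbilic x p \<longleftrightarrow> kappa1 x p = kappa2 x p"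

definition positive_principal_frame :: "(real \<times> real \<Rightarrow> real^3) \<Rightarrow> (real \<times> real \<Rightarrow> real^3) \<Rightarrow> (real \<times> real \<Rightarrow> real^3) \<Rightarrow> bool" where
  "positive_principal_frame x e1 e2 \<longleftrightarrow>
     smooth_on UNIV e1 \<and> smooth_on UNIV e2 \<and> torus_periodic e1 \<and> torus_periodic e2 \<and>
     (\<forall>p. \<exists>c1 c2. e1 p = dx x p c1 \<and> e2 p = dx x p c2 \<and>
        norm (e1 p) = 1 \<and> norm (e2 p) = 1 \<and> e1 p \<bullet> e2 p = 0 \<and>
        cross3 (e1 p) (e2 p) = unit_normal x p \<and>
        sff x p c1 c2 = 0 \<and> sff x p c1 c1 > sff x p c2 c2)"

end

theory Submission
  imports Defs
begin

text \<open>
  Let \<open>\<omega>\<close> be the complex coframe of an orthonormal tangent frame, \<open>\<rho>\<close> its connection form and \<open>h\<close> the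
  conjugate Hopf function, so that \<open>|h|\<^sup>2 = H\<^sup>2 - K\<close> and \<open>h\<close> vanishes exactly at the umbilic points. If
  \<open>H = f(|h|\<^sup>2)\<close> and \<open>\<phi> = f'(|h|\<^sup>2)\<close>, the Codazzi equations take the form \<open>dh \<and> \<sigma> = h \<alpha>\<close> with
  \<open>\<sigma> = (1 + \<phi>\<^sup>2|h|\<^sup>2) \<omega> + \<phi> cnj h cnj \<omega>\<close>, which is elliptic everywhere and smooth also at umbilics.

  A solution \<open>h\<close> of such an equation on a torus is identically zero or nowhere zero. Put
  \<open>v = ln(|h|\<^sup>2 + \<delta>) / 2\<close> and \<open>l = ln(1/\<delta>) / 2\<close>. Then \<open>Lv = F |h|\<^sup>2/(|h|\<^sup>2 + \<delta>) + P\<close> for an elliptic operator \<open>L\<close>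
  in divergence form, where \<open>P \<ge> 0\<close> and \<open>F\<close> is a divergence. Integrating \<open>Lv\<close> and \<open>v Lv\<close> bounds the
  Dirichlet energy of \<open>v\<close> by \<open>O(l)\<close>; with a Poincare inequality, started where \<open>h \<noteq> 0\<close>, the mean of \<open>|v|\<close> is
  \<open>O(sqrt l)\<close>, and feeding this back the energy is \<open>O(sqrt l)\<close> too. At a zero of \<open>h\<close>, however, \<open>v\<close> lies below a
  logarithmic potential, which forces an energy of order \<open>l\<close>.

  If \<open>h\<close> vanished identically, Gauss' equation integrated over the torus would give \<open>H = 0\<close> and a constant
  normal. So \<open>h\<close> has no zeros and the principal directions form a line field. Its positive
  direction is orientable: a suitable function of \<open>|h|\<close> times the first principal coform is closed and
  nowhere zero, and were it reversed by some period, its potential would be periodic for twice the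
  lattice and so have a critical point.
\<close>

section \<open>Smooth functions\<close>

text \<open>The classical route makes the zeros of h isolated with indices of one sign and counts
  them. The integrals here need neither a local normal form nor conformal coordinates: the complex
  structure of sigma enters only through real one-forms and pointwise identities. The topology of
  the torus enters through a global frame. It makes h a function and its connection form global, so
  F has mean zero.

  The obstacle is that the first energy bound is critical. A logarithmic potential regularised at
  scale delta itself has energy of order l, so testing v against it at a zero of h gives l <= const
  * sqrt(energy * l), that is, energy >= const * l. An upper bound O(l) does not contradict this,
  whatever the constants; O(sqrt l) does. The gain comes from the mean zero of F: only F *
  delta/(|h|^2 + delta) survives, and this is small on average once v is not near -l on most of the
  torus.

  Absence of umbilics alone does not give the frame, since a line field on a torus may be
  non-orientable. The Codazzi equations must be used a second time; the multiplier of the principal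
  coform solves the ordinary differential equation that makes the product closed.\<close>

abbreviation smooth :: "('a::real_normed_vector \<Rightarrow> 'b::real_normed_vector) \<Rightarrow> bool" where
  "smooth \<equiv> smooth_on UNIV"

text \<open>The head of the list is the outermost derivative, whereas induction on the order of
  differentiability peels off the innermost one, which is the last entry.\<close>

lemma diter_snoc: "diter (vs @ [v]) f = diter vs (\<lambda>p. frechet_derivative f (at p) v)"
  by (induction vs) auto

lemma differentiable_transform_open:
  assumes "f differentiable (at p)" "open U" "p \<in> U" "\<And>q. q \<in> U \<Longrightarrow> f q = g q"
  shows "g differentiable (at p)"
proof -
  obtain D where "(f has_derivative D) (at p)" using assms(1) by (auto simp: differentiable_def)
  then have "(g has_derivative D) (at p)"
    by (rule has_derivative_transform_within_open[OF _ assms(2-4)])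
  then show ?thesis by (auto simp: differentiable_def)
qed

lemma diter_cong_open:
  assumes "open U" "\<And>p. p \<in> U \<Longrightarrow> f p = g p" "p \<in> U"
  shows "diter vs f p = diter vs g p"
  using assms(3)
proof (induction vs arbitrary: p)
  case (Cons v vs)
  have "frechet_derivative (diter vs f) (at p) = frechet_derivative (diter vs g) (at p)"
  proof (cases "diter vs f differentiable at p")
    case True
    then show ?thesis
      using frechet_derivative_transform_within_open[OF True assms(1) Cons.prems] Cons.IH by blast
  next
    case False
    then have "\<not> (diter vs g differentiable at p)"
      using differentiable_transform_open[OF _ assms(1) Cons.prems, of "diter vs g" "diter vs f"] Cons.IH by auto
    \<comment> \<open>Where no derivative exists, \<open>frechet_derivative\<close> is a choice from
      an empty set of candidates, hence the same arbitrary value for both functions.\<close>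
    then show ?thesis using False
      by (simp add: frechet_derivative_def differentiable_def)
  qed
  then show ?case by simp
qed (use assms in auto)

text \<open>The derivatives of order \<open>n\<close> are themselves required to be differentiable,
  so level 0 already means differentiable. The product and chain rules express a derivative through
  functions of one level less, which makes this the scale for inductions.\<close>

definition diff_upto :: "nat \<Rightarrow> 'a set \<Rightarrow> ('a::real_normed_vector \<Rightarrow> 'b::real_normed_vector) \<Rightarrow> bool" where
  "diff_upto n U f \<longleftrightarrow> (\<forall>vs p. length vs \<le> n \<longrightarrow> p \<in> U \<longrightarrow> diter vs f differentiable (at p))"

lemma smooth_on_iff_diff_upto: "smooth_on U f \<longleftrightarrow> open U \<and> (\<forall>n. diff_upto n U f)"
  unfolding smooth_on_def diff_upto_def by blast

lemma diff_upto_0: "diff_upto 0 U f \<longleftrightarrow> (\<forall>p\<in>U. f differentiable (at p))"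
  by (auto simp: diff_upto_def)

lemma diff_upto_Suc:
  "diff_upto (Suc n) U f \<longleftrightarrow>
    (\<forall>p\<in>U. f differentiable (at p)) \<and> (\<forall>v. diff_upto n U (\<lambda>p. frechet_derivative f (at p) v))"
proof (intro iffI conjI)
  assume L: "diff_upto (Suc n) U f"
  then show "\<forall>p\<in>U. f differentiable (at p)"
    unfolding diff_upto_def by (metis diter.simps(1) list.size(3) zero_le)
  show "\<forall>v. diff_upto n U (\<lambda>p. frechet_derivative f (at p) v)"
    using L unfolding diff_upto_def by (metis Suc_le_mono diter_snoc length_append_singleton)
next
  assume R: "(\<forall>p\<in>U. f differentiable (at p)) \<and> (\<forall>v. diff_upto n U (\<lambda>p. frechet_derivative f (at p) v))"
  show "diff_upto (Suc n) U f"
    unfolding diff_upto_def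
  proof (intro allI impI)
    fix vs :: "'a list" and p assume vs: "length vs \<le> Suc n" "p \<in> U"
    show "diter vs f differentiable (at p)"
    proof (cases vs rule: rev_cases)
      case Nil
      then show ?thesis using R vs by simp
    next
      case (snoc ws w)
      then show ?thesis using R vs unfolding diff_upto_def by (auto simp: diter_snoc)
    qed
  qed
qed

lemma diff_upto_cong:
  assumes "open U" "\<And>p. p \<in> U \<Longrightarrow> f p = g p" "diff_upto n U f"
  shows "diff_upto n U g"
  unfolding diff_upto_def
proof (intro allI impI)
  fix vs :: "'a list" and p assume "length vs \<le> n" "p \<in> U"
  then have "diter vs f differentiable (at p)"
    using assms(3) by (auto simp: diff_upto_def)
  then show "diter vs g differentiable (at p)"
    by (rule differentiable_transform_open[OF _ assms(1) \<open>p \<in> U\<close>]) (rule diter_cong_open[OF assms(1,2)])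
qed

lemma diff_upto_mono: "diff_upto n U f \<Longrightarrow> m \<le> n \<Longrightarrow> diff_upto m U f"
  by (auto simp: diff_upto_def)

lemma diff_upto_SucD:
  assumes "diff_upto (Suc n) U f"
  shows "diff_upto n U f" "diff_upto n U (\<lambda>p. frechet_derivative f (at p) v)"
  using assms diff_upto_mono[OF assms, of n] by (simp_all add: diff_upto_Suc)

text \<open>Openness of \<open>U\<close> allows an explicit formula \<open>D\<close> in place of the
  chosen derivative, so each closure property reduces to a differentiation rule whose right-hand
  side is handled by induction.\<close>

lemma diff_upto_SucI:
  assumes "open U" "\<And>p. p \<in> U \<Longrightarrow> (f has_derivative D p) (at p)"
    "\<And>v. diff_upto n U (\<lambda>p. D p v)"
  shows "diff_upto (Suc n) U f"
  unfolding diff_upto_Suc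
proof (intro conjI ballI allI)
  show "f differentiable (at p)" if "p \<in> U" for p
    using assms(2)[OF that] by (auto simp: differentiable_def)
  show "diff_upto n U (\<lambda>p. frechet_derivative f (at p) v)" for v
    by (rule diff_upto_cong[OF assms(1) _ assms(3)[of v]]) (metis assms(2) frechet_derivative_at)
qed

lemma diff_upto_has_derivative:
  "diff_upto n U f \<Longrightarrow> p \<in> U \<Longrightarrow> (f has_derivative frechet_derivative f (at p)) (at p)"
  by (metis diff_upto_0 diff_upto_mono frechet_derivative_works zero_le)

lemma diff_upto_const: "open U \<Longrightarrow> diff_upto n U (\<lambda>p. c)"
proof (induction n arbitrary: c)
  case (Suc n)
  show ?case by (rule diff_upto_SucI[of _ _ "\<lambda>_ _. 0"]) (use Suc in auto)
qed (simp add: diff_upto_0)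

lemma diff_upto_linear:
  assumes "bounded_linear L" "open U"
  shows "diff_upto n U f \<Longrightarrow> diff_upto n U (\<lambda>p. L (f p))"
proof (induction n arbitrary: f)
  case 0
  then show ?case
    unfolding diff_upto_0 differentiable_def using bounded_linear.has_derivative[OF assms(1)] by blast
next
  case (Suc n)
  show ?case
  proof (rule diff_upto_SucI[OF assms(2)])
    show "((\<lambda>p. L (f p)) has_derivative (\<lambda>v. L (frechet_derivative f (at p) v))) (at p)" if "p \<in> U" for p
      using bounded_linear.has_derivative[OF assms(1) diff_upto_has_derivative[OF Suc.prems that]] .
    show "diff_upto n U (\<lambda>p. L (frechet_derivative f (at p) v))" for v
      using Suc by (auto simp: diff_upto_Suc)
  qed
qed

lemma diff_upto_add:
  assumes "open U"
  shows "diff_upto n U f \<Longrightarrow> diff_upto n U g \<Longrightarrow> diff_upto n U (\<lambda>p. f p + g p)"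
proof (induction n arbitrary: f g)
  case 0
  then show ?case by (auto simp: diff_upto_0)
next
  case (Suc n)
  show ?case
  proof (rule diff_upto_SucI[OF assms])
    show "((\<lambda>p. f p + g p) has_derivative
       (\<lambda>v. frechet_derivative f (at p) v + frechet_derivative g (at p) v)) (at p)" if "p \<in> U" for p
      using diff_upto_has_derivative[OF _ that] Suc.prems by (auto intro!: derivative_intros)
    show "diff_upto n U (\<lambda>p. frechet_derivative f (at p) v + frechet_derivative g (at p) v)" for v
      using Suc by (auto simp: diff_upto_Suc)
  qed
qed

lemma diff_upto_bilinear:
  assumes "bounded_bilinear B" "open U"
  shows "diff_upto n U f \<Longrightarrow> diff_upto n U g \<Longrightarrow> diff_upto n U (\<lambda>p. B (f p) (g p))"
proof (induction n arbitrary: f g)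
  case 0
  show ?case unfolding diff_upto_0
  proof
    fix p assume "p \<in> U"
    then show "(\<lambda>p. B (f p) (g p)) differentiable (at p)"
      using bounded_bilinear.FDERIV[OF assms(1) diff_upto_has_derivative[OF 0(1)] diff_upto_has_derivative[OF 0(2)]]
      unfolding differentiable_def by blast
  qed
next
  case (Suc n)
  show ?case
  proof (rule diff_upto_SucI[OF assms(2)])
    show "((\<lambda>p. B (f p) (g p)) has_derivative
       (\<lambda>v. B (f p) (frechet_derivative g (at p) v) + B (frechet_derivative f (at p) v) (g p))) (at p)" if "p \<in> U" for p
      using bounded_bilinear.FDERIV[OF assms(1) diff_upto_has_derivative[OF Suc.prems(1) that] diff_upto_has_derivative[OF Suc.prems(2) that]] .
    show "diff_upto n U (\<lambda>p. B (f p) (frechet_derivative g (at p) v) + B (frechet_derivative f (at p) v) (g p))" for v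
      by (intro diff_upto_add assms Suc.IH diff_upto_SucD[OF Suc.prems(1)] diff_upto_SucD[OF Suc.prems(2)])
  qed
qed

lemma diff_upto_compose:
  fixes g :: "real \<Rightarrow> 'b::real_normed_vector" and f :: "'a::real_normed_vector \<Rightarrow> real"
  assumes "open U" "open S" "\<And>p. p \<in> U \<Longrightarrow> f p \<in> S"
  shows "diff_upto n S g \<Longrightarrow> diff_upto n U f \<Longrightarrow> diff_upto n U (\<lambda>p. g (f p))"
proof (induction n arbitrary: g)
  case 0
  then show ?case
    unfolding diff_upto_0 using differentiable_chain_at[of f _ g, unfolded o_def] assms(3) by blast
next
  case (Suc n)
  \<comment> \<open>The argument of \<open>g\<close> is real, so its derivative is determined by its
    value at 1. The derivative of the composition thus becomes a product of functions of lower
    level.\<close>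
  have fd: "frechet_derivative f (at p) v *\<^sub>R frechet_derivative g (at (f p)) 1 =
            frechet_derivative g (at (f p)) (frechet_derivative f (at p) v)" if "p \<in> U" for p v
  proof -
    have "linear (frechet_derivative g (at (f p)))"
      using diff_upto_has_derivative[OF Suc.prems(1) assms(3)[OF that]] has_derivative_linear by blast
    from linear_scale[OF this, of "frechet_derivative f (at p) v" 1] show ?thesis by simp
  qed
  show ?case
  proof (rule diff_upto_SucI[OF assms(1)])
    show "((\<lambda>p. g (f p)) has_derivative
       (\<lambda>v. frechet_derivative f (at p) v *\<^sub>R frechet_derivative g (at (f p)) 1)) (at p)" if "p \<in> U" for p
      unfolding fd[OF that]
      using diff_chain_at[OF diff_upto_has_derivative[OF Suc.prems(2) that] diff_upto_has_derivative[OF Suc.prems(1) assms(3)[OF that]]]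
      by (simp add: o_def)
    show "diff_upto n U (\<lambda>p. frechet_derivative f (at p) v *\<^sub>R frechet_derivative g (at (f p)) 1)" for v
      by (intro diff_upto_bilinear[OF bounded_bilinear_scaleR] assms
          Suc.IH[of "\<lambda>t. frechet_derivative g (at t) 1"]
          diff_upto_SucD[OF Suc.prems(1)] diff_upto_SucD[OF Suc.prems(2)])
  qed
qed

lemma smooth_on_open: "smooth_on U f \<Longrightarrow> open U"
  by (simp add: smooth_on_def)

lemma smooth_on_const: "open U \<Longrightarrow> smooth_on U (\<lambda>p. c)"
  by (simp add: smooth_on_iff_diff_upto diff_upto_const)

lemma smooth_on_bounded_linear: "bounded_linear L \<Longrightarrow> smooth_on U f \<Longrightarrow> smooth_on U (\<lambda>p. L (f p))"
  by (simp add: smooth_on_iff_diff_upto diff_upto_linear)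

lemma smooth_on_bilinear:
  "bounded_bilinear B \<Longrightarrow> smooth_on U f \<Longrightarrow> smooth_on U g \<Longrightarrow> smooth_on U (\<lambda>p. B (f p) (g p))"
  by (simp add: smooth_on_iff_diff_upto diff_upto_bilinear)

lemma smooth_on_compose:
  fixes g :: "real \<Rightarrow> 'b::real_normed_vector"
  shows "smooth_on S g \<Longrightarrow> smooth_on U f \<Longrightarrow> (\<And>p. p \<in> U \<Longrightarrow> f p \<in> S) \<Longrightarrow> smooth_on U (\<lambda>p. g (f p))"
  unfolding smooth_on_iff_diff_upto using diff_upto_compose[of U S f _ g] by blast

lemma smooth_on_add: "smooth_on U f \<Longrightarrow> smooth_on U g \<Longrightarrow> smooth_on U (\<lambda>p. f p + g p)"
  by (simp add: smooth_on_iff_diff_upto diff_upto_add)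

lemma smooth_on_uminus: "smooth_on U f \<Longrightarrow> smooth_on U (\<lambda>p. - f p)"
  by (rule smooth_on_bounded_linear[OF bounded_linear_minus[OF bounded_linear_ident]])

lemma smooth_on_diff: "smooth_on U f \<Longrightarrow> smooth_on U g \<Longrightarrow> smooth_on U (\<lambda>p. f p - g p)"
  using smooth_on_add[OF _ smooth_on_uminus] by fastforce

lemma smooth_on_cong:
  "smooth_on U f \<Longrightarrow> (\<And>p. p \<in> U \<Longrightarrow> f p = g p) \<Longrightarrow> smooth_on U g"
  unfolding smooth_on_iff_diff_upto using diff_upto_cong[of U f g] by blast

lemma smooth_on_has_derivative:
  "smooth_on U f \<Longrightarrow> p \<in> U \<Longrightarrow> (f has_derivative frechet_derivative f (at p)) (at p)"
  using diff_upto_has_derivative[of 0 U f p] by (auto simp: smooth_on_iff_diff_upto)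

lemma smooth_on_frechet_derivative: "smooth_on U f \<Longrightarrow> smooth_on U (\<lambda>p. frechet_derivative f (at p) v)"
  unfolding smooth_on_iff_diff_upto using diff_upto_SucD(2) by blast

lemma smooth_onI_derivative:
  assumes "open U" "\<And>p. p \<in> U \<Longrightarrow> (f has_derivative D p) (at p)" "\<And>v. smooth_on U (\<lambda>p. D p v)"
  shows "smooth_on U f"
  unfolding smooth_on_iff_diff_upto
proof (intro conjI allI assms)
  show "diff_upto n U f" for n
    by (rule diff_upto_SucD(1), rule diff_upto_SucI[OF assms(1,2)])
      (use assms(3) in \<open>auto simp: smooth_on_iff_diff_upto\<close>)
qed

lemma smooth_on_continuous: "smooth_on U f \<Longrightarrow> continuous_on U f"
  by (meson continuous_at_imp_continuous_on has_derivative_continuous smooth_on_has_derivative)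

lemma smooth_on_real_exp: "smooth (exp :: real \<Rightarrow> real)"
proof -
  have "diff_upto n UNIV (exp :: real \<Rightarrow> real)" for n
  proof (induction n)
    case (Suc n)
    show ?case
    proof (rule diff_upto_SucI)
      show "(exp has_derivative (\<lambda>v. exp p * v)) (at p)" for p :: real
        by (auto intro!: derivative_eq_intros)
      show "diff_upto n UNIV (\<lambda>p. exp p * v)" for v :: real
        by (intro diff_upto_bilinear[OF bounded_bilinear_mult] Suc diff_upto_const) auto
    qed auto
  qed (auto simp: diff_upto_0 intro!: derivative_eq_intros field_differentiable_imp_differentiable field_differentiable_within_exp)
  then show ?thesis by (auto simp: smooth_on_iff_diff_upto)
qed

lemma smooth_on_real_sin_cos:
  "smooth (sin :: real \<Rightarrow> real)" "smooth (cos :: real \<Rightarrow> real)"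
proof -
  have "diff_upto n UNIV (sin :: real \<Rightarrow> real) \<and> diff_upto n UNIV (cos :: real \<Rightarrow> real)" for n
  proof (induction n)
    case (Suc n)
    show ?case
    proof (intro conjI diff_upto_SucI)
      show "(sin has_derivative (\<lambda>v. cos p * v)) (at p)" for p :: real
        by (auto intro!: derivative_eq_intros)
      show "(cos has_derivative (\<lambda>v. sin p * (- v))) (at p)" for p :: real
        by (auto intro!: derivative_eq_intros)
      show "diff_upto n UNIV (\<lambda>p. cos p * v)" "diff_upto n UNIV (\<lambda>p. sin p * (-v))" for v :: real
        by (intro diff_upto_bilinear[OF bounded_bilinear_mult] Suc[THEN conjunct1] Suc[THEN conjunct2] diff_upto_const; simp)+
    qed auto
  qed (auto simp: diff_upto_0 intro!: field_differentiable_imp_differentiable field_differentiable_within_sin field_differentiable_within_cos)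
  then show "smooth (sin :: real \<Rightarrow> real)" "smooth (cos :: real \<Rightarrow> real)" by (auto simp: smooth_on_iff_diff_upto)
qed

lemma smooth_on_inverse:
  fixes f :: "'a::real_normed_vector \<Rightarrow> 'b::real_normed_field"
  assumes "smooth_on U f" "\<And>p. p \<in> U \<Longrightarrow> f p \<noteq> 0"
  shows "smooth_on U (\<lambda>p. inverse (f p))"
proof -
  have "diff_upto n U (\<lambda>p. inverse (f p))" for n
  proof (induction n)
    case 0
    have "f differentiable (at p)" if "p \<in> U" for p
      using smooth_on_has_derivative[OF assms(1) that] by (auto simp: differentiable_def)
    then show ?case using assms(2) unfolding diff_upto_0 by (simp add: differentiable_inverse)
  next
    case (Suc n)
    show ?case
    proof (rule diff_upto_SucI)
      \<comment> \<open>The derivative is written with two factors \<open>inverse (f p)\<close>, to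
        which the induction hypothesis applies.\<close>
      show "((\<lambda>p. inverse (f p)) has_derivative (\<lambda>v. (inverse (f p) * inverse (f p)) * (- frechet_derivative f (at p) v))) (at p)" if "p \<in> U" for p
        using smooth_on_has_derivative[OF assms(1) that] assms(2)[OF that] 
        by (auto intro!: derivative_eq_intros)
      show "diff_upto n U (\<lambda>p. (inverse (f p) * inverse (f p)) * (- frechet_derivative f (at p) v))" for v
        using smooth_on_uminus[OF smooth_on_frechet_derivative[OF assms(1)]]
        by (intro diff_upto_bilinear[OF bounded_bilinear_mult] Suc) (auto simp: smooth_on_iff_diff_upto)
    qed (use assms smooth_on_open in auto)
  qed
  then show ?thesis using assms smooth_on_open by (auto simp: smooth_on_iff_diff_upto)
qed

lemma smooth_on_mult:
  fixes f g :: "'a::real_normed_vector \<Rightarrow> 'b::real_normed_algebra"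
  shows "smooth_on U f \<Longrightarrow> smooth_on U g \<Longrightarrow> smooth_on U (\<lambda>p. f p * g p)"
  by (rule smooth_on_bilinear[OF bounded_bilinear_mult])

lemma smooth_on_divide:
  fixes f g :: "'a::real_normed_vector \<Rightarrow> 'b::real_normed_field"
  shows "smooth_on U f \<Longrightarrow> smooth_on U g \<Longrightarrow> (\<And>p. p \<in> U \<Longrightarrow> g p \<noteq> 0) \<Longrightarrow> smooth_on U (\<lambda>p. f p / g p)"
  unfolding divide_inverse by (intro smooth_on_mult smooth_on_inverse)

lemma smooth_on_power:
  fixes f :: "'a::real_normed_vector \<Rightarrow> 'b::real_normed_field"
  shows "smooth_on U f \<Longrightarrow> smooth_on U (\<lambda>p. f p ^ n)"
  by (induction n) (auto intro: smooth_on_mult smooth_on_const smooth_on_open)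

lemma smooth_on_ident: "open U \<Longrightarrow> smooth_on U (\<lambda>p. p)"
  by (rule smooth_onI_derivative[of _ _ "\<lambda>_ v. v"]) (auto intro: smooth_on_const)

lemma smooth_on_ln: "smooth_on {0<..} (ln :: real \<Rightarrow> real)"
proof (rule smooth_onI_derivative)
  show "(ln has_derivative (\<lambda>v. inverse p * v)) (at p)" if "p \<in> {0<..}" for p :: real
    using that by (auto intro!: derivative_eq_intros simp: field_simps)
  show "smooth_on {0<..} (\<lambda>p. inverse p * v)" for v :: real
    by (intro smooth_on_mult smooth_on_inverse smooth_on_ident smooth_on_const) auto
qed auto

lemma smooth_on_sqrt:
  assumes "smooth_on U f" "\<And>p. p \<in> U \<Longrightarrow> f p > 0"
  shows "smooth_on U (\<lambda>p. sqrt (f p))"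
proof (rule smooth_on_cong)
  show "smooth_on U (\<lambda>p. exp (ln (f p) * (1/2)))"
    using assms smooth_on_open[OF assms(1)]
    by (intro smooth_on_compose[OF smooth_on_real_exp] smooth_on_mult smooth_on_const
        smooth_on_compose[OF smooth_on_ln]) auto
  show "exp (ln (f p) * (1/2)) = sqrt (f p)" if "p \<in> U" for p
    using assms(2)[OF that] by (simp add: powr_half_sqrt[symmetric] powr_def)
qed

lemmas smooth_on_scaleR = smooth_on_bilinear[OF bounded_bilinear_scaleR]
lemmas smooth_on_inner = smooth_on_bilinear[OF bounded_bilinear_inner]

lemma bounded_bilinear_cross3: "bounded_bilinear (cross3)"
  by (simp add: bilinear_conv_bounded_bilinear[symmetric] bilinear_cross)

lemmas smooth_on_cross3 = smooth_on_bilinear[OF bounded_bilinear_cross3]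
lemmas smooth_on_Re = smooth_on_bounded_linear[OF bounded_linear_Re]
lemmas smooth_on_Im = smooth_on_bounded_linear[OF bounded_linear_Im]
lemmas smooth_on_cnj = smooth_on_bounded_linear[OF bounded_linear_cnj]
lemmas smooth_on_of_real = smooth_on_bounded_linear[OF bounded_linear_of_real]

lemma smooth_on_Complex:
  assumes "smooth_on U f" "smooth_on U g"
  shows "smooth_on U (\<lambda>p. Complex (f p) (g p))"
  unfolding Complex_eq
  by (intro smooth_on_add smooth_on_mult smooth_on_of_real assms smooth_on_const smooth_on_open[OF assms(1)])

section \<open>Partial derivatives in the two coordinates and their symmetry\<close>

definition pdu :: "(real \<times> real \<Rightarrow> 'b::real_normed_vector) \<Rightarrow> real \<times> real \<Rightarrow> 'b" where
  "pdu f p = frechet_derivative f (at p) (1, 0)"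

definition pdv :: "(real \<times> real \<Rightarrow> 'b::real_normed_vector) \<Rightarrow> real \<times> real \<Rightarrow> 'b" where
  "pdv f p = frechet_derivative f (at p) (0, 1)"

lemma smooth_on_pdu: "smooth_on U f \<Longrightarrow> smooth_on U (pdu f)"
  and smooth_on_pdv: "smooth_on U f \<Longrightarrow> smooth_on U (pdv f)"
  unfolding pdu_def pdv_def using smooth_on_frechet_derivative by blast+

lemma frechet_derivative_pd:
  assumes "(f has_derivative D) (at p)"
  shows "pdu f p = D (1, 0)" "pdv f p = D (0, 1)"
  using frechet_derivative_at[OF assms] by (auto simp: pdu_def pdv_def)

lemma smooth_on_has_vector_derivative_u:
  assumes "smooth f"
  shows "((\<lambda>s. f (s, t)) has_vector_derivative pdu f (u, t)) (at u)"
proof -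
  have "((\<lambda>s. f (s, t)) has_derivative (\<lambda>h. frechet_derivative f (at (u,t)) (h, 0))) (at u)"
    by (rule has_derivative_compose[of "\<lambda>s. (s, t)" "\<lambda>h. (h, 0)" u _ f, OF _ smooth_on_has_derivative[OF assms], simplified])
      (auto intro!: derivative_eq_intros)
  moreover have "frechet_derivative f (at (u,t)) (h, 0) = h *\<^sub>R pdu f (u, t)" for h
    using linear_scale[OF has_derivative_linear[OF smooth_on_has_derivative[OF assms, of "(u,t)"]], of h "(1,0)"]
    by (simp add: pdu_def)
  ultimately show ?thesis by (simp add: has_vector_derivative_def)
qed

lemma smooth_on_has_vector_derivative_v:
  assumes "smooth f"
  shows "((\<lambda>s. f (u, s)) has_vector_derivative pdv f (u, t)) (at t)"
proof -
  have "((\<lambda>s. f (u, s)) has_derivative (\<lambda>h. frechet_derivative f (at (u,t)) (0, h))) (at t)"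
    by (rule has_derivative_compose[of "\<lambda>s. (u, s)" "\<lambda>h. (0, h)" t _ f, OF _ smooth_on_has_derivative[OF assms], simplified])
      (auto intro!: derivative_eq_intros)
  moreover have "frechet_derivative f (at (u,t)) (0, h) = h *\<^sub>R pdv f (u, t)" for h
    using linear_scale[OF has_derivative_linear[OF smooth_on_has_derivative[OF assms, of "(u,t)"]], of h "(0,1)"]
    by (simp add: pdv_def)
  ultimately show ?thesis by (simp add: has_vector_derivative_def)
qed

lemma frechet_derivative_eq_pd:
  assumes "smooth f"
  shows "frechet_derivative f (at p) c = fst c *\<^sub>R pdu f p + snd c *\<^sub>R pdv f p"
proof -
  have L: "linear (frechet_derivative f (at p))"
    using smooth_on_has_derivative[OF assms] has_derivative_linear by blast
  have "c = fst c *\<^sub>R (1,0) + snd c *\<^sub>R (0,1)" by (simp add: prod_eq_iff)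
  then have "frechet_derivative f (at p) c = frechet_derivative f (at p) (fst c *\<^sub>R (1,0) + snd c *\<^sub>R (0,1))" by simp
  also have "\<dots> = fst c *\<^sub>R pdu f p + snd c *\<^sub>R pdv f p"
    unfolding linear_add[OF L] linear_scale[OF L] pdu_def pdv_def ..
  finally show ?thesis .
qed

text \<open>The increment of \<open>f\<close> in the second variable is the integral of
  \<open>pdv f\<close>. Differentiating it in the first variable under the integral sign, and then
  in the upper limit, produces both mixed derivatives.\<close>

lemma pdu_pdv_commute:
  fixes f :: "real \<times> real \<Rightarrow> 'b::euclidean_space"
  assumes "smooth f"
  shows "pdu (pdv f) p = pdv (pdu f) p"
proof -
  obtain u t where p: "p = (u, t)" by (cases p)
  note S = smooth_on_pdu smooth_on_pdv
  have cont: "continuous_on A (\<lambda>q. g (h q))" if "smooth g" "continuous_on A h" for g :: "real \<times> real \<Rightarrow> 'b" and h :: "'c::topological_space \<Rightarrow> _" and A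
    using continuous_on_compose2[OF smooth_on_continuous[OF that(1)] that(2)] by simp
  \<comment> \<open>A base point strictly below \<open>t\<close>, so that \<open>t\<close> is
    interior to the interval and the one-sided derivative of the integral is two-sided
    there.\<close>
  define c where "c = t - 1"
  have int: "(\<lambda>r. pdv f (s, r)) integrable_on cbox c d" for s d
    by (intro integrable_continuous cont S assms continuous_intros)
  have F: "integral (cbox c d) (\<lambda>r. pdv f (s, r)) = f (s, d) - f (s, c)" if "c \<le> d" for s d
    using fundamental_theorem_of_calculus[OF that, of "\<lambda>r. f (s, r)" "\<lambda>r. pdv f (s, r)"]
      smooth_on_has_vector_derivative_v[OF assms] by (auto intro: has_vector_derivative_at_within integral_unique)
  have L: "((\<lambda>s. integral (cbox c d) (\<lambda>r. pdv f (s, r))) has_vector_derivative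
      integral (cbox c d) (\<lambda>r. pdu (pdv f) (u, r))) (at u within UNIV)" for d
    by (rule leibniz_rule_vector_derivative)
      (auto intro!: smooth_on_has_vector_derivative_u S assms int[unfolded cbox_interval] cont continuous_intros simp: case_prod_beta)
  have L': "((\<lambda>s. f (s, d) - f (s, c)) has_vector_derivative pdu f (u, d) - pdu f (u, c)) (at u)" for d
    by (intro derivative_intros smooth_on_has_vector_derivative_u assms)
  have E: "integral (cbox c d) (\<lambda>r. pdu (pdv f) (u, r)) = pdu f (u, d) - pdu f (u, c)" if "c \<le> d" for d
    by (rule vector_derivative_unique_at[OF L[of d, unfolded F[OF that]] L'])
  have "((\<lambda>d. integral {c..d} (\<lambda>r. pdu (pdv f) (u, r))) has_vector_derivative pdu (pdv f) (u, t)) (at t within {c..t+1})"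
    by (rule integral_has_vector_derivative) (auto simp: c_def intro!: S assms cont continuous_intros)
  then have "((\<lambda>d. pdu f (u, d) - pdu f (u, c)) has_vector_derivative pdu (pdv f) (u, t)) (at t within {c..t+1})"
    by (rule has_vector_derivative_transform[rotated 2]) (use E in \<open>auto simp: c_def\<close>)
  then have 1: "((\<lambda>d. pdu f (u, d) - pdu f (u, c)) has_vector_derivative pdu (pdv f) (u, t)) (at t)"
    by (simp add: at_within_Icc_at c_def)
  have 2: "((\<lambda>d. pdu f (u, d) - pdu f (u, c)) has_vector_derivative pdv (pdu f) (u, t) - 0) (at t)"
    by (intro derivative_intros smooth_on_has_vector_derivative_v S assms)
  show ?thesis
    using vector_derivative_unique_at[OF 1 2] p by simp
qed

section \<open>Integration over the torus\<close>

text \<open>Bare partial derivatives, given by explicit formulas. Integration by parts is later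
  applied to logarithms and quotients whose derivatives are known in closed form, and it then needs
  only continuity besides.\<close>

definition has_pu :: "(real \<times> real \<Rightarrow> real) \<Rightarrow> (real \<times> real \<Rightarrow> real) \<Rightarrow> bool" where
  "has_pu f f' \<longleftrightarrow> (\<forall>u t. ((\<lambda>s. f (s, t)) has_real_derivative f' (u, t)) (at u))"

definition has_pv :: "(real \<times> real \<Rightarrow> real) \<Rightarrow> (real \<times> real \<Rightarrow> real) \<Rightarrow> bool" where
  "has_pv f f' \<longleftrightarrow> (\<forall>u t. ((\<lambda>s. f (u, s)) has_real_derivative f' (u, t)) (at t))"

abbreviation Q :: "(real \<times> real) set" where "Q \<equiv> cbox (0,0) (1,1)"

lemma integrable_Q: "continuous_on UNIV f \<Longrightarrow> f integrable_on Q" for f :: "real \<times> real \<Rightarrow> real"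
  by (rule integrable_continuous) (rule continuous_on_subset, auto)

lemma has_pu_mult: "has_pu f f' \<Longrightarrow> has_pu g g' \<Longrightarrow> has_pu (\<lambda>p. f p * g p) (\<lambda>p. f' p * g p + f p * g' p)"
  unfolding has_pu_def by (auto intro!: derivative_eq_intros)

lemma has_pv_mult: "has_pv f f' \<Longrightarrow> has_pv g g' \<Longrightarrow> has_pv (\<lambda>p. f p * g p) (\<lambda>p. f' p * g p + f p * g' p)"
  unfolding has_pv_def by (auto intro!: derivative_eq_intros)

text \<open>Fubini: integrating first in the direction of differentiation gives a difference of two
  values that agree by periodicity.\<close>

lemma integral_pu_eq_0:
  assumes "has_pu f f'" "continuous_on UNIV f'" "torus_periodic f"
  shows "integral Q f' = 0"
proof -
  have c: "continuous_on (cbox (0,0) (1,1)) (\<lambda>(x, y). f' (x, y))"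
    using assms(2) continuous_on_subset by auto
  have z: "integral (cbox 0 1) (\<lambda>x. f' (x, y)) = 0" for y
  proof -
    have "((\<lambda>x. f' (x, y)) has_integral (f (1, y) - f (0, y))) {0..1}"
      by (rule fundamental_theorem_of_calculus)
        (use assms(1) in \<open>auto simp: has_pu_def has_real_derivative_iff_has_vector_derivative[symmetric] intro: has_field_derivative_at_within\<close>)
    moreover have "f (1, y) = f (0, y)"
      using assms(3) unfolding torus_periodic_def by (metis add_0)
    ultimately show ?thesis by (auto simp: integral_unique)
  qed
  have "integral Q f' = integral (cbox 0 1) (\<lambda>x. integral (cbox 0 1) (\<lambda>y. f' (x, y)))"
    using integral_prod_continuous[of 0 0 1 1 f'] c by simp
  also have "\<dots> = integral (cbox 0 1) (\<lambda>y. integral (cbox 0 1) (\<lambda>x. f' (x, y)))"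
    by (rule integral_swap_continuous[OF c])
  also have "\<dots> = 0" using z by simp
  finally show ?thesis .
qed

lemma integral_pv_eq_0:
  assumes "has_pv f f'" "continuous_on UNIV f'" "torus_periodic f"
  shows "integral Q f' = 0"
proof -
  have z: "integral (cbox 0 1) (\<lambda>y. f' (x, y)) = 0" for x
  proof -
    have "((\<lambda>y. f' (x, y)) has_integral (f (x, 1) - f (x, 0))) {0..1}"
      by (rule fundamental_theorem_of_calculus)
        (use assms(1) in \<open>auto simp: has_pv_def has_real_derivative_iff_has_vector_derivative[symmetric] intro: has_field_derivative_at_within\<close>)
    moreover have "f (x, 1) = f (x, 0)"
      using assms(3) unfolding torus_periodic_def by (metis add_0)
    ultimately show ?thesis by (auto simp: integral_unique)
  qed
  have "integral Q f' = integral (cbox 0 1) (\<lambda>x. integral (cbox 0 1) (\<lambda>y. f' (x, y)))"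
    using integral_prod_continuous[of 0 0 1 1 f'] assms(2) continuous_on_subset by blast
  also have "\<dots> = 0" using z by simp
  finally show ?thesis .
qed

lemma integral_pu_by_parts:
  assumes "has_pu f f'" "has_pu g g'" "continuous_on UNIV f" "continuous_on UNIV g"
    "continuous_on UNIV f'" "continuous_on UNIV g'" "torus_periodic f" "torus_periodic g"
  shows "integral Q (\<lambda>p. f' p * g p) = - integral Q (\<lambda>p. f p * g' p)"
proof -
  have "integral Q (\<lambda>p. f' p * g p + f p * g' p) = 0"
    by (rule integral_pu_eq_0[OF has_pu_mult[OF assms(1,2)]])
      (use assms in \<open>auto intro!: continuous_intros simp: torus_periodic_def\<close>)
  moreover have "integral Q (\<lambda>p. f' p * g p + f p * g' p) = integral Q (\<lambda>p. f' p * g p) + integral Q (\<lambda>p. f p * g' p)"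
    by (intro integral_add integrable_Q continuous_intros assms)
  ultimately show ?thesis by simp
qed

lemma integral_pv_by_parts:
  assumes "has_pv f f'" "has_pv g g'" "continuous_on UNIV f" "continuous_on UNIV g"
    "continuous_on UNIV f'" "continuous_on UNIV g'" "torus_periodic f" "torus_periodic g"
  shows "integral Q (\<lambda>p. f' p * g p) = - integral Q (\<lambda>p. f p * g' p)"
proof -
  have "integral Q (\<lambda>p. f' p * g p + f p * g' p) = 0"
    by (rule integral_pv_eq_0[OF has_pv_mult[OF assms(1,2)]])
      (use assms in \<open>auto intro!: continuous_intros simp: torus_periodic_def\<close>)
  moreover have "integral Q (\<lambda>p. f' p * g p + f p * g' p) = integral Q (\<lambda>p. f' p * g p) + integral Q (\<lambda>p. f p * g' p)"
    by (intro integral_add integrable_Q continuous_intros assms)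
  ultimately show ?thesis by simp
qed

lemma integral_Q_const: "integral Q (\<lambda>_. c) = (c :: real)"
  by (simp add: content_Pair)

lemma integral_Q_mono:
  fixes f g :: "real \<times> real \<Rightarrow> real"
  assumes "continuous_on UNIV f" "continuous_on UNIV g" "\<And>p. f p \<le> g p"
  shows "integral Q f \<le> integral Q g"
  by (rule integral_le) (auto intro: integrable_Q assms)

lemma integral_Q_nonneg:
  fixes f :: "real \<times> real \<Rightarrow> real"
  assumes "continuous_on UNIV f" "\<And>p. 0 \<le> f p"
  shows "0 \<le> integral Q f"
  by (rule integral_nonneg) (auto intro: integrable_Q assms)

section \<open>Compactness of the torus, and a Poincare inequality\<close>

lemma torus_periodic_int:
  assumes "torus_periodic f"
  shows "f (u + of_int m, t + of_int n) = f (u, t)"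
proof -
  have a: "f (u + of_nat k, t) = f (u, t)" for u t k
    by (induction k) (use assms in \<open>auto simp: torus_periodic_def add.assoc[symmetric] add.commute[of 1]\<close>)
  have b: "f (u, t + of_nat k) = f (u, t)" for u t k
    by (induction k) (use assms in \<open>auto simp: torus_periodic_def add.assoc[symmetric] add.commute[of 1]\<close>)
  have a': "f (u + of_int m, t) = f (u, t)" for u t m
  proof (cases m)
    case (nonneg n) then show ?thesis using a by simp
  next
    case (neg n)
    then show ?thesis using a[of "u + of_int m" "Suc n" t] by simp
  qed
  have b': "f (u, t + of_int m) = f (u, t)" for u t m
  proof (cases m)
    case (nonneg n) then show ?thesis using b by simp
  next
    case (neg n)
    then show ?thesis using b[of u "t + of_int m" "Suc n"] by simp
  qed
  show ?thesis using a' b' by simp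
qed

lemma torus_periodic_frac: "torus_periodic f \<Longrightarrow> f (u, t) = f (frac u, frac t)"
  using torus_periodic_int[of f "frac u" "\<lfloor>u\<rfloor>" "frac t" "\<lfloor>t\<rfloor>"] by (simp add: frac_def)

lemma frac_in_Q: "(frac u, frac t) \<in> Q"
  using frac_lt_1[of u] frac_lt_1[of t] by (auto simp: cbox_Pair_eq)

lemma torus_bounded:
  fixes f :: "real \<times> real \<Rightarrow> real"
  assumes "continuous_on UNIV f" "torus_periodic f"
  obtains C where "C > 0" "\<And>p. \<bar>f p\<bar> \<le> C"
proof -
  have "compact (f ` Q)"
    by (intro compact_continuous_image continuous_on_subset[OF assms(1)]) auto
  then obtain C where C: "\<And>p. p \<in> Q \<Longrightarrow> \<bar>f p\<bar> \<le> C"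
    unfolding bounded_iff[symmetric] using compact_imp_bounded[THEN bounded_pos[THEN iffD1]] by (metis image_eqI real_norm_def)
  have "\<bar>f p\<bar> \<le> max C 1" for p
    using C[OF frac_in_Q] torus_periodic_frac[OF assms(2)] by (cases p) (metis max.coboundedI1)
  then show ?thesis by (intro that[of "max C 1"]) auto
qed

lemma torus_attains_sup:
  fixes f :: "real \<times> real \<Rightarrow> real"
  assumes "continuous_on UNIV f" "torus_periodic f"
  obtains p where "\<And>q. f q \<le> f p"
proof -
  have "\<exists>p\<in>Q. \<forall>q\<in>Q. f q \<le> f p"
    by (rule continuous_attains_sup)
      (use frac_in_Q[of 0 0] in \<open>auto intro: continuous_on_subset[OF assms(1)] simp del: cbox_Pair_iff\<close>)
  then obtain p where p: "\<And>q. q \<in> Q \<Longrightarrow> f q \<le> f p" by blast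
  have "f q \<le> f p" for q
    using p[OF frac_in_Q] torus_periodic_frac[OF assms(2)] by (cases q) metis
  then show ?thesis by (rule that)
qed

lemma abs_diff_le_integral_deriv:
  fixes f f' :: "real \<Rightarrow> real"
  assumes "\<And>x. (f has_real_derivative f' x) (at x)" "continuous_on UNIV f'"
    "a \<in> {0..1}" "b \<in> {0..1}"
  shows "\<bar>f b - f a\<bar> \<le> integral {0..1} (\<lambda>x. \<bar>f' x\<bar>)"
  using assms(3,4)
proof (induction a b rule: linorder_wlog)
  case (le a b)
  have I: "(f' has_integral (f b - f a)) {a..b}"
    by (rule fundamental_theorem_of_calculus)
      (use le assms(1) in \<open>auto simp: has_real_derivative_iff_has_vector_derivative[symmetric] intro: has_field_derivative_at_within\<close>)
  have c: "continuous_on S (\<lambda>x. \<bar>f' x\<bar>)" for S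
    using assms(2) by (intro continuous_intros) (auto intro: continuous_on_subset)
  have "\<bar>f b - f a\<bar> = norm (integral {a..b} f')" using I by (simp add: integral_unique)
  also have "\<dots> \<le> integral {a..b} (\<lambda>x. norm (f' x))"
    by (rule integral_norm_bound_integral) (use I c in \<open>auto intro!: integrable_continuous_real has_integral_integrable[OF I]\<close>)
  also have "\<dots> \<le> integral {0..1} (\<lambda>x. \<bar>f' x\<bar>)"
    using le by (simp, intro integral_subset_le) (auto intro!: integrable_continuous_real c)
  finally show ?case .
next
  case (sym a b)
  then show ?case by (simp add: abs_minus_commute)
qed

text \<open>A point \<open>(u, t)\<close> is reached from \<open>(s, r)\<close> vertically and then
  horizontally, at a cost of at most \<open>I1 s + I2 t\<close>. Averaging over \<open>s\<close> in
  \<open>[a, b]\<close> turns \<open>I1 s\<close> into an integral over the cell, with the factor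
  \<open>1 / (b - a)\<close>. A single starting point would not do, since one vertical line is not
  controlled by an area integral.\<close>

lemma integral_le_segment_variation:
  assumes w: "has_pu w wu" "has_pv w wv"
    and c: "continuous_on UNIV w" "continuous_on UNIV wu" "continuous_on UNIV wv"
    and ab: "0 \<le> a" "a < b" "b \<le> 1" "0 \<le> r" "r \<le> 1"
    and seg: "\<And>s. a \<le> s \<Longrightarrow> s \<le> b \<Longrightarrow> w (s, r) \<le> W"
  shows "integral Q w \<le> W + integral Q (\<lambda>p. \<bar>wv p\<bar>) / (b - a) + integral Q (\<lambda>p. \<bar>wu p\<bar>)"
proof -
  define I1 where "I1 s = integral {0..1} (\<lambda>x. \<bar>wv (s, x)\<bar>)" for s
  define I2 where "I2 t = integral {0..1} (\<lambda>x. \<bar>wu (x, t)\<bar>)" for t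
  note [continuous_intros] = continuous_on_compose2[OF c(1)] continuous_on_compose2[OF c(2)] continuous_on_compose2[OF c(3)]
  have cI1: "continuous_on A I1" for A
    unfolding I1_def interval_cbox
    by (rule integral_continuous_on_param) (auto simp: case_prod_beta intro!: continuous_intros)
  have cI2: "continuous_on A I2" for A
    unfolding I2_def interval_cbox
    by (rule integral_continuous_on_param) (auto simp: case_prod_beta intro!: continuous_intros)
  have Q1: "integral Q (\<lambda>p. \<bar>wv p\<bar>) = integral {0..1} I1"
    unfolding I1_def interval_cbox by (rule integral_prod_continuous) (auto intro!: continuous_intros)
  have Q2: "integral Q (\<lambda>p. \<bar>wu p\<bar>) = integral {0..1} I2"
  proof -
    have "integral Q (\<lambda>p. \<bar>wu p\<bar>) = integral (cbox 0 1) (\<lambda>x. integral (cbox 0 1) (\<lambda>y. \<bar>wu (x, y)\<bar>))"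
      by (rule integral_prod_continuous) (auto intro!: continuous_intros)
    also have "\<dots> = integral (cbox 0 1) (\<lambda>y. integral (cbox 0 1) (\<lambda>x. \<bar>wu (x, y)\<bar>))"
      by (rule integral_swap_continuous) (auto simp: case_prod_beta intro!: continuous_intros)
    finally show ?thesis by (simp add: I2_def[abs_def])
  qed
  have Q2': "integral Q (\<lambda>p. I2 (snd p)) = integral {0..1} I2"
  proof -
    have "integral Q (\<lambda>p. I2 (snd p)) = integral (cbox 0 1) (\<lambda>x::real. integral (cbox 0 1) (\<lambda>y. I2 (snd (x, y))))"
      by (rule integral_prod_continuous) (auto intro!: continuous_on_compose2[OF cI2] continuous_intros)
    then show ?thesis by simp
  qed
  have pt: "w (u, t) \<le> W + I1 s + I2 t" if "u \<in> {0..1}" "t \<in> {0..1}" "s \<in> {a..b}" for u t s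
  proof -
    have "\<bar>w (u, t) - w (s, t)\<bar> \<le> I2 t"
      unfolding I2_def
      by (rule abs_diff_le_integral_deriv) (use w that ab in \<open>auto simp: has_pu_def intro!: continuous_intros\<close>)
    moreover have "\<bar>w (s, t) - w (s, r)\<bar> \<le> I1 s"
      unfolding I1_def
      by (rule abs_diff_le_integral_deriv) (use w that ab in \<open>auto simp: has_pv_def intro!: continuous_intros\<close>)
    ultimately show ?thesis using seg[of s] that by auto
  qed
  have fixs: "integral Q w \<le> (W + integral {0..1} I2) + I1 s" if "s \<in> {a..b}" for s
  proof -
    have cc: "continuous_on UNIV (\<lambda>p::real\<times>real. (W + I1 s) + I2 (snd p))"
      by (auto intro!: continuous_intros continuous_on_compose2[OF cI2])
    have "integral Q w \<le> integral Q (\<lambda>p. (W + I1 s) + I2 (snd p))"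
      by (rule integral_le[OF integrable_Q[OF c(1)] integrable_Q[OF cc]])
        (use pt[OF _ _ that] in \<open>auto simp: cbox_Pair_eq add.commute add.left_commute\<close>)
    also have "\<dots> = integral Q (\<lambda>p. W + I1 s) + integral Q (\<lambda>p. I2 (snd p))"
      by (rule integral_add) (auto intro!: integrable_Q continuous_intros continuous_on_compose2[OF cI2])
    also have "\<dots> = (W + I1 s) + integral {0..1} I2"
      unfolding Q2' integral_Q_const ..
    finally show ?thesis by simp
  qed
  have int: "I1 integrable_on {x..y}" for x y
    by (rule integrable_continuous_real[OF cI1])
  have "integral {a..b} (\<lambda>s. integral Q w) \<le> integral {a..b} (\<lambda>s. (W + integral {0..1} I2) + I1 s)"
    by (rule integral_le) (use fixs int in \<open>auto intro!: integrable_add\<close>)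
  also have "\<dots> = integral {a..b} (\<lambda>s. W + integral {0..1} I2) + integral {a..b} I1"
    by (rule integral_add) (use int in auto)
  also have "integral {a..b} I1 \<le> integral {0..1} I1"
    by (rule integral_subset_le) (use ab int in \<open>auto simp: I1_def intro!: integral_nonneg integrable_continuous_real continuous_intros\<close>)
  finally have "(b - a) * integral Q w \<le> (b - a) * (W + integral {0..1} I2) + integral {0..1} I1"
    using ab by simp
  then have "(b - a) * (integral Q w - W - integral {0..1} I2) \<le> integral {0..1} I1"
    by (simp add: algebra_simps)
  then have "integral Q w - W - integral {0..1} I2 \<le> integral {0..1} I1 / (b - a)"
    using ab by (simp add: pos_le_divide_eq mult.commute)
  then show ?thesis by (simp add: Q1 Q2)
qed

text \<open>Young's inequality in place of Cauchy-Schwarz. The free weight \<open>s\<close> will be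
  the square root of the logarithmic scale, which balances the two terms.\<close>

lemma integral_abs_le:
  assumes "continuous_on UNIV f" "continuous_on UNIV g" "\<And>p. (f p)\<^sup>2 \<le> g p" "s > 0"
  shows "integral Q (\<lambda>p. \<bar>f p\<bar> :: real) \<le> (integral Q g / s + s) / 2"
proof -
  have "integral Q (\<lambda>p. \<bar>f p\<bar>) \<le> integral Q (\<lambda>p. 1 / (2 * s) * g p + s / 2)"
  proof (rule integral_Q_mono)
    fix p
    have "0 \<le> (\<bar>f p\<bar> - s)\<^sup>2" by simp
    then have "2 * s * \<bar>f p\<bar> \<le> g p + s * s"
      using assms(3)[of p] by (simp add: power2_diff power2_eq_square algebra_simps)
    then show "\<bar>f p\<bar> \<le> 1 / (2 * s) * g p + s / 2"
      using assms(4) by (simp add: field_simps)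
  qed (intro continuous_intros assms)+
  also have "\<dots> = integral Q (\<lambda>p. 1 / (2 * s) * g p) + integral Q (\<lambda>p. s / 2)"
    by (intro integral_add integrable_Q continuous_intros assms)
  also have "\<dots> = 1 / (2 * s) * integral Q g + s / 2"
    unfolding integral_mult_right integral_Q_const ..
  finally show ?thesis by (simp add: add_divide_distrib)
qed

section \<open>The logarithmic potential of a point on the torus\<close>

lemma sin_pi_shift: "sin (pi * (x + 1 - c)) = - sin (pi * (x - c))" "cos (pi * (x + 1 - c)) = - cos (pi * (x - c))"
proof -
  have "pi * (x + 1 - c) = pi * (x - c) + pi" by (simp add: algebra_simps)
  then show "sin (pi * (x + 1 - c)) = - sin (pi * (x - c))" "cos (pi * (x + 1 - c)) = - cos (pi * (x - c))"
    by (simp_all only: sin_periodic_pi cos_periodic_pi)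
qed

text \<open>\<open>q\<close> is a periodic substitute for \<open>pi^2\<close> times the squared
  distance to the pole \<open>(u0, t0)\<close>, and \<open>eta\<close> is the logarithm of that
  distance, regularised at scale \<open>sqrt d\<close>. In the plane model its Laplacian is an
  approximate delta function of mass \<open>2 * pi\<close>.\<close>

locale torus_log =
  fixes u0 t0 d :: real
  assumes d: "0 < d" "d \<le> 1"
begin

definition S :: "real \<times> real \<Rightarrow> real" where "S p = (sin (pi * (fst p - u0)))\<^sup>2"
definition R :: "real \<times> real \<Rightarrow> real" where "R p = (sin (pi * (snd p - t0)))\<^sup>2"
definition q :: "real \<times> real \<Rightarrow> real" where "q p = S p + R p"
definition eta :: "real \<times> real \<Rightarrow> real" where "eta p = ln (q p + d) / 2"
definition eu :: "real \<times> real \<Rightarrow> real" where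
  "eu p = pi * (sin (pi * (fst p - u0)) * cos (pi * (fst p - u0))) / (q p + d)"
definition ev :: "real \<times> real \<Rightarrow> real" where
  "ev p = pi * (sin (pi * (snd p - t0)) * cos (pi * (snd p - t0))) / (q p + d)"
definition euu :: "real \<times> real \<Rightarrow> real" where
  "euu p = pi\<^sup>2 * (1 - 2 * S p) / (q p + d) - 2 * pi\<^sup>2 * (S p * (1 - S p)) / (q p + d)\<^sup>2"
definition evv :: "real \<times> real \<Rightarrow> real" where
  "evv p = pi\<^sup>2 * (1 - 2 * R p) / (q p + d) - 2 * pi\<^sup>2 * (R p * (1 - R p)) / (q p + d)\<^sup>2"
definition lap :: "real \<times> real \<Rightarrow> real" where
  "lap p = 2 * pi\<^sup>2 * (d * (1 - q p) - 2 * (S p * R p)) / (q p + d)\<^sup>2"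
text \<open>The Laplacian of the potential is \<open>ker - rem\<close>: \<open>ker\<close> concentrates at the pole as \<open>d\<close> tends to 0,
  while \<open>rem\<close> stays bounded.\<close>
definition ker :: "real \<times> real \<Rightarrow> real" where
  "ker p = 2 * pi\<^sup>2 * (d * max 0 (1 - q p)) / (q p + d)\<^sup>2"
definition rem :: "real \<times> real \<Rightarrow> real" where
  "rem p = 2 * pi\<^sup>2 * (2 * (S p * R p) + d * max 0 (q p - 1)) / (q p + d)\<^sup>2"

lemma SR: "0 \<le> S p" "S p \<le> 1" "0 \<le> R p" "R p \<le> 1"
  unfolding S_def R_def by (auto simp: abs_square_le_1)

lemma qd: "0 \<le> q p" "q p \<le> 2" "0 < q p + d" "q p + d \<noteq> 0"
  using SR[of p] d unfolding q_def by auto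

lemma cont: "continuous_on A S" "continuous_on A R" "continuous_on A q" "continuous_on A eta"
  "continuous_on A eu" "continuous_on A ev" "continuous_on A euu" "continuous_on A evv"
  "continuous_on A lap" "continuous_on A ker" "continuous_on A rem"
proof -
  show a: "continuous_on A S" unfolding S_def by (intro continuous_intros)
  show b: "continuous_on A R" unfolding R_def by (intro continuous_intros)
  show c: "continuous_on A q" unfolding q_def by (intro continuous_intros a b)
  have ne: "\<forall>x\<in>A. q x + d \<noteq> 0" "\<forall>x\<in>A. (q x + d)\<^sup>2 \<noteq> 0" "\<forall>x\<in>A. (2::real) \<noteq> 0"
    using qd by auto
  show "continuous_on A eta" unfolding eta_def by (intro continuous_intros c ne)
  show "continuous_on A eu" unfolding eu_def by (intro continuous_intros c ne)
  show "continuous_on A ev" unfolding ev_def by (intro continuous_intros c ne)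
  show "continuous_on A euu" unfolding euu_def by (intro continuous_intros a c ne)
  show "continuous_on A evv" unfolding evv_def by (intro continuous_intros b c ne)
  show "continuous_on A lap" unfolding lap_def by (intro continuous_intros a b c ne)
  show "continuous_on A ker" unfolding ker_def by (intro continuous_intros a b c ne)
  show "continuous_on A rem" unfolding rem_def by (intro continuous_intros a b c ne)
qed

lemma per: "torus_periodic S" "torus_periodic R" "torus_periodic q" "torus_periodic eta"
  "torus_periodic eu" "torus_periodic ev"
  unfolding torus_periodic_def eta_def eu_def ev_def q_def S_def R_def by (simp_all add: sin_pi_shift)

lemma der_q: "has_pu q (\<lambda>p. 2 * pi * (sin (pi * (fst p - u0)) * cos (pi * (fst p - u0))))"
  "has_pv q (\<lambda>p. 2 * pi * (sin (pi * (snd p - t0)) * cos (pi * (snd p - t0))))"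
  unfolding has_pu_def has_pv_def q_def S_def R_def by (auto intro!: derivative_eq_intros)

lemma ln_half_derivative:
  fixes g :: "real \<Rightarrow> real"
  assumes "(g has_real_derivative 2 * c * a) (at x)" "0 < g x + d"
  shows "((\<lambda>s. ln (g s + d) / 2) has_real_derivative c * a / (g x + d)) (at x)"
  using assms by (auto intro!: derivative_eq_intros simp: field_simps)

lemma der_eta: "has_pu eta eu" "has_pv eta ev"
proof -
  show "has_pu eta eu"
    unfolding has_pu_def eta_def
  proof (intro allI)
    fix u t
    have "((\<lambda>s. q (s, t)) has_real_derivative 2 * pi * (sin (pi * (u - u0)) * cos (pi * (u - u0)))) (at u)"
      using der_q(1) unfolding has_pu_def by simp
    then show "((\<lambda>s. ln (q (s, t) + d) / 2) has_real_derivative eu (u, t)) (at u)"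
      using qd[of "(u,t)"] unfolding eu_def fst_conv by (intro ln_half_derivative)
  qed
  show "has_pv eta ev"
    unfolding has_pv_def eta_def
  proof (intro allI)
    fix u t
    have "((\<lambda>s. q (u, s)) has_real_derivative 2 * pi * (sin (pi * (t - t0)) * cos (pi * (t - t0)))) (at t)"
      using der_q(2) unfolding has_pv_def by simp
    then show "((\<lambda>s. ln (q (u, s) + d) / 2) has_real_derivative ev (u, t)) (at t)"
      using qd[of "(u,t)"] unfolding ev_def snd_conv by (intro ln_half_derivative)
  qed
qed

lemma quotient_second_derivative:
  fixes g :: "real \<Rightarrow> real"
  assumes "(g has_real_derivative 2 * pi * (sin (pi * (x - c)) * cos (pi * (x - c)))) (at x)" "g x + d \<noteq> 0"
  shows "((\<lambda>s. pi * (sin (pi * (s - c)) * cos (pi * (s - c))) / (g s + d)) has_real_derivative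
    pi\<^sup>2 * (1 - 2 * (sin (pi * (x - c)))\<^sup>2) / (g x + d)
    - 2 * pi\<^sup>2 * ((sin (pi * (x - c)))\<^sup>2 * (1 - (sin (pi * (x - c)))\<^sup>2)) / (g x + d)\<^sup>2) (at x)"
proof -
  define a b where "a = sin (pi * (x - c))" and "b = cos (pi * (x - c))"
  have ab: "b * b = 1 - a * a"
    using sin_cos_squared_add2[of "pi * (x - c)"] unfolding a_def b_def power2_eq_square by linarith
  have "((\<lambda>s. pi * (sin (pi * (s - c)) * cos (pi * (s - c))) / (g s + d)) has_real_derivative
    (pi * (b * pi * b + a * (- a * pi)) * (g x + d) - pi * (a * b) * (2 * pi * (a * b))) / ((g x + d) * (g x + d))) (at x)"
    unfolding a_def b_def using assms by (auto intro!: derivative_eq_intros)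
  moreover have "pi * (b * pi * b + a * (- a * pi)) = pi\<^sup>2 * (b * b - a * a)"
    by (simp add: algebra_simps power2_eq_square)
  moreover have "pi * (a * b) * (2 * pi * (a * b)) = 2 * pi\<^sup>2 * (a * a * (b * b))"
    by (simp add: algebra_simps power2_eq_square)
  moreover have "(pi\<^sup>2 * (b * b - a * a) * (g x + d) - 2 * pi\<^sup>2 * (a * a * (b * b))) / ((g x + d) * (g x + d))
     = pi\<^sup>2 * (1 - 2 * a\<^sup>2) / (g x + d) - 2 * pi\<^sup>2 * (a\<^sup>2 * (1 - a\<^sup>2)) / (g x + d)\<^sup>2"
    unfolding ab using assms(2) by (simp add: diff_divide_distrib power2_eq_square)
  ultimately show ?thesis by (simp only: a_def)
qed

lemma der_eu: "has_pu eu euu" "has_pv ev evv"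
  unfolding has_pu_def has_pv_def eu_def ev_def euu_def evv_def S_def R_def fst_conv snd_conv
  using der_q qd by (auto simp: has_pu_def has_pv_def intro!: quotient_second_derivative)

lemma lap_eq: "euu p + evv p = lap p"
proof -
  define e where "e = q p + d"
  have e: "e \<noteq> 0" using qd by (simp add: e_def)
  have "euu p + evv p = pi\<^sup>2 * ((1 - 2 * S p) * e + (1 - 2 * R p) * e - 2 * (S p * (1 - S p)) - 2 * (R p * (1 - R p))) / e\<^sup>2"
    unfolding euu_def evv_def e_def[symmetric] using e by (simp add: field_simps power2_eq_square)
  also have "(1 - 2 * S p) * e + (1 - 2 * R p) * e - 2 * (S p * (1 - S p)) - 2 * (R p * (1 - R p))
      = 2 * (d * (1 - q p) - 2 * (S p * R p))"
    unfolding e_def q_def by (simp add: algebra_simps power2_eq_square)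
  finally show ?thesis unfolding lap_def e_def by simp
qed

lemma lap_ker_rem: "lap p = ker p - rem p"
proof -
  have "d * (1 - q p) - 2 * (S p * R p) = d * max 0 (1 - q p) - (2 * (S p * R p) + d * max 0 (q p - 1))"
    by (auto simp: max_def algebra_simps)
  then show ?thesis unfolding lap_def ker_def rem_def by (simp only: diff_divide_distrib right_diff_distrib)
qed

lemma ker_nonneg: "0 \<le> ker p"
  unfolding ker_def using d by simp

text \<open>\<open>4 S R <= (S + R)^2 = q^2\<close> bounds the quotient uniformly in
  \<open>d\<close>: the two terms contribute at most \<open>1/2\<close> and \<open>1\<close> to the
  factor of \<open>2 * pi^2\<close>. The lower bound uses \<open>q + d <= 3\<close>.\<close>

lemma rem_bounds: "0 \<le> rem p" "rem p \<le> 3 * pi\<^sup>2" "4 * pi\<^sup>2 / 9 * (S p * R p) \<le> rem p"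
proof -
  note qp = qd[of p] and sr = SR[of p]
  show "0 \<le> rem p" unfolding rem_def using d sr by simp
  have "4 * (S p * R p) \<le> (q p)\<^sup>2"
    unfolding q_def using zero_le_power2[of "S p - R p"] by (simp add: power2_eq_square algebra_simps)
  also have "\<dots> \<le> (q p + d)\<^sup>2" using qp d by (intro power_mono) auto
  finally have 1: "4 * (S p * R p) \<le> (q p + d)\<^sup>2" .
  have 2: "d * max 0 (q p - 1) \<le> (q p + d)\<^sup>2"
  proof -
    have "d * max 0 (q p - 1) \<le> d * q p" using d qp by (intro mult_left_mono) auto
    also have "\<dots> \<le> (q p + d)\<^sup>2"
    proof -
      have "0 \<le> q p * d" "0 \<le> (q p)\<^sup>2" "0 \<le> d\<^sup>2" using qp d by auto
      then show ?thesis by (simp add: power2_sum algebra_simps)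
    qed
    finally show ?thesis .
  qed
  have "2 * pi\<^sup>2 * (2 * (S p * R p) + d * max 0 (q p - 1)) \<le> 2 * pi\<^sup>2 * (3/2 * (q p + d)\<^sup>2)"
    using 1 2 by (intro mult_left_mono) auto
  then show "rem p \<le> 3 * pi\<^sup>2"
    unfolding rem_def using qp by (subst pos_divide_le_eq) auto
  have "(q p + d)\<^sup>2 \<le> 3\<^sup>2" using qp d by (intro power_mono) auto
  then have "4 * pi\<^sup>2 / 9 * (S p * R p) * (q p + d)\<^sup>2 \<le> 4 * pi\<^sup>2 / 9 * (S p * R p) * 9"
    using sr by (intro mult_left_mono) auto
  also have "\<dots> \<le> 2 * pi\<^sup>2 * (2 * (S p * R p) + d * max 0 (q p - 1))"
    using d by (simp add: algebra_simps)
  finally show "4 * pi\<^sup>2 / 9 * (S p * R p) \<le> rem p"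
    unfolding rem_def using qp by (subst pos_le_divide_eq) auto
qed

lemma integral_lap: "integral Q lap = 0"
proof -
  have "integral Q euu = 0" "integral Q evv = 0"
    using integral_pu_eq_0[OF der_eu(1)] integral_pv_eq_0[OF der_eu(2)] cont per by auto
  moreover have "integral Q (\<lambda>p. euu p + evv p) = integral Q euu + integral Q evv"
    by (intro integral_add integrable_Q cont)
  ultimately show ?thesis by (simp add: lap_eq)
qed

lemma integral_SR: "integral Q (\<lambda>p. S p * R p) = 1/4"
proof -
  \<comment> \<open>\<open>g\<close> and \<open>h\<close> are periodic antiderivatives of
    \<open>S - 1/2\<close> and \<open>R - 1/2\<close>, the deviations of a squared sine from its
    mean.\<close>
  define g where "g p = - (sin (pi * (fst p - u0)) * cos (pi * (fst p - u0))) / (2 * pi)" for p :: "real \<times> real"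
  define h where "h p = - (sin (pi * (snd p - t0)) * cos (pi * (snd p - t0))) / (2 * pi)" for p :: "real \<times> real"
  have dg: "((\<lambda>s. - (sin (pi * (s - c)) * cos (pi * (s - c))) / (2 * pi)) has_real_derivative (sin (pi * (x - c)))\<^sup>2 - 1/2) (at x)" for c x
  proof -
    have "((\<lambda>s. - (sin (pi * (s - c)) * cos (pi * (s - c))) / (2 * pi)) has_real_derivative
      - (cos (pi * (x - c)) * pi * cos (pi * (x - c)) + sin (pi * (x - c)) * (- sin (pi * (x - c)) * pi)) / (2 * pi)) (at x)"
      by (rule DERIV_cdivide) (auto intro!: derivative_eq_intros)
    moreover have "- (cos (pi * (x - c)) * pi * cos (pi * (x - c)) + sin (pi * (x - c)) * (- sin (pi * (x - c)) * pi)) / (2 * pi)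
       = pi * ((sin (pi * (x - c)))\<^sup>2 - (cos (pi * (x - c)))\<^sup>2) / (2 * pi)"
      by (rule arg_cong[of _ _ "\<lambda>z. z / (2 * pi)"]) (simp add: power2_eq_square algebra_simps)
    moreover have "\<dots> = (sin (pi * (x - c)))\<^sup>2 - 1/2"
      unfolding cos_squared_eq by simp
    ultimately show ?thesis by simp
  qed
  have "has_pu (\<lambda>p. g p * R p) (\<lambda>p. (S p - 1/2) * R p)"
    unfolding has_pu_def g_def S_def R_def using DERIV_cmult_right[OF dg] by auto
  then have 1: "integral Q (\<lambda>p. (S p - 1/2) * R p) = 0"
    by (rule integral_pu_eq_0) (auto simp: torus_periodic_def g_def R_def sin_pi_shift intro!: continuous_intros cont)
  have "has_pv h (\<lambda>p. R p - 1/2)"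
    unfolding has_pv_def h_def R_def using dg by auto
  then have 2: "integral Q (\<lambda>p. R p - 1/2) = 0"
    by (rule integral_pv_eq_0) (auto simp: torus_periodic_def h_def sin_pi_shift intro!: continuous_intros cont)
  have 3: "integral Q (\<lambda>p. R p - 1/2) = integral Q R - integral Q (\<lambda>p. 1/2)"
    by (intro integral_diff integrable_Q cont continuous_intros)
  have "integral Q (\<lambda>p. (S p - 1/2) * R p) = integral Q (\<lambda>p. S p * R p - 1/2 * R p)"
    by (simp add: left_diff_distrib)
  also have "\<dots> = integral Q (\<lambda>p. S p * R p) - integral Q (\<lambda>p. 1/2 * R p)"
    by (intro integral_diff integrable_Q cont continuous_intros)
  also have "integral Q (\<lambda>p. 1/2 * R p) = 1/2 * integral Q R"
    by (rule integral_mult_right)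
  finally show ?thesis using 1 2 3 integral_Q_const[of "1/2"] by simp
qed

text \<open>The Laplacian has mean zero, so the concentrated part has the same mass as the bounded
  part, whose bounds do not involve \<open>d\<close>. No integral near the pole has to be computed;
  \<open>pi^2 / 9\<close> is \<open>4 * pi^2 / 9\<close> times the mean \<open>1/4\<close> of
  \<open>S R\<close>.\<close>

lemma integral_ker: "integral Q ker = integral Q rem" "pi\<^sup>2 / 9 \<le> integral Q ker" "integral Q ker \<le> 3 * pi\<^sup>2"
proof -
  have "integral Q (\<lambda>p. ker p - rem p) = integral Q ker - integral Q rem"
    by (intro integral_diff integrable_Q cont)
  then show 1: "integral Q ker = integral Q rem"
    using integral_lap by (simp add: lap_ker_rem[abs_def])
  have "integral Q (\<lambda>p. 4 * pi\<^sup>2 / 9 * (S p * R p)) \<le> integral Q rem"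
    by (intro integral_Q_mono cont continuous_intros rem_bounds)
  then show "pi\<^sup>2 / 9 \<le> integral Q ker"
    unfolding integral_mult_right integral_SR 1 by simp
  have "integral Q rem \<le> integral Q (\<lambda>p. 3 * pi\<^sup>2)"
    by (intro integral_Q_mono cont continuous_intros rem_bounds)
  then show "integral Q ker \<le> 3 * pi\<^sup>2"
    unfolding integral_Q_const 1 .
qed

lemma eta_bounds: "ln d / 2 \<le> eta p" "eta p \<le> 1"
proof -
  note qp = qd[of p]
  show "ln d / 2 \<le> eta p" unfolding eta_def using qp d by (simp add: ln_mono)
  have "ln (q p + d) \<le> q p + d - 1" using qp by (intro ln_le_minus_one) auto
  then show "eta p \<le> 1" unfolding eta_def using qp d by simp
qed

text \<open>The energy is the integral of \<open>- eta\<close> against the Laplacian. The lower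
  bound of \<open>eta\<close> is used on \<open>ker\<close> and its upper bound on
  \<open>rem\<close>, so the growth is only linear in \<open>- ln d\<close>.\<close>

lemma gradient_eta_le: "integral Q (\<lambda>p. (eu p)\<^sup>2 + (ev p)\<^sup>2) \<le> 3 * pi\<^sup>2 * (1 - ln d / 2)"
proof -
  have "integral Q (\<lambda>p. eu p * eu p) = - integral Q (\<lambda>p. eta p * euu p)"
    by (rule integral_pu_by_parts[OF der_eta(1) der_eu(1)]) (auto intro: cont per)
  moreover have "integral Q (\<lambda>p. ev p * ev p) = - integral Q (\<lambda>p. eta p * evv p)"
    by (rule integral_pv_by_parts[OF der_eta(2) der_eu(2)]) (auto intro: cont per)
  moreover have "integral Q (\<lambda>p. eu p * eu p + ev p * ev p) = integral Q (\<lambda>p. eu p * eu p) + integral Q (\<lambda>p. ev p * ev p)"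
    by (intro integral_add integrable_Q cont continuous_intros)
  moreover have "integral Q (\<lambda>p. eta p * euu p + eta p * evv p) = integral Q (\<lambda>p. eta p * euu p) + integral Q (\<lambda>p. eta p * evv p)"
    by (intro integral_add integrable_Q cont continuous_intros)
  ultimately have "integral Q (\<lambda>p. (eu p)\<^sup>2 + (ev p)\<^sup>2) = - integral Q (\<lambda>p. eta p * lap p)"
    by (simp add: power2_eq_square lap_eq[symmetric] distrib_left)
  also have "\<dots> = integral Q (\<lambda>p. - (eta p * lap p))" by simp
  also have "\<dots> \<le> integral Q (\<lambda>p. (- ln d / 2) * ker p + rem p)"
  proof (intro integral_Q_mono continuous_intros cont)
    fix p
    have "(- eta p) * ker p \<le> (- ln d / 2) * ker p" 
      using eta_bounds[of p] ker_nonneg by (intro mult_right_mono) auto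
    moreover have "eta p * rem p \<le> 1 * rem p" 
      using eta_bounds rem_bounds by (intro mult_right_mono) auto
    ultimately show "- (eta p * lap p) \<le> (- ln d / 2) * ker p + rem p"
      unfolding lap_ker_rem by (simp add: algebra_simps)
  qed
  also have "\<dots> = integral Q (\<lambda>p. (- ln d / 2) * ker p) + integral Q rem"
    by (intro integral_add integrable_Q cont continuous_intros)
  also have "\<dots> = (1 - ln d / 2) * integral Q ker"
    unfolding integral_mult_right integral_ker(1) by (simp add: algebra_simps)
  also have "\<dots> \<le> (1 - ln d / 2) * (3 * pi\<^sup>2)"
    using ln_le_minus_one[of d] d integral_ker by (intro mult_left_mono) auto
  finally show ?thesis by (simp add: mult.commute)
qed

end

section \<open>Zeros of solutions of elliptic systems on the torus\<close>

text \<open>In the application \<open>V\<close> is a multiple of \<open>|h|\<^sup>2\<close>, the form \<open>b1 du + b2 dv\<close> is the conjugate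
  differential of \<open>V\<close>, and \<open>T1 du + T2 dv\<close> is twice the connection form in which \<open>h\<close> is holomorphic.\<close>
locale torus_elliptic =
  fixes V Vu Vv b1 b2 b1v b2u T1 T2 T1v T2u B :: "real \<times> real \<Rightarrow> real" and C K :: real
  assumes per: "torus_periodic V" "torus_periodic b1" "torus_periodic b2" "torus_periodic T1" "torus_periodic T2"
    and cont: "continuous_on UNIV V" "continuous_on UNIV Vu" "continuous_on UNIV Vv"
      "continuous_on UNIV b1" "continuous_on UNIV b2" "continuous_on UNIV b1v" "continuous_on UNIV b2u"
      "continuous_on UNIV T1v" "continuous_on UNIV T2u" "continuous_on UNIV B"
    and der: "has_pu V Vu" "has_pv V Vv" "has_pv b1 b1v" "has_pu b2 b2u" "has_pv T1 T1v" "has_pu T2 T2u"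
    and V_nonneg: "\<And>p. 0 \<le> V p" and V_le: "\<And>p. V p \<le> 1/2" and B_nonneg: "\<And>p. 0 \<le> B p"
    and d_beta: "\<And>p. b2u p - b1v p = B p + V p * (T2u p - T1v p)"
    and dV_beta: "\<And>p. Vu p * b2 p - Vv p * b1 p = V p * B p"
    and grad_V: "\<And>p. (Vu p)\<^sup>2 + (Vv p)\<^sup>2 \<le> C * (V p * B p)"
    and K: "\<And>p. \<bar>T2u p - T1v p\<bar> \<le> K" and C: "0 < C"
begin

text \<open>The negative of the overview's v, up to the scaling of \<open>V\<close>. With
  \<open>V <= 1/2\<close> and \<open>d <= 1/2\<close> the logarithm is nonpositive, so
  \<open>w\<close> is nonnegative and its mean is its L1 norm.\<close>

definition w :: "real \<Rightarrow> real \<times> real \<Rightarrow> real" where "w d p = - ln (V p + d) / 2"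
definition wu :: "real \<Rightarrow> real \<times> real \<Rightarrow> real" where "wu d p = - Vu p / (2 * (V p + d))"
definition wv :: "real \<Rightarrow> real \<times> real \<Rightarrow> real" where "wv d p = - Vv p / (2 * (V p + d))"

context
  fixes d :: real
  assumes d: "0 < d" "d \<le> 1/2"
begin

lemma Vd: "0 < V p + d" "V p + d \<noteq> 0" "V p + d \<le> 1" "2 * V p + 2 * d \<noteq> 0"
  using V_nonneg[of p] V_le[of p] d by auto

lemma w_bounds: "0 \<le> w d p" "w d p \<le> - ln d / 2"
  unfolding w_def using Vd[of p] V_nonneg[of p] d by (auto simp: ln_mono)

lemma cont_w: "continuous_on UNIV (w d)" "continuous_on UNIV (wu d)" "continuous_on UNIV (wv d)"
  unfolding w_def wu_def wv_def using Vd(2,4) by (auto intro!: continuous_intros cont)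

lemma ln_half_derivative:
  fixes g :: "real \<Rightarrow> real"
  assumes "(g has_real_derivative g') (at x)" "0 < g x + d"
  shows "((\<lambda>s. - ln (g s + d) / 2) has_real_derivative - g' / (2 * (g x + d))) (at x)"
  using assms by (auto intro!: derivative_eq_intros simp: divide_simps)

lemma der_w: "has_pu (w d) (wu d)" "has_pv (w d) (wv d)"
  unfolding has_pu_def has_pv_def w_def wu_def wv_def
  by (intro allI ln_half_derivative der(1)[unfolded has_pu_def, rule_format] der(2)[unfolded has_pv_def, rule_format] Vd)+

lemma per_w: "torus_periodic (w d)"
  using per(1) unfolding torus_periodic_def w_def by simp

lemma quotient_derivative:
  fixes f g :: "real \<Rightarrow> real"
  assumes "(f has_real_derivative f') (at x)" "(g has_real_derivative g') (at x)" "g x + d \<noteq> 0"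
  shows "((\<lambda>s. f s / (2 * (g s + d))) has_real_derivative f' / (2 * (g x + d)) - f x * g' / (2 * (g x + d)\<^sup>2)) (at x)"
proof -
  have "((\<lambda>s. f s / (2 * (g s + d))) has_real_derivative
     (f' * (2 * (g x + d)) - f x * (2 * g')) / ((2 * (g x + d)) * (2 * (g x + d)))) (at x)"
    using assms by (auto intro!: derivative_eq_intros)
  moreover have "(f' * (2 * (g x + d)) - f x * (2 * g')) / ((2 * (g x + d)) * (2 * (g x + d)))
     = f' / (2 * (g x + d)) - f x * g' / (2 * (g x + d)\<^sup>2)"
  proof -
    define e where "e = g x + d"
    have "e \<noteq> 0" using assms(3) e_def by simp
    then have "(f' * (2 * e) - f x * (2 * g')) / ((2 * e) * (2 * e)) = f' / (2 * e) - f x * g' / (2 * e\<^sup>2)"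
      by (simp add: diff_divide_distrib power2_eq_square)
    then show ?thesis by (simp add: e_def)
  qed
  ultimately show ?thesis by simp
qed

text \<open>\<open>X1 du + X2 dv\<close> is minus the conjugate differential of \<open>w\<close>,
  and its exterior derivative has density \<open>Z1 + Z2\<close>. Integrated against 1 this controls
  the mass of \<open>Z2 >= 0\<close>; integrated against \<open>w\<close> it gives the integral of
  \<open>D\<close>, which dominates the squared gradient of \<open>w\<close> by
  \<open>grad_V\<close>.\<close>

lemma energy_le:
  "integral Q (\<lambda>p. (wu d p)\<^sup>2 + (wv d p)\<^sup>2)
    \<le> C * (K / 2 * integral Q (w d) + (- ln d / 2) * (K / 2 * integral Q (\<lambda>p. d / (V p + d))))"
proof -
  define X1 where "X1 p = b1 p / (2 * (V p + d))" for p
  define X2 where "X2 p = b2 p / (2 * (V p + d))" for p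
  define X1v where "X1v p = b1v p / (2 * (V p + d)) - b1 p * Vv p / (2 * (V p + d)\<^sup>2)" for p
  define X2u where "X2u p = b2u p / (2 * (V p + d)) - b2 p * Vu p / (2 * (V p + d)\<^sup>2)" for p
  define Z1 where "Z1 p = V p * (T2u p - T1v p) / (2 * (V p + d))" for p
  define Z2 where "Z2 p = d * B p / (2 * (V p + d)\<^sup>2)" for p
  define D where "D p = V p * B p / (4 * (V p + d)\<^sup>2)" for p
  have cX: "continuous_on UNIV X1" "continuous_on UNIV X2" "continuous_on UNIV X1v" "continuous_on UNIV X2u"
    "continuous_on UNIV Z1" "continuous_on UNIV Z2" "continuous_on UNIV D"
    unfolding X1_def X2_def X1v_def X2u_def Z1_def Z2_def D_def using Vd(2,4) by (auto intro!: continuous_intros cont)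
  have dX: "has_pv X1 X1v" "has_pu X2 X2u"
    unfolding has_pv_def has_pu_def X1_def X2_def X1v_def X2u_def
    by (intro allI quotient_derivative Vd der(1,4)[unfolded has_pu_def, rule_format] der(2,3)[unfolded has_pv_def, rule_format])+
  have pX: "torus_periodic X1" "torus_periodic X2"
    using per unfolding torus_periodic_def X1_def X2_def by simp_all
  have dXZ: "X2u p - X1v p = Z1 p + Z2 p" for p
  proof -
    define e where "e = V p + d"
    have e: "e \<noteq> 0" "V p = e - d" using Vd e_def by auto
    have "X2u p - X1v p = (b2u p - b1v p) / (2 * e) - (Vu p * b2 p - Vv p * b1 p) / (2 * e\<^sup>2)"
      unfolding X2u_def X1v_def e_def[symmetric] by (simp add: diff_divide_distrib mult.commute)
    \<comment> \<open>The terms \<open>B / (2 e)\<close> and \<open>V B / (2 e^2)\<close> combine to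
      \<open>d B / (2 e^2)\<close>, because \<open>e - V = d\<close>.\<close>
    also have "\<dots> = Z1 p + Z2 p"
      unfolding d_beta dV_beta Z1_def Z2_def e_def[symmetric] e(2) using e(1)
      by (simp add: field_simps power2_eq_square)
    finally show ?thesis .
  qed
  have wX: "wu d p * X2 p - wv d p * X1 p = - D p" for p
  proof -
    define e where "e = V p + d"
    have "wu d p * X2 p - wv d p * X1 p = - ((Vu p * b2 p - Vv p * b1 p) / (4 * (V p + d)\<^sup>2))"
      unfolding wu_def wv_def X1_def X2_def e_def[symmetric] by (simp add: diff_divide_distrib power2_eq_square)
    then show ?thesis unfolding dV_beta D_def .
  qed
  have "integral Q (\<lambda>p. wu d p * X2 p) = - integral Q (\<lambda>p. w d p * X2u p)"
    by (rule integral_pu_by_parts) (auto intro: der_w dX cont_w cX per_w pX)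
  moreover have "integral Q (\<lambda>p. wv d p * X1 p) = - integral Q (\<lambda>p. w d p * X1v p)"
    by (rule integral_pv_by_parts) (auto intro: der_w dX cont_w cX per_w pX)
  moreover have "integral Q (\<lambda>p. wu d p * X2 p - wv d p * X1 p) = integral Q (\<lambda>p. wu d p * X2 p) - integral Q (\<lambda>p. wv d p * X1 p)"
    by (intro integral_diff integrable_Q continuous_intros cont_w cX)
  moreover have "integral Q (\<lambda>p. w d p * X2u p - w d p * X1v p) = integral Q (\<lambda>p. w d p * X2u p) - integral Q (\<lambda>p. w d p * X1v p)"
    by (intro integral_diff integrable_Q continuous_intros cont_w cX)
  ultimately have iD: "integral Q D = integral Q (\<lambda>p. w d p * (Z1 p + Z2 p))"
    unfolding wX by (simp add: right_diff_distrib[symmetric] dXZ)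
  have "integral Q X2u = 0" "integral Q X1v = 0"
    using integral_pu_eq_0[OF dX(2)] integral_pv_eq_0[OF dX(1)] cX pX by auto
  moreover have "integral Q (\<lambda>p. X2u p - X1v p) = integral Q X2u - integral Q X1v"
    by (intro integral_diff integrable_Q cX)
  moreover have "integral Q (\<lambda>p. Z1 p + Z2 p) = integral Q Z1 + integral Q Z2"
    by (intro integral_add integrable_Q cX)
  ultimately have Z21: "integral Q Z2 = - integral Q Z1" by (simp add: dXZ)
  have "integral Q T2u = 0" "integral Q T1v = 0"
    using integral_pu_eq_0[OF der(6)] integral_pv_eq_0[OF der(5)] cont per by auto
  moreover have "integral Q (\<lambda>p. T2u p - T1v p) = integral Q T2u - integral Q T1v"
    by (intro integral_diff integrable_Q cont)
  ultimately have T0: "integral Q (\<lambda>p. 1/2 * (T2u p - T1v p)) = 0" by (simp only: integral_mult_right) simp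
  have cd: "continuous_on UNIV (\<lambda>p. d / (V p + d))"
    using Vd(2,4) by (auto intro!: continuous_intros cont)
  \<comment> \<open>Adding half of the curvature costs nothing, as its mean is zero, and it improves
    the factor \<open>V / (V + d)\<close> in \<open>Z1\<close> to \<open>d / (V + d)\<close>, which
    is small wherever \<open>V\<close> is much larger than \<open>d\<close>.\<close>
  have "- integral Q Z1 = integral Q (\<lambda>p. 1/2 * (T2u p - T1v p)) - integral Q Z1" using T0 by simp
  also have "\<dots> = integral Q (\<lambda>p. 1/2 * (T2u p - T1v p) - Z1 p)"
    by (rule integral_diff[symmetric]) (intro integrable_Q continuous_intros cont cX)+
  also have "\<dots> \<le> integral Q (\<lambda>p. K / 2 * (d / (V p + d)))"
  proof (rule integral_Q_mono)
    fix p
    define e where "e = V p + d"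
    have e: "e \<noteq> 0" "e > 0" "V p = e - d" using Vd e_def by auto
    have "1/2 * (T2u p - T1v p) - Z1 p = (T2u p - T1v p) / 2 * (d / e)"
      unfolding Z1_def e_def[symmetric] e(3) using e(1) by (simp add: field_simps)
    also have "\<dots> \<le> K / 2 * (d / e)"
      using K[of p] e d by (intro mult_right_mono) auto
    finally show "1/2 * (T2u p - T1v p) - Z1 p \<le> K / 2 * (d / (V p + d))" by (simp add: e_def)
  qed (intro continuous_intros cont cX cd)+
  finally have iZ2: "integral Q Z2 \<le> K / 2 * integral Q (\<lambda>p. d / (V p + d))"
    unfolding Z21 integral_mult_right .
  have "integral Q D \<le> integral Q (\<lambda>p. K / 2 * w d p + (- ln d / 2) * Z2 p)"
    unfolding iD
  proof (rule integral_Q_mono)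
    fix p
    have "Z1 p \<le> K / 2"
    proof -
      have "V p * (T2u p - T1v p) \<le> V p * K" using K[of p] V_nonneg by (intro mult_left_mono) auto
      also have "\<dots> \<le> (V p + d) * K" using d K[of p] by (intro mult_right_mono) auto
      finally have "V p * (T2u p - T1v p) \<le> K / 2 * (2 * (V p + d))" by (simp add: algebra_simps)
      then show ?thesis unfolding Z1_def using Vd(1)[of p] by (subst pos_divide_le_eq) auto
    qed
    then have "w d p * Z1 p \<le> w d p * (K / 2)" using w_bounds by (intro mult_left_mono) auto
    moreover have "w d p * Z2 p \<le> (- ln d / 2) * Z2 p"
      using w_bounds[of p] d B_nonneg[of p] by (intro mult_right_mono) (auto simp: Z2_def)
    ultimately show "w d p * (Z1 p + Z2 p) \<le> K / 2 * w d p + (- ln d / 2) * Z2 p"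
      by (simp add: algebra_simps)
  qed (intro continuous_intros cont_w cX)+
  also have "\<dots> = integral Q (\<lambda>p. K / 2 * w d p) + integral Q (\<lambda>p. (- ln d / 2) * Z2 p)"
    by (intro integral_add integrable_Q continuous_intros cont_w cX)
  also have "\<dots> = K / 2 * integral Q (w d) + (- ln d / 2) * integral Q Z2"
    unfolding integral_mult_right ..
  also have "\<dots> \<le> K / 2 * integral Q (w d) + (- ln d / 2) * (K / 2 * integral Q (\<lambda>p. d / (V p + d)))"
    using ln_le_minus_one[of d] d iZ2 by (intro add_left_mono mult_left_mono) auto
  finally have fD: "integral Q D \<le> K / 2 * integral Q (w d) + (- ln d / 2) * (K / 2 * integral Q (\<lambda>p. d / (V p + d)))" .
  have "integral Q (\<lambda>p. (wu d p)\<^sup>2 + (wv d p)\<^sup>2) \<le> integral Q (\<lambda>p. C * D p)"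
  proof (rule integral_Q_mono)
    fix p
    have "(wu d p)\<^sup>2 + (wv d p)\<^sup>2 = ((Vu p)\<^sup>2 + (Vv p)\<^sup>2) / (4 * (V p + d)\<^sup>2)"
      unfolding wu_def wv_def power_divide power_mult_distrib power2_minus by (simp add: add_divide_distrib)
    also have "\<dots> \<le> C * (V p * B p) / (4 * (V p + d)\<^sup>2)"
      using grad_V by (intro divide_right_mono) auto
    finally show "(wu d p)\<^sup>2 + (wv d p)\<^sup>2 \<le> C * D p" by (simp add: D_def)
  qed (intro continuous_intros cont_w cX)+
  also have "\<dots> = C * integral Q D" by (rule integral_mult_right)
  also have "\<dots> \<le> C * (K / 2 * integral Q (w d) + (- ln d / 2) * (K / 2 * integral Q (\<lambda>p. d / (V p + d))))"
    using fD C by (intro mult_left_mono) auto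
  finally show ?thesis .
qed

text \<open>A Chebyshev estimate, split at \<open>V + d = sqrt d\<close>. Above this level the ratio
  is at most \<open>sqrt d\<close>; below it \<open>w\<close> is at least half of its maximal value
  \<open>- ln d / 2\<close>, so the ratio, being at most 1, is dominated by a multiple of
  \<open>w\<close>.\<close>

lemma integral_ratio_le:
  "integral Q (\<lambda>p. d / (V p + d)) \<le> sqrt d + 2 * integral Q (w d) / (- ln d / 2)"
proof -
  have l: "- ln d / 2 > 0" using ln_less_zero[of d] d by simp
  have "integral Q (\<lambda>p. d / (V p + d)) \<le> integral Q (\<lambda>p. sqrt d + 2 / (- ln d / 2) * w d p)"
  proof (rule integral_Q_mono)
    fix p
    show "d / (V p + d) \<le> sqrt d + 2 / (- ln d / 2) * w d p"
    proof (cases "V p + d \<ge> sqrt d")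
      case True
      then have "sqrt d * sqrt d \<le> sqrt d * (V p + d)" using d by (intro mult_left_mono) auto
      then have "d / (V p + d) \<le> sqrt d" using Vd(1)[of p] d by (subst pos_divide_le_eq) auto
      moreover have "0 \<le> 2 / (- ln d / 2) * w d p"
        using w_bounds(1)[of p] l by (intro mult_nonneg_nonneg divide_nonneg_pos) auto
      ultimately show ?thesis by linarith
    next
      case False
      then have "ln (V p + d) \<le> ln (sqrt d)" using Vd(1)[of p] by (intro ln_mono) auto
      then have "w d p \<ge> - ln d / 4" unfolding w_def using d by (simp add: ln_sqrt)
      then have "2 / (- ln d / 2) * w d p \<ge> 2 / (- ln d / 2) * (- ln d / 4)"
        using l by (intro mult_left_mono) auto
      then have "2 / (- ln d / 2) * w d p \<ge> 1" using l by simp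
      moreover have "d / (V p + d) \<le> 1" using Vd(1)[of p] V_nonneg[of p] by simp
      moreover have "sqrt d \<ge> 0" using d by simp
      ultimately show ?thesis by linarith
    qed
  qed (use Vd(2) l in \<open>auto intro!: continuous_intros cont cont_w\<close>)
  also have "\<dots> = integral Q (\<lambda>p. sqrt d) + integral Q (\<lambda>p. 2 / (- ln d / 2) * w d p)"
    by (intro integral_add integrable_Q continuous_intros cont_w)
  also have "\<dots> = sqrt d + 2 / (- ln d / 2) * integral Q (w d)"
    unfolding integral_Q_const integral_mult_right ..
  finally show ?thesis by simp
qed

lemma integral_ratio_le_1: "integral Q (\<lambda>p. d / (V p + d)) \<le> 1"
proof -
  have "integral Q (\<lambda>p. d / (V p + d)) \<le> integral Q (\<lambda>p. 1)"
  proof (rule integral_Q_mono)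
    show "d / (V p + d) \<le> 1" for p using Vd(1)[of p] V_nonneg[of p] by simp
  qed (use Vd(2) in \<open>auto intro!: continuous_intros cont\<close>)
  then show ?thesis by (simp only: integral_Q_const)
qed

lemma integral_w_le: "integral Q (w d) \<le> - ln d / 2"
  using integral_Q_mono[OF cont_w(1) continuous_on_const w_bounds(2)] by (simp only: integral_Q_const)

lemma integral_w_nonneg: "0 \<le> integral Q (w d)"
  by (intro integral_Q_nonneg cont_w w_bounds)

end

text \<open>The scale is written as \<open>d = exp (- 2 s^2)\<close>, so that
  \<open>- ln d / 2 = s^2\<close>. The trivial bounds give energy O(s^2), hence mean of
  \<open>w\<close> O(s) by the Poincare inequality. Then the mean of \<open>d / (V + d)\<close> is
  O(1/s), and both terms of \<open>energy_le\<close> become O(s).\<close>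

lemma energy_sublinear:
  assumes "V p1 > 0"
  obtains A where "A \<ge> 0" "\<And>s. s \<ge> 1 \<Longrightarrow> integral Q (w (exp (- 2 * s\<^sup>2))) \<le> A * s"
    "\<And>s. s \<ge> 1 \<Longrightarrow> integral Q (\<lambda>p. (wu (exp (- 2 * s\<^sup>2)) p)\<^sup>2 + (wv (exp (- 2 * s\<^sup>2)) p)\<^sup>2) \<le> A * s"
proof -
  obtain a1 r1 where p1: "p1 = (a1, r1)" by (cases p1)
  \<comment> \<open>The point is moved into the unit cell. By continuity \<open>V\<close> exceeds
    half of its value there on a short horizontal segment, on which \<open>w\<close> is bounded
    independently of \<open>d\<close>.\<close>
  define a r where "a = frac a1" and "r = frac r1"
  define e0 where "e0 = V (a, r) / 2"
  have e0: "e0 > 0" using assms torus_periodic_frac[OF per(1), of a1 r1] by (simp add: e0_def a_def r_def p1)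
  have a01: "0 \<le> a" "a < 1" "0 \<le> r" "r \<le> 1"
    using frac_lt_1[of a1] frac_lt_1[of r1] unfolding a_def r_def by auto
  have "continuous_on UNIV (\<lambda>s. V (s, r))"
    by (rule continuous_on_compose2[OF cont(1)]) (auto intro!: continuous_intros)
  then have "isCont (\<lambda>s. V (s, r)) a" by (simp add: continuous_on_eq_continuous_at)
  then obtain e where e: "e > 0" "\<And>s. \<bar>s - a\<bar> < e \<Longrightarrow> \<bar>V (s, r) - V (a, r)\<bar> < e0"
    using e0 unfolding continuous_at_eps_delta dist_real_def by metis
  define b where "b = min 1 (a + e / 2)"
  have b: "a < b" "b \<le> 1" using a01 e by (auto simp: b_def)
  have seg: "V (s, r) > e0" if "a \<le> s" "s \<le> b" for s
    using e(2)[of s] that e(1) unfolding e0_def b_def by (auto simp: abs_if split: if_splits)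
  define W0 where "W0 = - ln e0 / 2"
  define cc where "cc = 1 + 1 / (b - a)"
  have cc: "cc \<ge> 0" using b by (simp add: cc_def)
  have K0: "K \<ge> 0" using K[of "(0,0)"] by simp
  \<comment> \<open>Read off from the two final chains: \<open>A1\<close> from the Poincare
    inequality with \<open>G <= C K s^2\<close>, and \<open>A2\<close> from \<open>energy_le\<close>
    with \<open>I <= A1 s\<close> and \<open>T <= (1 + 2 A1) / s\<close>.\<close>
  define A1 where "A1 = \<bar>W0\<bar> + cc * (C * K + 1) / 2"
  define A2 where "A2 = C * K / 2 * (1 + 3 * A1)"
  have A1: "A1 \<ge> 0" unfolding A1_def using cc K0 C by simp
  have A2: "A2 \<ge> 0" unfolding A2_def using A1 K0 C by simp
  have main: "integral Q (w (exp (- 2 * s\<^sup>2))) \<le> A1 * s \<and>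
    integral Q (\<lambda>p. (wu (exp (- 2 * s\<^sup>2)) p)\<^sup>2 + (wv (exp (- 2 * s\<^sup>2)) p)\<^sup>2) \<le> A2 * s" if s: "s \<ge> 1" for s
  proof -
    define d where "d = exp (- 2 * s\<^sup>2)"
    have s2: "1 \<le> s\<^sup>2" using s by (simp add: one_le_power)
    have es: "1 + 2 * s\<^sup>2 \<le> exp (2 * s\<^sup>2)" "1 + s\<^sup>2 \<le> exp (s\<^sup>2)" using exp_ge_add_one_self by auto
    have "2 \<le> exp (2 * s\<^sup>2)" using es(1) s2 by linarith
    then have d: "0 < d" "d \<le> 1/2" unfolding d_def by (auto simp: exp_minus field_simps)
    have l: "- ln d / 2 = s\<^sup>2" by (simp add: d_def)
    have sqd: "sqrt d \<le> 1 / s"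
    proof -
      have "d = (exp (- s\<^sup>2))\<^sup>2" unfolding d_def by (simp add: exp_double[symmetric])
      then have "sqrt d = exp (- s\<^sup>2)" by simp
      also have "\<dots> = 1 / exp (s\<^sup>2)" by (simp add: exp_minus field_simps)
      also have "\<dots> \<le> 1 / s"
      proof -
        have "s \<le> s\<^sup>2" using s mult_left_mono[of 1 s s] by (simp add: power2_eq_square)
        then have "s \<le> exp (s\<^sup>2)" using es(2) by linarith
        then show ?thesis using s by (intro divide_left_mono) auto
      qed
      finally show ?thesis .
    qed
    note cw = cont_w[OF d]
    define G where "G = integral Q (\<lambda>p. (wu d p)\<^sup>2 + (wv d p)\<^sup>2)"
    define I where "I = integral Q (w d)"
    define T where "T = integral Q (\<lambda>p. d / (V p + d))"
    have cG: "continuous_on UNIV (\<lambda>p. (wu d p)\<^sup>2 + (wv d p)\<^sup>2)" by (intro continuous_intros cw)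
    have I: "0 \<le> I" "I \<le> s\<^sup>2" using integral_w_nonneg[OF d] integral_w_le[OF d] unfolding l I_def by auto
    have T: "T \<le> 1" "T \<le> sqrt d + 2 * I / s\<^sup>2"
      using integral_ratio_le_1[OF d] integral_ratio_le[OF d] unfolding T_def I_def l by auto
    have G: "G \<le> C * (K / 2 * I + s\<^sup>2 * (K / 2 * T))"
      using energy_le[OF d] unfolding G_def I_def T_def l .
    have "C * (K / 2 * I + s\<^sup>2 * (K / 2 * T)) \<le> C * (K / 2 * s\<^sup>2 + s\<^sup>2 * (K / 2 * 1))"
      using I T C K0 by (intro mult_left_mono add_mono) auto
    then have G1: "G \<le> C * K * s\<^sup>2" using G by (simp add: algebra_simps)
    have "integral Q (w d) \<le> W0 + integral Q (\<lambda>p. \<bar>wv d p\<bar>) / (b - a) + integral Q (\<lambda>p. \<bar>wu d p\<bar>)"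
    proof (rule integral_le_segment_variation[OF der_w[OF d] cw a01(1) b a01(3,4)])
      fix x assume "a \<le> x" "x \<le> b"
      then have "ln e0 \<le> ln (V (x, r) + d)" using seg[of x] e0 d by (intro ln_mono) auto
      then show "w d (x, r) \<le> W0" unfolding w_def W0_def by simp
    qed
    moreover define Z where "Z = (G / s + s) / 2"
    moreover have "integral Q (\<lambda>p. \<bar>wv d p\<bar>) \<le> Z"
      unfolding G_def Z_def by (rule integral_abs_le[OF cw(3) cG]) (use s in auto)
    moreover have "integral Q (\<lambda>p. \<bar>wu d p\<bar>) \<le> Z"
      unfolding G_def Z_def by (rule integral_abs_le[OF cw(2) cG]) (use s in auto)
    moreover have "integral Q (\<lambda>p. \<bar>wv d p\<bar>) / (b - a) \<le> Z / (b - a)"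
      using b calculation by (intro divide_right_mono) auto
    ultimately have "I \<le> W0 + Z / (b - a) + Z" unfolding I_def by linarith
    then have "I \<le> W0 + cc * Z" by (simp add: cc_def distrib_right)
    also have "\<dots> \<le> \<bar>W0\<bar> * s + cc * ((C * K * s + s) / 2)"
      unfolding Z_def
    proof (intro add_mono mult_left_mono cc divide_right_mono)
      have "\<bar>W0\<bar> * 1 \<le> \<bar>W0\<bar> * s" using s by (intro mult_left_mono) auto
      then show "W0 \<le> \<bar>W0\<bar> * s" by linarith
      show "G / s \<le> C * K * s" using G1 s by (simp add: pos_divide_le_eq power2_eq_square mult.assoc)
    qed auto
    also have "\<dots> = A1 * s" unfolding A1_def by (simp add: algebra_simps add_divide_distrib)
    finally have I1: "I \<le> A1 * s" .
    have "2 * I / s\<^sup>2 \<le> 2 * (A1 * s) / s\<^sup>2" using I1 by (intro divide_right_mono) auto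
    also have "\<dots> = 2 * A1 / s" using s by (simp add: power2_eq_square)
    finally have "T \<le> (1 + 2 * A1) / s" using T(2) sqd by (simp add: add_divide_distrib)
    then have "C * (K / 2 * I + s\<^sup>2 * (K / 2 * T)) \<le> C * (K / 2 * (A1 * s) + s\<^sup>2 * (K / 2 * ((1 + 2 * A1) / s)))"
      using I1 C K0 by (intro mult_left_mono add_mono) auto
    also have "\<dots> = A2 * s" unfolding A2_def using s by (simp add: power2_eq_square field_simps)
    finally have "G \<le> A2 * s" using G by linarith
    then show ?thesis using I1 unfolding I_def G_def d_def by blast
  qed
  show ?thesis
  proof (rule that[of "max A1 A2"])
    show "0 \<le> max A1 A2" using A1 by auto
    fix s :: real assume s: "s \<ge> 1"
    have "A1 * s \<le> max A1 A2 * s" "A2 * s \<le> max A1 A2 * s" using s by (auto intro!: mult_right_mono)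
    then show "integral Q (w (exp (- 2 * s\<^sup>2))) \<le> max A1 A2 * s"
      "integral Q (\<lambda>p. (wu (exp (- 2 * s\<^sup>2)) p)\<^sup>2 + (wv (exp (- 2 * s\<^sup>2)) p)\<^sup>2) \<le> max A1 A2 * s"
      using main[OF s] by linarith+
  qed
qed

text \<open>At a zero of \<open>V\<close> the function \<open>w\<close> dominates a logarithmic potential. Testing \<open>w\<close> against that potential
  forces an energy of order \<open>s\<^sup>2\<close>, which \<open>energy_sublinear\<close> excludes.\<close>
theorem no_zero:
  assumes "V p1 > 0" "1 \<le> M"
    and M: "\<And>p. V p \<le> M * ((sin (pi * (fst p - u0)))\<^sup>2 + (sin (pi * (snd p - t0)))\<^sup>2)"
  shows False
proof -
  obtain A where A: "A \<ge> 0" "\<And>s. s \<ge> 1 \<Longrightarrow> integral Q (w (exp (- 2 * s\<^sup>2))) \<le> A * s"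
    "\<And>s. s \<ge> 1 \<Longrightarrow> integral Q (\<lambda>p. (wu (exp (- 2 * s\<^sup>2)) p)\<^sup>2 + (wv (exp (- 2 * s\<^sup>2)) p)\<^sup>2) \<le> A * s"
    by (rule energy_sublinear[OF assms(1)]) blast
  \<comment> \<open>The loss in the lower bound \<open>w >= s^2 / 4 - m\<close> near the zero, where
    \<open>V + d <= 2 M exp (- s^2 / 2)\<close>.\<close>
  define m where "m = ln (2 * M) / 2"
  have m: "m \<ge> 0" unfolding m_def using assms(2) by simp
  \<comment> \<open>503 = 500 + 3 collects the coefficients of \<open>A * s\<close> in the final
    inequality. Its quadratic coefficient is \<open>1/72 - 3/2000\<close>, and 200 times this
    exceeds 1, so with \<open>s = 200 * Y\<close> the quadratic term wins.\<close>
  define Y where "Y = 1 + m + 503 * A"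
  have Y: "Y \<ge> 1" "Y \<ge> m" "Y \<ge> 503 * A" unfolding Y_def using m A(1) by auto
  define s where "s = 200 * Y"
  have s: "s \<ge> 1" "s \<ge> 6" using Y by (auto simp: s_def)
  define d where "d = exp (- 2 * s\<^sup>2)"
  have s36: "36 \<le> s\<^sup>2" using power_mono[OF s(2), of 2] by simp
  have es: "1 + 2 * s\<^sup>2 \<le> exp (2 * s\<^sup>2)" "1 + s\<^sup>2 \<le> exp (s\<^sup>2)" using exp_ge_add_one_self by auto
  have "2 \<le> exp (2 * s\<^sup>2)" "36 \<le> exp (s\<^sup>2)" using es s36 by linarith+
  then have d: "0 < d" "d \<le> 1/2" and ed: "exp (- s\<^sup>2) \<le> 1/36"
    unfolding d_def by (auto simp: exp_minus field_simps)
  have l: "- ln d / 2 = s\<^sup>2" by (simp add: d_def)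
  interpret tl: torus_log u0 t0 d by unfold_locales (use d in auto)
  note cw = cont_w[OF d] and wb = w_bounds[OF d]
  have m4: "m \<le> s\<^sup>2 / 4"
  proof -
    have "4 * m \<le> 200 * Y" using Y m by linarith
    also have "\<dots> \<le> s\<^sup>2" using s unfolding s_def[symmetric] by (simp add: power2_eq_square)
    finally show ?thesis by simp
  qed
  have Vq: "V p \<le> M * tl.q p" for p using M unfolding tl.q_def tl.S_def tl.R_def .
  \<comment> \<open>The split is at \<open>q = exp (- s^2 / 2)\<close>. Nearer to the pole
    \<open>w\<close> is large. Farther away \<open>(q + d)^2 >= exp (- s^2)\<close> and
    \<open>d = exp (- 2 s^2)\<close> make \<open>ker\<close> at most the subtracted constant, so the
    left side is nonpositive.\<close>
  have ptw: "(s\<^sup>2 / 4 - m) * (tl.ker p - 2 * pi\<^sup>2 * exp (- s\<^sup>2)) \<le> w d p * tl.ker p" for p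
  proof (cases "tl.q p \<le> exp (- s\<^sup>2 / 2)")
    case True
    have de: "d \<le> exp (- s\<^sup>2 / 2)" unfolding d_def by simp
    have "V p + d \<le> M * tl.q p + M * d" 
      using Vq[of p] mult_right_mono[OF assms(2), of d] d by linarith
    also have "\<dots> \<le> M * exp (- s\<^sup>2 / 2) + M * exp (- s\<^sup>2 / 2)"
      using True de assms(2) by (intro add_mono mult_left_mono) auto
    finally have "V p + d \<le> 2 * M * exp (- s\<^sup>2 / 2)" by simp
    then have "ln (V p + d) \<le> ln (2 * M * exp (- s\<^sup>2 / 2))"
      using Vd(1)[OF d, of p] by (intro ln_mono) auto
    also have "\<dots> = ln (2 * M) - s\<^sup>2 / 2" using assms(2) by (simp add: ln_mult)
    finally have "s\<^sup>2 / 4 - m \<le> w d p" unfolding w_def m_def by simp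
    then have "(s\<^sup>2 / 4 - m) * tl.ker p \<le> w d p * tl.ker p"
      using tl.ker_nonneg by (intro mult_right_mono) auto
    moreover have "(s\<^sup>2 / 4 - m) * (tl.ker p - 2 * pi\<^sup>2 * exp (- s\<^sup>2)) \<le> (s\<^sup>2 / 4 - m) * tl.ker p"
      using m4 by (intro mult_left_mono) auto
    ultimately show ?thesis by linarith
  next
    case False
    have "tl.ker p \<le> 2 * pi\<^sup>2 * exp (- s\<^sup>2)"
    proof -
      have "(exp (- s\<^sup>2 / 2))\<^sup>2 \<le> (tl.q p + d)\<^sup>2"
        using False d by (intro power_mono) auto
      moreover have "(exp (- s\<^sup>2 / 2))\<^sup>2 = exp (- s\<^sup>2)" by (simp add: exp_double[symmetric])
      ultimately have "exp (- s\<^sup>2) * exp (- s\<^sup>2) \<le> exp (- s\<^sup>2) * (tl.q p + d)\<^sup>2" by simp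
      moreover have "exp (- s\<^sup>2) * exp (- s\<^sup>2) = d" unfolding d_def by (simp add: exp_add[symmetric])
      moreover have "d * max 0 (1 - tl.q p) \<le> d * 1" using tl.qd[of p] d by (intro mult_left_mono) auto
      ultimately have "d * max 0 (1 - tl.q p) \<le> exp (- s\<^sup>2) * (tl.q p + d)\<^sup>2" by linarith
      then have "2 * pi\<^sup>2 * (d * max 0 (1 - tl.q p)) \<le> 2 * pi\<^sup>2 * (exp (- s\<^sup>2) * (tl.q p + d)\<^sup>2)"
        by (intro mult_left_mono) auto
      then show ?thesis unfolding tl.ker_def using tl.qd[of p] by (subst pos_divide_le_eq) (auto simp: mult.assoc)
    qed
    then have "(s\<^sup>2 / 4 - m) * (tl.ker p - 2 * pi\<^sup>2 * exp (- s\<^sup>2)) \<le> 0"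
      using m4 by (intro mult_nonneg_nonpos) auto
    moreover have "0 \<le> w d p * tl.ker p" using wb tl.ker_nonneg by simp
    ultimately show ?thesis by linarith
  qed
  define I where "I = integral Q (w d)"
  have I: "I \<le> A * s" unfolding I_def d_def by (rule A(2)[OF s(1)])
  define G where "G = integral Q (\<lambda>p. (wu d p)\<^sup>2 + (wv d p)\<^sup>2)"
  have G: "G \<le> A * s" unfolding G_def d_def by (rule A(3)[OF s(1)])
  have low: "(s\<^sup>2 / 4 - m) * (pi\<^sup>2 / 18) - 3 * pi\<^sup>2 * I \<le> integral Q (\<lambda>p. w d p * tl.lap p)"
  proof -
    \<comment> \<open>Since \<open>s >= 6\<close>, the subtracted constant is at most
      \<open>pi^2 / 18\<close>, half of the guaranteed mass \<open>pi^2 / 9\<close> of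
      \<open>ker\<close>.\<close>
    have "2 * pi\<^sup>2 * exp (- s\<^sup>2) \<le> 2 * pi\<^sup>2 * (1/36)" using ed by (intro mult_left_mono) auto
    then have "pi\<^sup>2 / 18 \<le> integral Q tl.ker - 2 * pi\<^sup>2 * exp (- s\<^sup>2)"
      using tl.integral_ker(2) by linarith
    then have "(s\<^sup>2 / 4 - m) * (pi\<^sup>2 / 18) \<le> (s\<^sup>2 / 4 - m) * (integral Q tl.ker - 2 * pi\<^sup>2 * exp (- s\<^sup>2))"
      using m4 by (intro mult_left_mono) auto
    also have "\<dots> = integral Q (\<lambda>p. (s\<^sup>2 / 4 - m) * (tl.ker p - 2 * pi\<^sup>2 * exp (- s\<^sup>2)))"
      unfolding integral_mult_right
      by (subst integral_diff) (auto intro!: integrable_Q tl.cont continuous_on_const simp only: integral_Q_const)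
    also have "\<dots> - 3 * pi\<^sup>2 * I = integral Q (\<lambda>p. (s\<^sup>2 / 4 - m) * (tl.ker p - 2 * pi\<^sup>2 * exp (- s\<^sup>2))) - integral Q (\<lambda>p. 3 * pi\<^sup>2 * w d p)"
      unfolding I_def integral_mult_right ..
    also have "\<dots> = integral Q (\<lambda>p. (s\<^sup>2 / 4 - m) * (tl.ker p - 2 * pi\<^sup>2 * exp (- s\<^sup>2)) - 3 * pi\<^sup>2 * w d p)"
      by (rule integral_diff[symmetric]) (intro integrable_Q continuous_intros tl.cont cw)+
    also have "\<dots> \<le> integral Q (\<lambda>p. w d p * tl.lap p)"
    proof (rule integral_Q_mono)
      fix p
      have "w d p * tl.rem p \<le> w d p * (3 * pi\<^sup>2)" using wb tl.rem_bounds by (intro mult_left_mono) auto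
      then show "(s\<^sup>2 / 4 - m) * (tl.ker p - 2 * pi\<^sup>2 * exp (- s\<^sup>2)) - 3 * pi\<^sup>2 * w d p \<le> w d p * tl.lap p"
        unfolding tl.lap_ker_rem right_diff_distrib[of "w d p"] using ptw[of p] by (simp add: mult.commute)
    qed (intro continuous_intros tl.cont cw)+
    finally show ?thesis by simp
  qed
  have "integral Q (\<lambda>p. wu d p * tl.eu p) = - integral Q (\<lambda>p. w d p * tl.euu p)"
    by (rule integral_pu_by_parts) (auto intro: der_w[OF d] tl.der_eu cw tl.cont per_w[OF d] tl.per)
  moreover have "integral Q (\<lambda>p. wv d p * tl.ev p) = - integral Q (\<lambda>p. w d p * tl.evv p)"
    by (rule integral_pv_by_parts) (auto intro: der_w[OF d] tl.der_eu cw tl.cont per_w[OF d] tl.per)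
  moreover have "integral Q (\<lambda>p. wu d p * tl.eu p + wv d p * tl.ev p) = integral Q (\<lambda>p. wu d p * tl.eu p) + integral Q (\<lambda>p. wv d p * tl.ev p)"
    by (intro integral_add integrable_Q continuous_intros cw tl.cont)
  moreover have "integral Q (\<lambda>p. w d p * tl.euu p + w d p * tl.evv p) = integral Q (\<lambda>p. w d p * tl.euu p) + integral Q (\<lambda>p. w d p * tl.evv p)"
    by (intro integral_add integrable_Q continuous_intros cw tl.cont)
  ultimately have "integral Q (\<lambda>p. w d p * tl.lap p) = - integral Q (\<lambda>p. wu d p * tl.eu p + wv d p * tl.ev p)"
    by (simp add: distrib_left[symmetric] tl.lap_eq)
  also have "\<dots> = integral Q (\<lambda>p. - (wu d p * tl.eu p + wv d p * tl.ev p))" by (rule integral_neg[symmetric])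
  also have "\<dots> \<le> integral Q (\<lambda>p. 500 * ((wu d p)\<^sup>2 + (wv d p)\<^sup>2) + 1/2000 * ((tl.eu p)\<^sup>2 + (tl.ev p)\<^sup>2))"
  proof (rule integral_Q_mono)
    fix p
    \<comment> \<open>The small weight goes to the potential, whose energy grows like
      \<open>s^2\<close> and must stay below the main term; the large weight goes to
      \<open>w\<close>, whose energy is only O(s).\<close>
    have am: "- (x * y) \<le> 500 * x\<^sup>2 + 1/2000 * y\<^sup>2" for x y :: real
      using zero_le_power2[of "1000 * x + y"] by (simp add: power2_eq_square algebra_simps)
    show "- (wu d p * tl.eu p + wv d p * tl.ev p) \<le> 500 * ((wu d p)\<^sup>2 + (wv d p)\<^sup>2) + 1/2000 * ((tl.eu p)\<^sup>2 + (tl.ev p)\<^sup>2)"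
      using am[of "wu d p" "tl.eu p"] am[of "wv d p" "tl.ev p"] by argo
  qed (intro continuous_intros tl.cont cw)+
  also have "\<dots> = integral Q (\<lambda>p. 500 * ((wu d p)\<^sup>2 + (wv d p)\<^sup>2)) + integral Q (\<lambda>p. 1/2000 * ((tl.eu p)\<^sup>2 + (tl.ev p)\<^sup>2))"
    by (intro integral_add integrable_Q continuous_intros cw tl.cont)
  also have "\<dots> = 500 * G + 1/2000 * integral Q (\<lambda>p. (tl.eu p)\<^sup>2 + (tl.ev p)\<^sup>2)"
    unfolding integral_mult_right G_def ..
  also have "\<dots> \<le> 500 * (A * s) + 1/2000 * (3 * pi\<^sup>2 * (1 + s\<^sup>2))"
    using tl.gradient_eta_le G by (intro add_mono mult_left_mono) (auto simp: d_def)
  finally have up: "(s\<^sup>2 / 4 - m) * (pi\<^sup>2 / 18) - 3 * pi\<^sup>2 * I \<le> 500 * (A * s) + 1/2000 * (3 * pi\<^sup>2 * (1 + s\<^sup>2))"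
    using low by linarith
  have upI: "3 * pi\<^sup>2 * I \<le> 3 * pi\<^sup>2 * (A * s)" using I by (intro mult_left_mono) auto
  have fin: "pi\<^sup>2 * ((s\<^sup>2 / 4 - m) / 18 - 3 * (A * s) - 3/2000 * (1 + s\<^sup>2)) \<le> 500 * (A * s)"
    (is "?L \<le> _")
  proof -
    have "?L = (s\<^sup>2 / 4 - m) * (pi\<^sup>2 / 18) - 3 * pi\<^sup>2 * (A * s) - 1/2000 * (3 * pi\<^sup>2 * (1 + s\<^sup>2))"
      by (simp add: field_simps)
    then show ?thesis
      using up upI by linarith
  qed
  have "s\<^sup>2 = 200 * (Y * s)" unfolding s_def by (simp add: power2_eq_square)
  moreover have "m * 1 + 503 * A * s + s * 1 \<le> Y * s" 
  proof -
    have "m * 1 \<le> m * s" using s m by (intro mult_left_mono) auto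
    then show ?thesis unfolding Y_def by (simp add: algebra_simps)
  qed
  moreover have "0 \<le> A * s" using A(1) s by simp
  ultimately have br: "500 * (A * s) < (s\<^sup>2 / 4 - m) / 18 - 3 * (A * s) - 3/2000 * (1 + s\<^sup>2)"
    using s m by argo
  have "1 \<le> pi\<^sup>2" using pi_ge_two by (simp add: one_le_power)
  then have "1 * ((s\<^sup>2 / 4 - m) / 18 - 3 * (A * s) - 3/2000 * (1 + s\<^sup>2)) \<le> pi\<^sup>2 * ((s\<^sup>2 / 4 - m) / 18 - 3 * (A * s) - 3/2000 * (1 + s\<^sup>2))"
    by (rule mult_right_mono) (use br \<open>0 \<le> A * s\<close> in linarith)
  from less_le_trans[OF br order_trans[OF this fin, unfolded mult_1]] show False by simp
qed

end

section \<open>Calculus rules for smooth periodic functions, and growth at a zero\<close>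

lemmas smooth_intros = smooth_on_add smooth_on_diff smooth_on_uminus smooth_on_mult smooth_on_divide
  smooth_on_power smooth_on_Re smooth_on_Im smooth_on_cnj smooth_on_of_real smooth_on_Complex
  smooth_on_scaleR smooth_on_inner smooth_on_cross3 smooth_on_pdu smooth_on_pdv
  smooth_on_const[OF open_UNIV]

lemma smooth_has_pu: "smooth f \<Longrightarrow> has_pu f (pdu f)"
  and smooth_has_pv: "smooth f \<Longrightarrow> has_pv f (pdv f)"
  unfolding has_pu_def has_pv_def has_real_derivative_iff_has_vector_derivative
  using smooth_on_has_vector_derivative_u smooth_on_has_vector_derivative_v by blast+

lemma pd_bounded_linear:
  assumes "bounded_linear L" "smooth f"
  shows "pdu (\<lambda>p. L (f p)) p = L (pdu f p)" "pdv (\<lambda>p. L (f p)) p = L (pdv f p)"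
  using frechet_derivative_pd[OF bounded_linear.has_derivative[OF assms(1) smooth_on_has_derivative[OF assms(2) UNIV_I]]]
  unfolding pdu_def pdv_def by auto

lemma pd_bilinear:
  assumes "bounded_bilinear B" "smooth f" "smooth g"
  shows "pdu (\<lambda>p. B (f p) (g p)) p = B (f p) (pdu g p) + B (pdu f p) (g p)"
    "pdv (\<lambda>p. B (f p) (g p)) p = B (f p) (pdv g p) + B (pdv f p) (g p)"
  using frechet_derivative_pd[OF bounded_bilinear.FDERIV[OF assms(1)
      smooth_on_has_derivative[OF assms(2) UNIV_I] smooth_on_has_derivative[OF assms(3) UNIV_I]]]
  unfolding pdu_def pdv_def by auto

lemma pd_const: "pdu (\<lambda>p. c) p = 0" "pdv (\<lambda>p. c) p = 0"
  by (simp_all add: pdu_def pdv_def)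

lemma pd_add:
  assumes "smooth f" "smooth g"
  shows "pdu (\<lambda>p. f p + g p) p = pdu f p + pdu g p" "pdv (\<lambda>p. f p + g p) p = pdv f p + pdv g p"
  using frechet_derivative_pd[OF has_derivative_add[OF 
      smooth_on_has_derivative[OF assms(1) UNIV_I] smooth_on_has_derivative[OF assms(2) UNIV_I]]]
  unfolding pdu_def pdv_def by auto

lemma pd_diff:
  assumes "smooth f" "smooth g"
  shows "pdu (\<lambda>p. f p - g p) p = pdu f p - pdu g p" "pdv (\<lambda>p. f p - g p) p = pdv f p - pdv g p"
  using frechet_derivative_pd[OF has_derivative_diff[OF 
      smooth_on_has_derivative[OF assms(1) UNIV_I] smooth_on_has_derivative[OF assms(2) UNIV_I]]]
  unfolding pdu_def pdv_def by auto

lemmas pd_mult = pd_bilinear[OF bounded_bilinear_mult]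
lemmas pd_cmult = pd_bounded_linear[OF bounded_linear_mult_right]
lemmas pd_Re = pd_bounded_linear[OF bounded_linear_Re]
lemmas pd_Im = pd_bounded_linear[OF bounded_linear_Im]

lemma pd_power2:
  fixes f :: "real \<times> real \<Rightarrow> real"
  assumes "smooth f"
  shows "pdu (\<lambda>p. (f p)\<^sup>2) p = 2 * f p * pdu f p" "pdv (\<lambda>p. (f p)\<^sup>2) p = 2 * f p * pdv f p"
  unfolding power2_eq_square by (simp_all add: pd_mult[OF assms assms])

text \<open>Translation by a period carries the derivatives at \<open>p\<close> to those at the
  translated point, so \<open>frechet_derivative\<close> chooses from the same candidates at
  both.\<close>

lemma torus_periodic_frechet_derivative:
  assumes "torus_periodic f"
  shows "torus_periodic (\<lambda>p. frechet_derivative f (at p) c)"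
proof -
  have *: "frechet_derivative f (at (p + a)) = frechet_derivative f (at p)" if "\<And>q. f (q + a) = f q" for a p
  proof -
    have "(f has_derivative D) (at (p + a)) \<longleftrightarrow> (f has_derivative D) (at p)" for D
    proof
      assume "(f has_derivative D) (at (p + a))"
      moreover have "((\<lambda>q. q + a) has_derivative (\<lambda>q. q)) (at p)" by (auto intro!: derivative_eq_intros)
      ultimately show "(f has_derivative D) (at p)"
        using has_derivative_compose[of "\<lambda>q. q + a" "\<lambda>q. q" p UNIV f D] that by simp
    next
      assume "(f has_derivative D) (at p)"
      then have "(f has_derivative D) (at ((p + a) - a))" by simp
      moreover have "((\<lambda>q. q - a) has_derivative (\<lambda>q. q)) (at (p + a))" by (auto intro!: derivative_eq_intros)
      moreover have "f (q - a) = f q" for q using that[of "q - a"] by simp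
      ultimately show "(f has_derivative D) (at (p + a))"
        using has_derivative_compose[of "\<lambda>q. q - a" "\<lambda>q. q" "p + a" UNIV f D] by simp
    qed
    then show ?thesis unfolding frechet_derivative_def by simp
  qed
  have "f (q + (1, 0)) = f q" "f (q + (0, 1)) = f q" for q
    using assms by (cases q; simp add: torus_periodic_def)+
  from *[OF this(1)] *[OF this(2)] show ?thesis
    unfolding torus_periodic_def by (metis add_Pair add_0_right)
qed

lemma torus_periodic_pd: "torus_periodic f \<Longrightarrow> torus_periodic (pdu f)" "torus_periodic f \<Longrightarrow> torus_periodic (pdv f)"
  using torus_periodic_frechet_derivative[of f "(1,0)"] torus_periodic_frechet_derivative[of f "(0,1)"]
  unfolding pdu_def[abs_def] pdv_def[abs_def] by auto

text \<open>A crude constant suffices. Halving the angle brings it below \<open>pi / 4\<close>,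
  where the cosine is at least \<open>1/2\<close>, and this bounds both factors of the double-angle
  formula.\<close>

lemma abs_sin_pi_ge:
  assumes "\<bar>x\<bar> \<le> 1/2"
  shows "\<bar>x\<bar> / 2 \<le> \<bar>sin (pi * x)\<bar>"
proof -
  have pos: "x / 2 \<le> sin (pi * x)" if x: "0 < x" "x \<le> 1/2" for x
  proof -
    define z where "z = pi * x / 2"
    have z: "0 < z" "z \<le> pi / 4" using x by (auto simp: z_def)
    have "cos (pi/4) \<ge> 1/2"
    proof -
      have "1 \<le> sqrt 2" by simp
      then show ?thesis by (simp add: cos_45)
    qed
    then have c: "1/2 \<le> cos y" if "0 \<le> y" "y \<le> pi / 4" for y
      using cos_monotone_0_pi_le[of y "pi/4"] that by auto
    obtain y where y: "0 < y" "y < z" "sin z - sin 0 = (z - 0) * cos y"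
      using MVT2[of 0 z sin cos] z by (auto intro: derivative_eq_intros)
    have "z * (1/2) \<le> z * cos y" using y z by (intro mult_left_mono c) auto
    then have s: "z / 2 \<le> sin z" using y by simp
    have "sin (pi * x) = 2 * sin z * cos z" using sin_double[of z] by (simp add: z_def)
    moreover have "(z / 2) * (1/2) \<le> sin z * cos z" using s c[of z] z by (intro mult_mono) auto
    moreover have "x \<le> z" using x pi_ge_two by (simp add: z_def)
    ultimately show ?thesis using z by linarith
  qed
  consider "x = 0" | "x > 0" | "x < 0" by linarith
  then show ?thesis
  proof cases
    case 2 then show ?thesis using pos[of x] assms by auto
  next
    case 3 then show ?thesis using pos[of "-x"] assms by auto
  qed auto
qed

text \<open>Bounded derivatives make \<open>f\<close> Lipschitz, and rounding picks the lattice
  translate of the zero next to \<open>p\<close>. In the constant \<open>8 L^2\<close> the factor 4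
  comes from \<open>abs_sin_pi_ge\<close> and the factor 2 from squaring a sum. This is what puts
  \<open>w\<close> above a logarithmic potential.\<close>

lemma torus_zero_quadratic:
  fixes f :: "real \<times> real \<Rightarrow> real"
  assumes "smooth f" "torus_periodic f" "f (u0, t0) = 0"
  obtains M where "0 \<le> M" "\<And>p. (f p)\<^sup>2 \<le> M * ((sin (pi * (fst p - u0)))\<^sup>2 + (sin (pi * (snd p - t0)))\<^sup>2)"
proof -
  note S = smooth_on_pdu[OF assms(1)] smooth_on_pdv[OF assms(1)]
  obtain C1 where C1: "C1 > 0" "\<And>p. \<bar>pdu f p\<bar> \<le> C1"
    by (rule torus_bounded[OF smooth_on_continuous[OF S(1)] torus_periodic_pd(1)[OF assms(2)]]) blast
  obtain C2 where C2: "C2 > 0" "\<And>p. \<bar>pdv f p\<bar> \<le> C2"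
    by (rule torus_bounded[OF smooth_on_continuous[OF S(2)] torus_periodic_pd(2)[OF assms(2)]]) blast
  define L where "L = C1 + C2"
  have L: "L > 0" "C1 \<le> L" "C2 \<le> L" using C1 C2 by (auto simp: L_def)
  have lip: "\<bar>f (u0 + x, t0 + y)\<bar> \<le> L * (\<bar>x\<bar> + \<bar>y\<bar>)" for x y
  proof -
    have "norm (f (u0 + x, t0 + y) - f (u0, t0 + y)) \<le> C1 * norm ((u0 + x) - u0)"
      using smooth_has_pu[OF assms(1)] C1(2)
      by (intro field_differentiable_bound[of UNIV "\<lambda>s. f (s, t0 + y)" "\<lambda>s. pdu f (s, t0 + y)"]) (auto simp: has_pu_def)
    moreover have "norm (f (u0, t0 + y) - f (u0, t0)) \<le> C2 * norm ((t0 + y) - t0)"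
      using smooth_has_pv[OF assms(1)] C2(2)
      by (intro field_differentiable_bound[of UNIV "\<lambda>s. f (u0, s)" "\<lambda>s. pdv f (u0, s)"]) (auto simp: has_pv_def)
    moreover have "C1 * \<bar>x\<bar> \<le> L * \<bar>x\<bar>" "C2 * \<bar>y\<bar> \<le> L * \<bar>y\<bar>" using L by (auto intro!: mult_right_mono)
    ultimately show ?thesis using assms(3) by (simp add: distrib_left) linarith
  qed
  have "(f p)\<^sup>2 \<le> 8 * L\<^sup>2 * ((sin (pi * (fst p - u0)))\<^sup>2 + (sin (pi * (snd p - t0)))\<^sup>2)" for p
  proof -
    obtain u t where p: "p = (u, t)" by (cases p)
    define x y where "x = (u - u0) - of_int (round (u - u0))" and "y = (t - t0) - of_int (round (t - t0))"
    have xy: "\<bar>x\<bar> \<le> 1/2" "\<bar>y\<bar> \<le> 1/2"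
      using of_int_round_abs_le[of "u - u0"] of_int_round_abs_le[of "t - t0"] by (auto simp: x_def y_def abs_minus_commute)
    have sx: "\<bar>sin (pi * (z + of_int n))\<bar> = \<bar>sin (pi * z)\<bar>" for z n
    proof -
      have "sin (of_int n * pi) = 0" using sin_zero_iff_int2 by blast
      then show ?thesis using sin_zero_abs_cos_one[of "of_int n * pi"]
        by (simp add: distrib_left sin_add abs_mult mult.commute[of pi "of_int n"])
    qed
    have "f p = f (u0 + x, t0 + y)"
      using torus_periodic_int[OF assms(2), of "u0 + x" "round (u - u0)" "t0 + y" "round (t - t0)"]
      by (simp add: p x_def y_def)
    then have "\<bar>f p\<bar> \<le> L * (\<bar>x\<bar> + \<bar>y\<bar>)" using lip by simp
    also have "\<dots> \<le> L * (2 * \<bar>sin (pi * (u - u0))\<bar> + 2 * \<bar>sin (pi * (t - t0))\<bar>)"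
      using abs_sin_pi_ge[OF xy(1)] abs_sin_pi_ge[OF xy(2)] L
        sx[of x "round (u - u0)"] sx[of y "round (t - t0)"]
      by (intro mult_left_mono add_mono) (auto simp: x_def y_def)
    finally have "(\<bar>f p\<bar>)\<^sup>2 \<le> (L * (2 * \<bar>sin (pi * (u - u0))\<bar> + 2 * \<bar>sin (pi * (t - t0))\<bar>))\<^sup>2"
      by (intro power_mono) auto
    also have "\<dots> = 4 * L\<^sup>2 * (\<bar>sin (pi * (u - u0))\<bar> + \<bar>sin (pi * (t - t0))\<bar>)\<^sup>2"
      by (simp add: power2_eq_square algebra_simps)
    also have "\<dots> \<le> 4 * L\<^sup>2 * (2 * ((sin (pi * (u - u0)))\<^sup>2 + (sin (pi * (t - t0)))\<^sup>2))"
    proof (intro mult_left_mono)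
      have "(a + b)\<^sup>2 \<le> 2 * (a\<^sup>2 + b\<^sup>2)" for a b :: real
        using zero_le_power2[of "a - b"] by (simp add: power2_eq_square algebra_simps)
      from this[of "\<bar>sin (pi * (u - u0))\<bar>" "\<bar>sin (pi * (t - t0))\<bar>"]
      show "(\<bar>sin (pi * (u - u0))\<bar> + \<bar>sin (pi * (t - t0))\<bar>)\<^sup>2 \<le> 2 * ((sin (pi * (u - u0)))\<^sup>2 + (sin (pi * (t - t0)))\<^sup>2)"
        by simp
    qed simp
    finally show ?thesis by (simp add: p algebra_simps)
  qed
  then show ?thesis by (intro that[of "8 * L\<^sup>2"]) auto
qed

section \<open>From the complex system to the real elliptic inequalities\<close>

text \<open>Real one-forms tau are mapped bijectively onto complex densities by wedging with sigma,
  since \<open>s1\<close> and \<open>s2\<close> are independent over the reals. So \<alpha> can be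
  absorbed by a real tau with \<open>dh + i tau h = k sigma\<close>: \<open>h\<close> is holomorphic
  for the structure of sigma and a unitary connection, and this leaves no first-order error in the
  equations for its squared modulus.\<close>

theorem torus_zero_free:
  fixes h s1 s2 \<alpha> :: "real \<times> real \<Rightarrow> complex"
  assumes smooth: "smooth h" "smooth s1" "smooth s2" "smooth \<alpha>"
    and per: "torus_periodic h" "torus_periodic s1" "torus_periodic s2" "torus_periodic \<alpha>"
    and eq: "\<And>p. pdu h p * s2 p - pdv h p * s1 p = h p * \<alpha> p"
    and J_pos: "\<And>p. 0 < Im (cnj (s1 p) * s2 p)"
    and zero: "h p0 = 0"
  shows "h p1 = 0"
proof (rule ccontr)
  assume p1: "h p1 \<noteq> 0"
  define J where "J p = Im (cnj (s1 p) * s2 p)" for p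
  have Jp: "J p > 0" "J p \<noteq> 0" for p using J_pos[of p] by (auto simp: J_def)
  have s1n: "s1 p \<noteq> 0" for p using J_pos[of p] by auto
  \<comment> \<open>Cramer's rule for the real solution of
    \<open>ta * s2 - tb * s1 = i * \<alpha>\<close>.\<close>
  define ta where "ta p = Re (cnj (s1 p) * \<alpha> p) / J p" for p
  define tb where "tb p = Re (cnj (s2 p) * \<alpha> p) / J p" for p
  define a where "a p = Re (h p)" for p
  define b where "b p = Im (h p)" for p
  define k where "k p = (pdu h p + \<i> * of_real (ta p) * h p) / s1 p" for p
  have SJ: "smooth J" unfolding J_def[abs_def] by (intro smooth_intros smooth)
  have St: "smooth ta" "smooth tb"
    unfolding ta_def[abs_def] tb_def[abs_def] by (intro smooth_intros smooth SJ; rule Jp)+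
  have Sab: "smooth a" "smooth b"
    unfolding a_def[abs_def] b_def[abs_def] by (intro smooth_intros smooth)+
  have Sk: "smooth k" unfolding k_def[abs_def] by (intro smooth_intros smooth St; rule s1n)
  have perab: "torus_periodic a" "torus_periodic b" "torus_periodic ta" "torus_periodic tb"
    using per by (simp_all add: torus_periodic_def a_def b_def ta_def tb_def J_def)
  define W where "W p = (a p)\<^sup>2 + (b p)\<^sup>2" for p
  have SW: "smooth W" unfolding W_def[abs_def] by (intro smooth_intros Sab)
  have perW: "torus_periodic W" using perab by (simp add: torus_periodic_def W_def)
  obtain N where N: "N > 0" "\<And>p. \<bar>W p\<bar> \<le> N"
    by (rule torus_bounded[OF smooth_on_continuous[OF SW] perW]) blast
  \<comment> \<open>Scales the squared modulus so that \<open>V <= 1/2\<close>.\<close>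
  define c where "c = 1 / (2 * N)"
  have c: "c > 0" using N by (simp add: c_def)
  define V where "V p = c * W p" for p
  \<comment> \<open>The form with components \<open>b1\<close>, \<open>b2\<close> is
    \<open>2 c\<close> times the imaginary part of \<open>cnj h (dh + i tau h)\<close>; the real
    part gives the differential of \<open>V\<close>. As \<open>dh + i tau h\<close> is a multiple of
    sigma, the two forms are conjugate.\<close>
  define b1 where "b1 p = 2 * c * (a p * pdu b p - b p * pdu a p + ta p * W p)" for p
  define b2 where "b2 p = 2 * c * (a p * pdv b p - b p * pdv a p + tb p * W p)" for p
  define B where "B p = 4 * c * ((Re (k p))\<^sup>2 + (Im (k p))\<^sup>2) * J p" for p
  define T1 where "T1 p = 2 * ta p" for p
  define T2 where "T2 p = 2 * tb p" for p
  have SV: "smooth V" unfolding V_def[abs_def] by (intro smooth_intros SW)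
  have Sb: "smooth b1" "smooth b2"
    unfolding b1_def[abs_def] b2_def[abs_def] by (intro smooth_intros Sab St SW)+
  have ST: "smooth T1" "smooth T2"
    unfolding T1_def[abs_def] T2_def[abs_def] by (intro smooth_intros St)+
  have SB: "smooth B" unfolding B_def[abs_def] by (intro smooth_intros Sk SJ)
  have perV: "torus_periodic V" "torus_periodic b1" "torus_periodic b2" "torus_periodic T1" "torus_periodic T2"
    using perab perW torus_periodic_pd[OF perab(1)] torus_periodic_pd[OF perab(2)]
    by (simp_all add: torus_periodic_def V_def b1_def b2_def T1_def T2_def)
  have pab: "pdu a p = Re (pdu h p)" "pdv a p = Re (pdv h p)" "pdu b p = Im (pdu h p)" "pdv b p = Im (pdv h p)" for p
    unfolding a_def[abs_def] b_def[abs_def] by (simp_all add: pd_Re[OF smooth(1)] pd_Im[OF smooth(1)])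
  have ks1: "pdu h p + \<i> * of_real (ta p) * h p = k p * s1 p" for p
    unfolding k_def using s1n by simp
  have ta_tb: "of_real (ta p) * s2 p - of_real (tb p) * s1 p = \<i> * \<alpha> p" for p
  proof -
    have "of_real (J p) * (of_real (ta p) * s2 p - of_real (tb p) * s1 p) = of_real (J p) * (\<i> * \<alpha> p)"
    proof -
      have t: "of_real (J p) * (of_real (ta p) * s2 p - of_real (tb p) * s1 p)
         = of_real (ta p * J p) * s2 p - of_real (tb p * J p) * s1 p" by (simp add: algebra_simps)
      have "ta p * J p = Re (cnj (s1 p) * \<alpha> p)" "tb p * J p = Re (cnj (s2 p) * \<alpha> p)"
        using Jp(2)[of p] by (auto simp: ta_def tb_def)
      then show ?thesis unfolding t by (simp add: complex_eq_iff J_def algebra_simps)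
    qed
    then show ?thesis using Jp(2)[of p] by simp
  qed
  have ks2: "pdv h p + \<i> * of_real (tb p) * h p = k p * s2 p" for p
  proof -
    have "(pdv h p + \<i> * of_real (tb p) * h p) * s1 p
        = pdu h p * s2 p - h p * \<alpha> p + \<i> * (of_real (tb p) * s1 p) * h p"
      using eq[of p] by (simp add: algebra_simps)
    also have "of_real (tb p) * s1 p = of_real (ta p) * s2 p - \<i> * \<alpha> p"
      using ta_tb[of p] by (simp add: algebra_simps)
    also have "pdu h p * s2 p - h p * \<alpha> p + \<i> * (of_real (ta p) * s2 p - \<i> * \<alpha> p) * h p
       = (pdu h p + \<i> * of_real (ta p) * h p) * s2 p"
      by (simp add: algebra_simps)
    also have "\<dots> = k p * s2 p * s1 p" unfolding ks1 by (simp add: algebra_simps)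
    finally show ?thesis using s1n[of p] by simp
  qed
  define P1 where "P1 p = Re (k p * s1 p)" for p
  define R1 where "R1 p = Im (k p * s1 p)" for p
  define P2 where "P2 p = Re (k p * s2 p)" for p
  define R2 where "R2 p = Im (k p * s2 p)" for p
  have ders: "pdu a p = P1 p + ta p * b p" "pdu b p = R1 p - ta p * a p"
    "pdv a p = P2 p + tb p * b p" "pdv b p = R2 p - tb p * a p" for p
    unfolding pab P1_def R1_def P2_def R2_def ks1[symmetric] ks2[symmetric] a_def b_def by simp_all
  have PR: "P1 p * R2 p - R1 p * P2 p = ((Re (k p))\<^sup>2 + (Im (k p))\<^sup>2) * J p" for p
    unfolding P1_def R1_def P2_def R2_def J_def by (simp add: power2_eq_square algebra_simps)
  have PRn: "(P1 p)\<^sup>2 + (R1 p)\<^sup>2 = ((Re (k p))\<^sup>2 + (Im (k p))\<^sup>2) * (cmod (s1 p))\<^sup>2"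
     "(P2 p)\<^sup>2 + (R2 p)\<^sup>2 = ((Re (k p))\<^sup>2 + (Im (k p))\<^sup>2) * (cmod (s2 p))\<^sup>2" for p
    unfolding P1_def R1_def P2_def R2_def cmod_power2[symmetric] norm_mult power_mult_distrib by simp_all
  have pW: "pdu W p = 2 * (a p * pdu a p + b p * pdu b p)" "pdv W p = 2 * (a p * pdv a p + b p * pdv b p)" for p
    unfolding W_def[abs_def] using Sab by (simp_all add: pd_add pd_power2 smooth_on_power)
  have pV: "pdu V p = 2 * c * (a p * P1 p + b p * R1 p)" "pdv V p = 2 * c * (a p * P2 p + b p * R2 p)" for p
    unfolding V_def[abs_def] pd_cmult[OF SW] pW ders by (simp_all add: algebra_simps)
  have b12: "b1 p = 2 * c * (a p * R1 p - b p * P1 p)" "b2 p = 2 * c * (a p * R2 p - b p * P2 p)" for p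
    unfolding b1_def b2_def ders W_def by (simp_all add: algebra_simps power2_eq_square)
  note Spd = smooth_on_pdu[OF Sab(1)] smooth_on_pdu[OF Sab(2)] smooth_on_pdv[OF Sab(1)] smooth_on_pdv[OF Sab(2)]
  have db: "pdu b2 p - pdv b1 p = B p + V p * (pdu T2 p - pdv T1 p)" for p
  proof -
    have 1: "pdu b2 p = 2 * c * (a p * pdu (pdv b) p + pdu a p * pdv b p - (b p * pdu (pdv a) p + pdu b p * pdv a p)
         + (tb p * pdu W p + pdu tb p * W p))"
      unfolding b2_def[abs_def] using Sab Spd St SW
      by (simp add: pd_mult pd_add pd_diff pd_const smooth_on_mult smooth_on_add smooth_on_diff smooth_on_const)
    have 2: "pdv b1 p = 2 * c * (a p * pdv (pdu b) p + pdv a p * pdu b p - (b p * pdv (pdu a) p + pdv b p * pdu a p)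
         + (ta p * pdv W p + pdv ta p * W p))"
      unfolding b1_def[abs_def] using Sab Spd St SW
      by (simp add: pd_mult pd_add pd_diff pd_const smooth_on_mult smooth_on_add smooth_on_diff smooth_on_const)
    have 3: "pdu T2 p = 2 * pdu tb p" "pdv T1 p = 2 * pdv ta p"
      unfolding T1_def[abs_def] T2_def[abs_def] pd_cmult[OF St(1)] pd_cmult[OF St(2)] by simp_all
    \<comment> \<open>The second derivatives of \<open>a\<close> and \<open>b\<close> cancel by
      symmetry; what remains is a Jacobian and the curvature of the connection.\<close>
    have "pdu b2 p - pdv b1 p = 2 * c * (2 * (pdu a p * pdv b p - pdu b p * pdv a p)
        + tb p * pdu W p - ta p * pdv W p) + V p * (pdu T2 p - pdv T1 p)"
      unfolding 1 2 3 V_def pdu_pdv_commute[OF Sab(1)] pdu_pdv_commute[OF Sab(2)] by (simp add: algebra_simps)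
    also have "2 * (pdu a p * pdv b p - pdu b p * pdv a p) + tb p * pdu W p - ta p * pdv W p
       = 2 * (P1 p * R2 p - R1 p * P2 p)"
      unfolding pW ders by (simp add: algebra_simps)
    finally show ?thesis unfolding PR B_def by simp
  qed
  have dVb: "pdu V p * b2 p - pdv V p * b1 p = V p * B p" for p
  proof -
    have "pdu V p * b2 p - pdv V p * b1 p = 4 * c\<^sup>2 * W p * (P1 p * R2 p - R1 p * P2 p)"
      unfolding pV b12 W_def by (simp add: algebra_simps power2_eq_square)
    then show ?thesis unfolding PR B_def V_def by (simp add: power2_eq_square)
  qed
  \<comment> \<open>The quotient measures the eccentricity of sigma relative to the coordinates.
    Compactness bounds it, which is uniform ellipticity.\<close>
  have cJ: "continuous_on UNIV (\<lambda>p. ((cmod (s1 p))\<^sup>2 + (cmod (s2 p))\<^sup>2) / J p)"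
    using Jp(2) smooth_on_continuous[OF smooth(2)] smooth_on_continuous[OF smooth(3)] smooth_on_continuous[OF SJ]
    by (intro continuous_intros) auto
  have pJ: "torus_periodic (\<lambda>p. ((cmod (s1 p))\<^sup>2 + (cmod (s2 p))\<^sup>2) / J p)"
    using per by (simp add: torus_periodic_def J_def)
  obtain C where C: "C > 0" "\<And>p. \<bar>((cmod (s1 p))\<^sup>2 + (cmod (s2 p))\<^sup>2) / J p\<bar> \<le> C"
    by (rule torus_bounded[OF cJ pJ]) blast
  have CJ: "(cmod (s1 p))\<^sup>2 + (cmod (s2 p))\<^sup>2 \<le> C * J p" for p
    using C(2)[of p] Jp[of p] by (simp add: pos_divide_le_eq)
  have grad: "(pdu V p)\<^sup>2 + (pdv V p)\<^sup>2 \<le> C * (V p * B p)" for p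
  proof -
    have cs: "(x * y + z * t)\<^sup>2 \<le> (x\<^sup>2 + z\<^sup>2) * (y\<^sup>2 + t\<^sup>2)" for x y z t :: real
      using zero_le_power2[of "x * t - z * y"] by (simp add: power2_eq_square algebra_simps)
    have "(pdu V p)\<^sup>2 + (pdv V p)\<^sup>2 = 4 * c\<^sup>2 * ((a p * P1 p + b p * R1 p)\<^sup>2 + (a p * P2 p + b p * R2 p)\<^sup>2)"
      unfolding pV power_mult_distrib by (simp only: distrib_left) simp
    also have "\<dots> \<le> 4 * c\<^sup>2 * (W p * ((P1 p)\<^sup>2 + (R1 p)\<^sup>2) + W p * ((P2 p)\<^sup>2 + (R2 p)\<^sup>2))"
      unfolding W_def by (intro mult_left_mono add_mono cs) auto
    also have "\<dots> = 4 * c\<^sup>2 * W p * ((Re (k p))\<^sup>2 + (Im (k p))\<^sup>2) * ((cmod (s1 p))\<^sup>2 + (cmod (s2 p))\<^sup>2)"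
      unfolding PRn by (simp add: algebra_simps)
    also have "\<dots> \<le> 4 * c\<^sup>2 * W p * ((Re (k p))\<^sup>2 + (Im (k p))\<^sup>2) * (C * J p)"
      by (intro mult_left_mono CJ mult_nonneg_nonneg) (auto simp: W_def)
    also have "\<dots> = C * (V p * B p)" unfolding V_def B_def by (simp add: power2_eq_square)
    finally show ?thesis .
  qed
  have cK: "continuous_on UNIV (\<lambda>p. pdu T2 p - pdv T1 p)"
    by (intro smooth_on_continuous smooth_intros ST)
  have pK: "torus_periodic (\<lambda>p. pdu T2 p - pdv T1 p)"
    using torus_periodic_pd(1)[OF perV(5)] torus_periodic_pd(2)[OF perV(4)] by (simp add: torus_periodic_def)
  obtain K where K: "K > 0" "\<And>p. \<bar>pdu T2 p - pdv T1 p\<bar> \<le> K"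
    by (rule torus_bounded[OF cK pK]) blast
  interpret torus_elliptic V "pdu V" "pdv V" b1 b2 "pdv b1" "pdu b2" T1 T2 "pdv T1" "pdu T2" B C K
  proof unfold_locales
    show "0 \<le> V p" for p unfolding V_def W_def using c by simp
    show "V p \<le> 1/2" for p
    proof -
      have "c * W p \<le> c * N" using N(2)[of p] c by (intro mult_left_mono) auto
      then show ?thesis unfolding V_def c_def using N(1) by simp
    qed
    show "0 \<le> B p" for p unfolding B_def using c Jp(1)[of p] by simp
  qed (intro perV smooth_has_pu smooth_has_pv smooth_on_continuous SV Sb ST SB smooth_on_pdu smooth_on_pdv db dVb grad K(2) C(1))+
  obtain u0 t0 where p0: "p0 = (u0, t0)" by (cases p0)
  obtain M1 where M1: "0 \<le> M1" "\<And>p. (a p)\<^sup>2 \<le> M1 * ((sin (pi * (fst p - u0)))\<^sup>2 + (sin (pi * (snd p - t0)))\<^sup>2)"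
    by (rule torus_zero_quadratic[OF Sab(1) perab(1), of u0 t0]) (use zero p0 in \<open>auto simp: a_def\<close>)
  obtain M2 where M2: "0 \<le> M2" "\<And>p. (b p)\<^sup>2 \<le> M2 * ((sin (pi * (fst p - u0)))\<^sup>2 + (sin (pi * (snd p - t0)))\<^sup>2)"
    by (rule torus_zero_quadratic[OF Sab(2) perab(2), of u0 t0]) (use zero p0 in \<open>auto simp: b_def\<close>)
  show False
  proof (rule no_zero[of p1 "c * (M1 + M2) + 1" u0 t0])
    have "W p1 > 0" using p1 unfolding W_def a_def b_def
      by (metis complex_eq_iff sum_power2_gt_zero_iff zero_complex.simps)
    then show "V p1 > 0" unfolding V_def using c by simp
    \<comment> \<open>The summand 1 only serves to meet the requirement that the constant be at
      least 1.\<close>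
    show "1 \<le> c * (M1 + M2) + 1" using c M1 M2 by simp
    fix p
    define q where "q = (sin (pi * (fst p - u0)))\<^sup>2 + (sin (pi * (snd p - t0)))\<^sup>2"
    have "W p \<le> M1 * q + M2 * q" unfolding W_def using M1(2)[of p] M2(2)[of p] by (simp add: q_def)
    then have "c * W p \<le> c * (M1 * q + M2 * q)" using c by (intro mult_left_mono) auto
    also have "\<dots> \<le> (c * (M1 + M2) + 1) * q" by (simp add: algebra_simps q_def)
    finally show "V p \<le> (c * (M1 + M2) + 1) * ((sin (pi * (fst p - u0)))\<^sup>2 + (sin (pi * (snd p - t0)))\<^sup>2)"
      by (simp add: V_def q_def)
  qed
qed

section \<open>Adapted frames\<close>

lemmas pd_inner = pd_bilinear[OF bounded_bilinear_inner]

lemma pd_orth: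
  assumes "smooth f" "smooth g" "\<And>p. f p \<bullet> g p = (c::real)"
  shows "pdu f p \<bullet> g p = - (f p \<bullet> pdu g p)" "pdv f p \<bullet> g p = - (f p \<bullet> pdv g p)"
proof -
  have "pdu (\<lambda>p. f p \<bullet> g p) p = 0" "pdv (\<lambda>p. f p \<bullet> g p) p = 0"
    unfolding assms(3) by (simp_all add: pdu_def pdv_def)
  then show "pdu f p \<bullet> g p = - (f p \<bullet> pdu g p)" "pdv f p \<bullet> g p = - (f p \<bullet> pdv g p)"
    using pd_inner[OF assms(1,2), of p] by simp_all
qed

text \<open>Symmetry of second derivatives removes them from the exterior derivative of the form
  \<open>dy . e\<close>. All structure equations come from this.\<close>

lemma d_inner_pd:
  assumes "smooth (y :: real \<times> real \<Rightarrow> real^3)" "smooth e"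
  shows "pdu (\<lambda>p. pdv y p \<bullet> e p) p - pdv (\<lambda>p. pdu y p \<bullet> e p) p = pdv y p \<bullet> pdu e p - pdu y p \<bullet> pdv e p"
  unfolding pd_inner[OF smooth_on_pdv[OF assms(1)] assms(2)] pd_inner[OF smooth_on_pdu[OF assms(1)] assms(2)]
    pdu_pdv_commute[OF assms(1)] by simp

lemma pd_minus: "smooth f \<Longrightarrow> pdu (\<lambda>p. - f p) p = - pdu f p"
  "smooth f \<Longrightarrow> pdv (\<lambda>p. - f p) p = - pdv f p"
  using pd_bounded_linear[OF bounded_linear_minus[OF bounded_linear_ident]] by blast+

lemma torus_immersionD:
  assumes "torus_immersion x"
  shows "smooth x" "torus_periodic x" "xu x = pdu x" "xv x = pdv x"
    "dx x p c = fst c *\<^sub>R pdu x p + snd c *\<^sub>R pdv x p" "cross3 (pdu x p) (pdv x p) \<noteq> 0"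
proof -
  show S: "smooth x" and "torus_periodic x" using assms by (auto simp: torus_immersion_def)
  show "xu x = pdu x" "xv x = pdv x" by (auto simp: xu_def xv_def dx_def pdu_def pdv_def)
  show D: "dx x p c = fst c *\<^sub>R pdu x p + snd c *\<^sub>R pdv x p" for p c
    unfolding dx_def by (rule frechet_derivative_eq_pd[OF S])
  have inj: "inj (dx x p)" using assms unfolding torus_immersion_def by blast
  show "cross3 (pdu x p) (pdv x p) \<noteq> 0"
  proof
    assume "cross3 (pdu x p) (pdv x p) = 0"
    then have "collinear {0, pdu x p, pdv x p}" by (simp add: cross_eq_0)
    then consider "pdu x p = 0" | "pdv x p = 0" | c where "pdv x p = c *\<^sub>R pdu x p"
      unfolding collinear_lemma by blast
    then show False
    proof cases
      case 1
      then have "dx x p (1, 0) = dx x p (0, 0)" by (simp add: D)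
      then show ?thesis using inj by (auto dest: injD)
    next
      case 2
      then have "dx x p (0, 1) = dx x p (0, 0)" by (simp add: D)
      then show ?thesis using inj by (auto dest: injD)
    next
      case 3
      then have "dx x p (0, 1) = dx x p (c, 0)" by (simp add: D)
      then show ?thesis using inj by (auto dest: injD)
    qed
  qed
qed

lemma smooth_unit_normal:
  assumes "torus_immersion x"
  shows "smooth (unit_normal x)"
proof -
  note D = torus_immersionD[OF assms]
  have c: "smooth (\<lambda>p. cross3 (pdu x p) (pdv x p))" by (intro smooth_intros D)
  have "smooth (\<lambda>p. (1 / sqrt (cross3 (pdu x p) (pdv x p) \<bullet> cross3 (pdu x p) (pdv x p))) *\<^sub>R cross3 (pdu x p) (pdv x p))"
    by (intro smooth_intros smooth_on_sqrt c D) (use D(6) in auto)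
  then show ?thesis
    by (rule smooth_on_cong) (simp add: unit_normal_def D(3,4) norm_eq_sqrt_inner)
qed

locale adapted_frame =
  fixes x :: "real \<times> real \<Rightarrow> real^3" and e1 e2 :: "real \<times> real \<Rightarrow> real^3"
  assumes imm: "torus_immersion x"
    and Se: "smooth e1" "smooth e2"
    and on: "\<And>p. e1 p \<bullet> e1 p = 1" "\<And>p. e2 p \<bullet> e2 p = 1" "\<And>p. e1 p \<bullet> e2 p = 0"
    and cr: "\<And>p. cross3 (e1 p) (e2 p) = unit_normal x p"
begin

abbreviation n where "n \<equiv> unit_normal x"
text \<open>The forms of the moving frame by their coordinate components: \<open>w1\<close>,
  \<open>w2\<close> are the coframe, \<open>k1\<close>, \<open>k2\<close> the tangential components
  of \<open>- dn\<close>, \<open>r\<close> is the connection form and \<open>W\<close> the area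
  density. The functions \<open>h11\<close>, \<open>h12\<close>, \<open>h22\<close> solve
  \<open>k_i = sum_j h_ij w_j\<close> by Cramer's rule.\<close>

definition w1u where "w1u p = pdu x p \<bullet> e1 p"
definition w1v where "w1v p = pdv x p \<bullet> e1 p"
definition w2u where "w2u p = pdu x p \<bullet> e2 p"
definition w2v where "w2v p = pdv x p \<bullet> e2 p"
definition k1u where "k1u p = - (pdu n p \<bullet> e1 p)"
definition k1v where "k1v p = - (pdv n p \<bullet> e1 p)"
definition k2u where "k2u p = - (pdu n p \<bullet> e2 p)"
definition k2v where "k2v p = - (pdv n p \<bullet> e2 p)"
definition ru where "ru p = pdu e1 p \<bullet> e2 p"
definition rv where "rv p = pdv e1 p \<bullet> e2 p"
definition W where "W p = w1u p * w2v p - w1v p * w2u p"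
definition h11 where "h11 p = (k1u p * w2v p - k1v p * w2u p) / W p"
definition h12 where "h12 p = (w1u p * k1v p - w1v p * k1u p) / W p"
definition h22 where "h22 p = (w1u p * k2v p - w1v p * k2u p) / W p"

lemmas Sx = torus_immersionD(1)[OF imm]
lemmas Sn = smooth_unit_normal[OF imm]
lemmas dx_eq = torus_immersionD(5)[OF imm]

lemma nn: "n p \<bullet> n p = 1" "e1 p \<bullet> n p = 0" "e2 p \<bullet> n p = 0" "n p \<bullet> e1 p = 0" "n p \<bullet> e2 p = 0" "e2 p \<bullet> e1 p = 0"
proof -
  show "e1 p \<bullet> n p = 0" "e2 p \<bullet> n p = 0" "n p \<bullet> e1 p = 0" "n p \<bullet> e2 p = 0"
    unfolding cr[symmetric] by (simp_all add: dot_cross_self)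
  show "e2 p \<bullet> e1 p = 0" using on(3) by (simp add: inner_commute)
  have "(norm (n p))\<^sup>2 = 1"
    using norm_cross_dot[of "e1 p" "e2 p"] on cr by (simp add: norm_eq_sqrt_inner)
  then show "n p \<bullet> n p = 1" by (simp add: power2_norm_eq_inner)
qed

lemma xn: "pdu x p \<bullet> n p = 0" "pdv x p \<bullet> n p = 0"
  unfolding unit_normal_def torus_immersionD(3,4)[OF imm] by (simp_all add: dot_cross_self)

lemma expand: "a = (a \<bullet> e1 p) *\<^sub>R e1 p + (a \<bullet> e2 p) *\<^sub>R e2 p + (a \<bullet> n p) *\<^sub>R n p"
proof -
  define r where "r = a - ((a \<bullet> e1 p) *\<^sub>R e1 p + (a \<bullet> e2 p) *\<^sub>R e2 p + (a \<bullet> n p) *\<^sub>R n p)"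
  have r: "r \<bullet> e1 p = 0" "r \<bullet> e2 p = 0" "r \<bullet> n p = 0"
    unfolding r_def using on nn by (simp_all add: inner_diff_left inner_add_left)
  \<comment> \<open>As \<open>n\<close> is the cross product of \<open>e1\<close> and
    \<open>e2\<close>, the remainder has zero cross product and zero inner product with
    \<open>n\<close>, hence vanishes.\<close>
  have "cross3 r (n p) = (r \<bullet> e2 p) *\<^sub>R e1 p - (r \<bullet> e1 p) *\<^sub>R e2 p"
    unfolding cr[symmetric] by (simp add: cross3_simps) (simp add: forall_3)
  then have "cross3 r (n p) = 0" using r by simp
  then have "r = 0 \<or> n p = 0" using r(3) norm_and_cross_eq_0 by blast
  then have "r = 0" using nn(1)[of p] by auto
  then show ?thesis by (simp add: r_def)
qed

lemma inner_expand: "a \<bullet> b = (a \<bullet> e1 p) * (b \<bullet> e1 p) + (a \<bullet> e2 p) * (b \<bullet> e2 p) + (a \<bullet> n p) * (b \<bullet> n p)"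
  by (subst expand[of a p]) (simp add: inner_add_left inner_commute[of b])

lemma xu_expand: "pdu x p = w1u p *\<^sub>R e1 p + w2u p *\<^sub>R e2 p" "pdv x p = w1v p *\<^sub>R e1 p + w2v p *\<^sub>R e2 p"
  using expand[of "pdu x p" p] expand[of "pdv x p" p] xn by (simp_all add: w1u_def w2u_def w1v_def w2v_def)

text \<open>The cross product of the coordinate vectors is both \<open>W\<close> times the normal
  and, by the choice of the normal, its own length times the normal.\<close>

lemma W_pos: "W p > 0"
proof -
  have "cross3 (pdu x p) (pdv x p) = W p *\<^sub>R n p"
    unfolding xu_expand W_def cr[symmetric]
    by (simp add: cross_add_left cross_add_right cross_mult_left cross_mult_right cross_skew[of "e2 p" "e1 p"] algebra_simps)
  moreover have "cross3 (pdu x p) (pdv x p) = norm (cross3 (pdu x p) (pdv x p)) *\<^sub>R n p"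
    unfolding unit_normal_def torus_immersionD(3,4)[OF imm] using torus_immersionD(6)[OF imm, of p] by simp
  ultimately have "W p * (n p \<bullet> n p) = norm (cross3 (pdu x p) (pdv x p)) * (n p \<bullet> n p)"
    by (metis inner_scaleR_left)
  then show ?thesis using torus_immersionD(6)[OF imm, of p] by (simp add: nn)
qed

lemma W_ne: "W p \<noteq> 0" using W_pos[of p] by simp

lemma smooth_forms:
  "smooth w1u" "smooth w1v" "smooth w2u" "smooth w2v"
  "smooth k1u" "smooth k1v" "smooth k2u" "smooth k2v"
  "smooth ru" "smooth rv" "smooth W"
  unfolding w1u_def[abs_def] w1v_def[abs_def] w2u_def[abs_def] w2v_def[abs_def]
    k1u_def[abs_def] k1v_def[abs_def] k2u_def[abs_def] k2v_def[abs_def] ru_def[abs_def] rv_def[abs_def] W_def[abs_def]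
  by (intro smooth_intros Sx Se Sn)+

lemma smooth_h: "smooth h11" "smooth h12" "smooth h22"
  unfolding h11_def[abs_def] h12_def[abs_def] h22_def[abs_def]
  by (intro smooth_intros smooth_forms; rule W_ne)+

lemma frame_derivs:
  "pdu e1 p \<bullet> e1 p = 0" "pdv e1 p \<bullet> e1 p = 0" "pdu e2 p \<bullet> e2 p = 0" "pdv e2 p \<bullet> e2 p = 0"
  "pdu n p \<bullet> n p = 0" "pdv n p \<bullet> n p = 0"
  "pdu e1 p \<bullet> e2 p = ru p" "pdv e1 p \<bullet> e2 p = rv p" "pdu e2 p \<bullet> e1 p = - ru p" "pdv e2 p \<bullet> e1 p = - rv p"
  "pdu e1 p \<bullet> n p = k1u p" "pdv e1 p \<bullet> n p = k1v p" "pdu e2 p \<bullet> n p = k2u p" "pdv e2 p \<bullet> n p = k2v p"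
  "pdu n p \<bullet> e1 p = - k1u p" "pdv n p \<bullet> e1 p = - k1v p" "pdu n p \<bullet> e2 p = - k2u p" "pdv n p \<bullet> e2 p = - k2v p"
proof -
  show "pdu e1 p \<bullet> e1 p = 0" "pdv e1 p \<bullet> e1 p = 0"
    using pd_orth[OF Se(1) Se(1) on(1), of p] by (simp_all add: inner_commute)
  show "pdu e2 p \<bullet> e2 p = 0" "pdv e2 p \<bullet> e2 p = 0"
    using pd_orth[OF Se(2) Se(2) on(2), of p] by (simp_all add: inner_commute)
  show "pdu n p \<bullet> n p = 0" "pdv n p \<bullet> n p = 0"
    using pd_orth[OF Sn Sn nn(1), of p] by (simp_all add: inner_commute)
  show "pdu e1 p \<bullet> e2 p = ru p" "pdv e1 p \<bullet> e2 p = rv p" by (simp_all add: ru_def rv_def)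
  show "pdu e2 p \<bullet> e1 p = - ru p" "pdv e2 p \<bullet> e1 p = - rv p"
    using pd_orth[OF Se(2) Se(1) nn(6), of p] by (simp_all add: ru_def rv_def inner_commute)
  show "pdu e1 p \<bullet> n p = k1u p" "pdv e1 p \<bullet> n p = k1v p"
    using pd_orth[OF Se(1) Sn nn(2), of p] by (simp_all add: k1u_def k1v_def inner_commute)
  show "pdu e2 p \<bullet> n p = k2u p" "pdv e2 p \<bullet> n p = k2v p"
    using pd_orth[OF Se(2) Sn nn(3), of p] by (simp_all add: k2u_def k2v_def inner_commute)
  show "pdu n p \<bullet> e1 p = - k1u p" "pdv n p \<bullet> e1 p = - k1v p" "pdu n p \<bullet> e2 p = - k2u p" "pdv n p \<bullet> e2 p = - k2v p"
    by (simp_all add: k1u_def k1v_def k2u_def k2v_def)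
qed

text \<open>Each exterior derivative is reduced by \<open>d_inner_pd\<close> and expanded in the
  frame. In order: two equations for the coframe (vanishing torsion), two Codazzi equations, and the
  Gauss equation.\<close>

lemma structure_eqs:
  "pdu w1v p - pdv w1u p = ru p * w2v p - rv p * w2u p"
  "pdu w2v p - pdv w2u p = - (ru p * w1v p - rv p * w1u p)"
  "pdu k1v p - pdv k1u p = ru p * k2v p - rv p * k2u p"
  "pdu k2v p - pdv k2u p = - (ru p * k1v p - rv p * k1u p)"
  "pdu rv p - pdv ru p = - (k1u p * k2v p - k1v p * k2u p)"
proof -
  show "pdu w1v p - pdv w1u p = ru p * w2v p - rv p * w2u p"
    unfolding w1v_def[abs_def] w1u_def[abs_def] d_inner_pd[OF Sx Se(1)]
    unfolding inner_expand[of "pdv x p" "pdu e1 p" p] inner_expand[of "pdu x p" "pdv e1 p" p] frame_derivs xn w2u_def w2v_def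
    by simp
  show "pdu w2v p - pdv w2u p = - (ru p * w1v p - rv p * w1u p)"
    unfolding w2v_def[abs_def] w2u_def[abs_def] d_inner_pd[OF Sx Se(2)]
    unfolding inner_expand[of "pdv x p" "pdu e2 p" p] inner_expand[of "pdu x p" "pdv e2 p" p] frame_derivs xn w1u_def w1v_def
    by simp
  note Sne = smooth_on_inner[OF smooth_on_pdv[OF Sn] Se(1)] smooth_on_inner[OF smooth_on_pdv[OF Sn] Se(2)]
    smooth_on_inner[OF smooth_on_pdu[OF Sn] Se(1)] smooth_on_inner[OF smooth_on_pdu[OF Sn] Se(2)]
  have "pdu k1v p - pdv k1u p = - (pdv n p \<bullet> pdu e1 p - pdu n p \<bullet> pdv e1 p)"
    unfolding k1v_def[abs_def] k1u_def[abs_def] pd_minus[OF Sne(1)] pd_minus[OF Sne(3)] d_inner_pd[OF Sn Se(1), symmetric] by simp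
  then show "pdu k1v p - pdv k1u p = ru p * k2v p - rv p * k2u p"
    unfolding inner_expand[of "pdv n p" "pdu e1 p" p] inner_expand[of "pdu n p" "pdv e1 p" p] frame_derivs by simp
  have "pdu k2v p - pdv k2u p = - (pdv n p \<bullet> pdu e2 p - pdu n p \<bullet> pdv e2 p)"
    unfolding k2v_def[abs_def] k2u_def[abs_def] pd_minus[OF Sne(2)] pd_minus[OF Sne(4)] d_inner_pd[OF Sn Se(2), symmetric] by simp
  then show "pdu k2v p - pdv k2u p = - (ru p * k1v p - rv p * k1u p)"
    unfolding inner_expand[of "pdv n p" "pdu e2 p" p] inner_expand[of "pdu n p" "pdv e2 p" p] frame_derivs by simp
  show "pdu rv p - pdv ru p = - (k1u p * k2v p - k1v p * k2u p)"
    unfolding rv_def[abs_def] ru_def[abs_def] d_inner_pd[OF Se(1) Se(2)]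
    unfolding inner_expand[of "pdv e1 p" "pdu e2 p" p] inner_expand[of "pdu e1 p" "pdv e2 p" p] frame_derivs by simp
qed

lemma second_derivs_normal:
  "pdu (pdu x) p \<bullet> n p = w1u p * k1u p + w2u p * k2u p"
  "pdu (pdv x) p \<bullet> n p = w1v p * k1u p + w2v p * k2u p"
  "pdv (pdu x) p \<bullet> n p = w1u p * k1v p + w2u p * k2v p"
  "pdv (pdv x) p \<bullet> n p = w1v p * k1v p + w2v p * k2v p"
proof -
  note A = pd_orth[OF smooth_on_pdu[OF Sx] Sn xn(1), of p] pd_orth[OF smooth_on_pdv[OF Sx] Sn xn(2), of p]
  note B = inner_expand[of "pdu x p" "pdu n p" p] inner_expand[of "pdu x p" "pdv n p" p]
    inner_expand[of "pdv x p" "pdu n p" p] inner_expand[of "pdv x p" "pdv n p" p]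
  show "pdu (pdu x) p \<bullet> n p = w1u p * k1u p + w2u p * k2u p"
    "pdu (pdv x) p \<bullet> n p = w1v p * k1u p + w2v p * k2u p"
    "pdv (pdu x) p \<bullet> n p = w1u p * k1v p + w2u p * k2v p"
    "pdv (pdv x) p \<bullet> n p = w1v p * k1v p + w2v p * k2v p"
    unfolding A B frame_derivs xn w1u_def w1v_def w2u_def w2v_def by simp_all
qed

text \<open>Equality of the mixed derivatives of \<open>x\<close>; this is the symmetry of the
  second fundamental form and makes the two expressions for \<open>h12\<close> agree.\<close>

lemma kw_sym: "w1v p * k1u p + w2v p * k2u p = w1u p * k1v p + w2u p * k2v p"
  using second_derivs_normal(2,3)[of p] pdu_pdv_commute[OF Sx, of p] by simp

lemma h12_alt: "h12 p = (k2u p * w2v p - k2v p * w2u p) / W p"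
  unfolding h12_def using kw_sym[of p] by (simp add: algebra_simps)

lemma k_eq:
  "k1u p = h11 p * w1u p + h12 p * w2u p" "k1v p = h11 p * w1v p + h12 p * w2v p"
  "k2u p = h12 p * w1u p + h22 p * w2u p" "k2v p = h12 p * w1v p + h22 p * w2v p"
proof -
  have *: "a = ((a * w2v p - b * w2u p) / W p) * w1u p + ((w1u p * b - w1v p * a) / W p) * w2u p"
    "b = ((a * w2v p - b * w2u p) / W p) * w1v p + ((w1u p * b - w1v p * a) / W p) * w2v p" for a b
  proof -
    have "a * W p = (a * w2v p - b * w2u p) * w1u p + (w1u p * b - w1v p * a) * w2u p"
      "b * W p = (a * w2v p - b * w2u p) * w1v p + (w1u p * b - w1v p * a) * w2v p"
      by (simp_all add: W_def algebra_simps)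
    then show "a = ((a * w2v p - b * w2u p) / W p) * w1u p + ((w1u p * b - w1v p * a) / W p) * w2u p"
      "b = ((a * w2v p - b * w2u p) / W p) * w1v p + ((w1u p * b - w1v p * a) / W p) * w2v p"
      using W_ne[of p] unfolding times_divide_eq_left add_divide_distrib[symmetric] by (simp_all only: eq_divide_eq) simp_all
  qed
  show "k1u p = h11 p * w1u p + h12 p * w2u p" "k1v p = h11 p * w1v p + h12 p * w2v p"
    using *[where a = "k1u p" and b = "k1v p"] unfolding h11_def h12_def by simp_all
  show "k2u p = h12 p * w1u p + h22 p * w2u p" "k2v p = h12 p * w1v p + h22 p * w2v p"
    using *[where a = "k2u p" and b = "k2v p"] unfolding h12_alt h22_def by simp_all
qed

lemma sff_pd: "sff x p c d =
    fst c * fst d * (pdu (pdu x) p \<bullet> n p) + fst c * snd d * (pdu (pdv x) p \<bullet> n p)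
    + snd c * fst d * (pdv (pdu x) p \<bullet> n p) + snd c * snd d * (pdv (pdv x) p \<bullet> n p)"
proof -
  have S: "smooth (\<lambda>q. fst d *\<^sub>R pdu x q)" "smooth (\<lambda>q. snd d *\<^sub>R pdv x q)"
    by (intro smooth_intros Sx)+
  have "diter [c, d] x p = frechet_derivative (\<lambda>q. fst d *\<^sub>R pdu x q + snd d *\<^sub>R pdv x q) (at p) c"
    by (simp add: frechet_derivative_eq_pd[OF Sx])
  also have "\<dots> = fst c *\<^sub>R (fst d *\<^sub>R pdu (pdu x) p + snd d *\<^sub>R pdu (pdv x) p)
      + snd c *\<^sub>R (fst d *\<^sub>R pdv (pdu x) p + snd d *\<^sub>R pdv (pdv x) p)"
    unfolding frechet_derivative_eq_pd[OF smooth_on_add[OF S]] pd_add[OF S]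
      pd_bounded_linear[OF bounded_linear_scaleR_right smooth_on_pdu[OF Sx]]
      pd_bounded_linear[OF bounded_linear_scaleR_right smooth_on_pdv[OF Sx]] ..
  finally show ?thesis unfolding sff_def by (simp add: inner_add_left algebra_simps)
qed

lemma sff_frame: "sff x p c d = h11 p * ((dx x p c \<bullet> e1 p) * (dx x p d \<bullet> e1 p))
    + h12 p * ((dx x p c \<bullet> e1 p) * (dx x p d \<bullet> e2 p) + (dx x p c \<bullet> e2 p) * (dx x p d \<bullet> e1 p))
    + h22 p * ((dx x p c \<bullet> e2 p) * (dx x p d \<bullet> e2 p))"
  unfolding sff_pd second_derivs_normal k_eq dx_eq
  by (simp add: inner_add_left w1u_def[symmetric] w1v_def[symmetric] w2u_def[symmetric] w2v_def[symmetric] algebra_simps)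

lemma fff_frame: "fff x p c d = (dx x p c \<bullet> e1 p) * (dx x p d \<bullet> e1 p) + (dx x p c \<bullet> e2 p) * (dx x p d \<bullet> e2 p)"
proof -
  have "dx x p c \<bullet> n p = 0" unfolding dx_eq by (simp add: inner_add_left xn)
  then show ?thesis unfolding fff_def inner_expand[of "dx x p c" "dx x p d" p] by simp
qed

section \<open>Curvatures and umbilics in terms of the frame\<close>

text \<open>The columns of the inverse of the coframe matrix, whose determinant is \<open>W\<close>:
  coordinates of the frame vectors.\<close>

definition c1 where "c1 p = (w2v p / W p, - w2u p / W p)"
definition c2 where "c2 p = (- w1v p / W p, w1u p / W p)"

lemma dx_c: "dx x p (c1 p) = e1 p" "dx x p (c2 p) = e2 p"
proof -
  have 1: "w2v p / W p * w1u p - w2u p / W p * w1v p = 1" "- w1v p / W p * w2u p + w1u p / W p * w2v p = 1"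
    using W_ne[of p] by (simp_all add: W_def diff_divide_distrib[symmetric] mult.commute)
  have "dx x p (c1 p) = (w2v p / W p * w1u p - w2u p / W p * w1v p) *\<^sub>R e1 p"
    unfolding dx_eq c1_def xu_expand by (simp add: algebra_simps)
  then show "dx x p (c1 p) = e1 p" unfolding 1 by simp
  have "dx x p (c2 p) = (- w1v p / W p * w2u p + w1u p / W p * w2v p) *\<^sub>R e2 p"
    unfolding dx_eq c2_def xu_expand by (simp add: algebra_simps)
  then show "dx x p (c2 p) = e2 p" unfolding 1 by simp
qed

lemma h_eq_sff: "h11 p = sff x p (c1 p) (c1 p)" "h12 p = sff x p (c1 p) (c2 p)" "h22 p = sff x p (c2 p) (c2 p)"
  unfolding sff_frame dx_c by (simp_all add: on nn)

text \<open>Passing from the coordinate basis to the orthonormal frame multiplies numerators and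
  denominators alike by \<open>W^2\<close>.\<close>

lemma mean_gauss: "mean_curv x p = (h11 p + h22 p) / 2" "gauss_curv x p = h11 p * h22 p - (h12 p)\<^sup>2"
proof -
  have d: "dx x p (1, 0) \<bullet> e1 p = w1u p" "dx x p (1, 0) \<bullet> e2 p = w2u p"
     "dx x p (0, 1) \<bullet> e1 p = w1v p" "dx x p (0, 1) \<bullet> e2 p = w2v p"
    unfolding dx_eq w1u_def w2u_def w1v_def w2v_def by simp_all
  define E where "E = fff x p (1,0) (1,0)"
  define F where "F = fff x p (1,0) (0,1)"
  define G where "G = fff x p (0,1) (0,1)"
  define L where "L = sff x p (1,0) (1,0)"
  define M where "M = sff x p (1,0) (0,1)"
  define N where "N = sff x p (0,1) (0,1)"
  note defs = E_def F_def G_def L_def M_def N_def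
  have 1: "E * G - F\<^sup>2 = (W p)\<^sup>2"
    unfolding defs fff_frame d W_def by (simp add: power2_eq_square algebra_simps)
  have 2: "E * N - 2 * F * M + G * L = (h11 p + h22 p) * (W p)\<^sup>2"
    unfolding defs fff_frame sff_frame d W_def by (simp add: power2_eq_square algebra_simps)
  have 3: "L * N - M\<^sup>2 = (h11 p * h22 p - (h12 p)\<^sup>2) * (W p)\<^sup>2"
    unfolding defs fff_frame sff_frame d W_def by (simp add: power2_eq_square algebra_simps)
  show "mean_curv x p = (h11 p + h22 p) / 2"
    unfolding mean_curv_def Let_def defs[symmetric] 1 2 using W_ne[of p] by simp
  show "gauss_curv x p = h11 p * h22 p - (h12 p)\<^sup>2"
    unfolding gauss_curv_def Let_def defs[symmetric] 1 3 using W_ne[of p] by simp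
qed

text \<open>Together with \<open>h12\<close> this is the trace-free part of the second fundamental
  form.\<close>

definition A where "A p = (h11 p - h22 p) / 2"

lemma smooth_A: "smooth A"
  unfolding A_def[abs_def] by (intro smooth_intros smooth_h) simp

lemma V_eq: "(mean_curv x p)\<^sup>2 - gauss_curv x p = (A p)\<^sup>2 + (h12 p)\<^sup>2"
  unfolding mean_gauss A_def by (simp add: power2_eq_square field_simps)

lemma smooth_H: "smooth (mean_curv x)"
proof -
  have "smooth (\<lambda>p. (h11 p + h22 p) / 2)" by (intro smooth_intros smooth_h) simp
  then show ?thesis by (rule smooth_on_cong) (simp add: mean_gauss)
qed

text \<open>Equal supremum and infimum make the normal curvature constant, once boundedness has made
  both meaningful. The directions \<open>e1\<close>, \<open>e2\<close> and \<open>e1 + e2\<close>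
  then determine the whole form.\<close>

lemma umbilic_imp:
  assumes "umbilic x p"
  shows "A p = 0" "h12 p = 0"
proof -
  define N where "N = {normal_curv x p c | c. c \<noteq> 0}"
  define D where "D c = dx x p c" for c
  have nc: "normal_curv x p c = (h11 p * (D c \<bullet> e1 p)\<^sup>2 + 2 * h12 p * ((D c \<bullet> e1 p) * (D c \<bullet> e2 p)) + h22 p * (D c \<bullet> e2 p)\<^sup>2)
      / ((D c \<bullet> e1 p)\<^sup>2 + (D c \<bullet> e2 p)\<^sup>2)" for c
    unfolding normal_curv_def sff_frame fff_frame D_def by (simp add: power2_eq_square algebra_simps)
  have bound: "\<bar>normal_curv x p c\<bar> \<le> \<bar>h11 p\<bar> + \<bar>h12 p\<bar> + \<bar>h22 p\<bar>" for c
  proof -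
    define a b where "a = D c \<bullet> e1 p" and "b = D c \<bullet> e2 p"
    have "2 * \<bar>a * b\<bar> \<le> a\<^sup>2 + b\<^sup>2"
      using zero_le_power2[of "\<bar>a\<bar> - \<bar>b\<bar>"] by (simp add: power2_eq_square algebra_simps abs_mult)
    then have "\<bar>h12 p\<bar> * (2 * \<bar>a * b\<bar>) \<le> \<bar>h12 p\<bar> * (a\<^sup>2 + b\<^sup>2)" by (intro mult_left_mono) auto
    then have m: "\<bar>2 * h12 p * (a * b)\<bar> \<le> \<bar>h12 p\<bar> * (a\<^sup>2 + b\<^sup>2)" by (simp add: abs_mult algebra_simps)
    have m1: "\<bar>h11 p * a\<^sup>2\<bar> \<le> \<bar>h11 p\<bar> * (a\<^sup>2 + b\<^sup>2)" "\<bar>h22 p * b\<^sup>2\<bar> \<le> \<bar>h22 p\<bar> * (a\<^sup>2 + b\<^sup>2)"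
      by (simp_all add: abs_mult mult_left_mono)
    have "\<bar>h11 p * a\<^sup>2 + 2 * h12 p * (a * b) + h22 p * b\<^sup>2\<bar> \<le> (\<bar>h11 p\<bar> + \<bar>h12 p\<bar> + \<bar>h22 p\<bar>) * (a\<^sup>2 + b\<^sup>2)"
      using m m1 unfolding distrib_right by linarith
    \<comment> \<open>The case \<open>t = 0\<close> covers the zero direction, where the quotient is
      0 by convention.\<close>
    moreover have "m / t \<le> C" if "m \<le> C * t" "0 \<le> t" "0 \<le> C" for m t C :: real
      using that by (cases "t = 0") (auto simp: pos_divide_le_eq)
    ultimately have "\<bar>h11 p * a\<^sup>2 + 2 * h12 p * (a * b) + h22 p * b\<^sup>2\<bar> / (a\<^sup>2 + b\<^sup>2) \<le> \<bar>h11 p\<bar> + \<bar>h12 p\<bar> + \<bar>h22 p\<bar>"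
      by simp
    then show ?thesis unfolding nc a_def[symmetric] b_def[symmetric] by simp
  qed
  have bd: "bdd_above N" "bdd_below N"
    unfolding N_def using bound[unfolded abs_le_iff] 
    by (auto intro!: bdd_aboveI[of _ "\<bar>h11 p\<bar> + \<bar>h12 p\<bar> + \<bar>h22 p\<bar>"] bdd_belowI[of _ "- (\<bar>h11 p\<bar> + \<bar>h12 p\<bar> + \<bar>h22 p\<bar>)"]
        simp del: minus_add_distrib simp: minus_le_iff)
  define K where "K = Sup N"
  have K: "Inf N = K" using assms unfolding umbilic_def kappa1_def kappa2_def N_def K_def by simp
  have const: "normal_curv x p c = K" if "c \<noteq> 0" for c
  proof -
    have "normal_curv x p c \<in> N" unfolding N_def using that by blast
    then show ?thesis using cSup_upper[OF _ bd(1)] cInf_lower[OF _ bd(2)] K K_def by (metis order_antisym)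
  qed
  have ne: "c \<noteq> 0" if "D c \<noteq> 0" for c using that unfolding D_def dx_eq by auto
  have Dc: "D (c1 p) = e1 p" "D (c2 p) = e2 p" "D (c1 p + c2 p) = e1 p + e2 p"
  proof -
    show "D (c1 p) = e1 p" "D (c2 p) = e2 p" using dx_c by (simp_all add: D_def)
    then show "D (c1 p + c2 p) = e1 p + e2 p" unfolding D_def dx_eq by (simp add: algebra_simps)
  qed
  have "e1 p \<noteq> 0" "e2 p \<noteq> 0" using on(1,2)[of p] by auto
  moreover have "e1 p + e2 p \<noteq> 0"
  proof
    assume "e1 p + e2 p = 0"
    then have "(e1 p + e2 p) \<bullet> e1 p = 0" by simp
    then show False using on nn by (simp add: inner_add_left)
  qed
  ultimately have "normal_curv x p (c1 p) = K" "normal_curv x p (c2 p) = K" "normal_curv x p (c1 p + c2 p) = K"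
    using const ne Dc by auto
  then have "h11 p = K" "h22 p = K" "(h11 p + 2 * h12 p + h22 p) / 2 = K"
    unfolding nc Dc by (simp_all add: on nn inner_add_left)
  then show "A p = 0" "h12 p = 0" unfolding A_def by auto
qed

end

section \<open>The Weingarten equation\<close>

lemma cross_triple_self: "cross3 a (cross3 b a) = (a \<bullet> a) *\<^sub>R b - (a \<bullet> b) *\<^sub>R (a :: real^3)"
  by (simp add: cross3_simps) (simp add: forall_3)

text \<open>The coordinate field \<open>pdu x\<close> is periodic and nowhere zero, so normalising
  it and rotating it about the normal gives a frame on the whole torus. This parallelism is what
  makes the Hopf function a genuine function.\<close>

lemma adapted_frame_exists:
  assumes "torus_immersion x"
  obtains e1 e2 where "adapted_frame x e1 e2" "torus_periodic e1" "torus_periodic e2"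
proof -
  note D = torus_immersionD[OF assms] and Sn = smooth_unit_normal[OF assms]
  define e1 where "e1 p = (1 / sqrt (pdu x p \<bullet> pdu x p)) *\<^sub>R pdu x p" for p
  define e2 where "e2 p = cross3 (unit_normal x p) (e1 p)" for p
  have pos: "pdu x p \<bullet> pdu x p > 0" for p
    using D(6)[of p] by auto
  have e11: "e1 p \<bullet> e1 p = 1" for p
    using pos[of p] by (simp add: e1_def)
  have nn: "unit_normal x p \<bullet> unit_normal x p = 1" for p
    using D(6)[of p] by (simp add: unit_normal_def D(3,4) dot_square_norm power2_eq_square)
  have e1n: "e1 p \<bullet> unit_normal x p = 0" for p
    unfolding e1_def unit_normal_def D(3,4) by (simp add: dot_cross_self)
  have "adapted_frame x e1 e2"
  proof
    show S1: "smooth e1"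
      unfolding e1_def[abs_def] by (intro smooth_intros smooth_on_sqrt D) (use pos in \<open>auto simp: less_imp_neq[symmetric]\<close>)
    show "smooth e2"
      unfolding e2_def[abs_def] by (intro smooth_intros Sn S1)
    show "e2 p \<bullet> e2 p = 1" for p
      using norm_cross_dot[of "unit_normal x p" "e1 p"] e11[of p] nn[of p] e1n[of p]
      by (simp add: e2_def dot_square_norm[symmetric] power_mult_distrib inner_commute)
    show "e1 p \<bullet> e2 p = 0" for p unfolding e2_def by (simp add: dot_cross_self)
    show "cross3 (e1 p) (e2 p) = unit_normal x p" for p
      unfolding e2_def cross_triple_self e11 e1n by simp
  qed (use assms e11 in auto)
  moreover have pn: "torus_periodic (unit_normal x)" and p1: "torus_periodic e1"
    using torus_periodic_pd[OF D(2)] unfolding torus_periodic_def unit_normal_def D(3,4) e1_def by simp_all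
  moreover have "torus_periodic e2" using pn p1 unfolding torus_periodic_def e2_def by simp
  ultimately show ?thesis using that by blast
qed

context adapted_frame
begin

lemma h11_h22_eq: "h11 = (\<lambda>p. mean_curv x p + A p)" "h22 = (\<lambda>p. mean_curv x p - A p)"
  by (auto simp: fun_eq_iff mean_gauss A_def field_simps)

text \<open>\<open>k_eq\<close> is inserted into the Codazzi equations and the derivatives of the
  coframe are replaced by the first two structure equations; \<open>r1\<close> and \<open>r2\<close>
  are the products of the connection form with the coframe.\<close>

lemma codazzi_real:
  fixes p
  defines "r1 \<equiv> ru p * w1v p - rv p * w1u p" and "r2 \<equiv> ru p * w2v p - rv p * w2u p"
  shows "pdu h11 p * w1v p - pdv h11 p * w1u p + (pdu h12 p * w2v p - pdv h12 p * w2u p) + (h11 p - h22 p) * r2 - 2 * h12 p * r1 = 0"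
    "pdu h12 p * w1v p - pdv h12 p * w1u p + (pdu h22 p * w2v p - pdv h22 p * w2u p) + 2 * h12 p * r2 + (h11 p - h22 p) * r1 = 0"
proof -
  have "k1u = (\<lambda>p. h11 p * w1u p + h12 p * w2u p)" "k1v = (\<lambda>p. h11 p * w1v p + h12 p * w2v p)"
    "k2u = (\<lambda>p. h12 p * w1u p + h22 p * w2u p)" "k2v = (\<lambda>p. h12 p * w1v p + h22 p * w2v p)"
    using k_eq by auto
  then have d: "pdv k1u p = pdv (\<lambda>p. h11 p * w1u p + h12 p * w2u p) p" "pdu k1v p = pdu (\<lambda>p. h11 p * w1v p + h12 p * w2v p) p"
    "pdv k2u p = pdv (\<lambda>p. h12 p * w1u p + h22 p * w2u p) p" "pdu k2v p = pdu (\<lambda>p. h12 p * w1v p + h22 p * w2v p) p"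
    by simp_all
  note S = smooth_forms smooth_h
  have d1: "pdu k1v p - pdv k1u p = pdu h11 p * w1v p - pdv h11 p * w1u p + (pdu h12 p * w2v p - pdv h12 p * w2u p)
     + h11 p * (pdu w1v p - pdv w1u p) + h12 p * (pdu w2v p - pdv w2u p)"
    unfolding d using S by (simp add: pd_add pd_mult smooth_on_mult algebra_simps)
  have d2: "pdu k2v p - pdv k2u p = pdu h12 p * w1v p - pdv h12 p * w1u p + (pdu h22 p * w2v p - pdv h22 p * w2u p)
     + h12 p * (pdu w1v p - pdv w1u p) + h22 p * (pdu w2v p - pdv w2u p)"
    unfolding d using S by (simp add: pd_add pd_mult smooth_on_mult algebra_simps)
  have k: "ru p * k2v p - rv p * k2u p = h12 p * r1 + h22 p * r2" "ru p * k1v p - rv p * k1u p = h11 p * r1 + h12 p * r2"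
    unfolding k_eq r1_def r2_def by (simp_all add: algebra_simps)
  show "pdu h11 p * w1v p - pdv h11 p * w1u p + (pdu h12 p * w2v p - pdv h12 p * w2u p) + (h11 p - h22 p) * r2 - 2 * h12 p * r1 = 0"
    using d1 structure_eqs(1-3)[of p] unfolding k r1_def[symmetric] r2_def[symmetric] by (simp add: algebra_simps)
  show "pdu h12 p * w1v p - pdv h12 p * w1u p + (pdu h22 p * w2v p - pdv h22 p * w2u p) + 2 * h12 p * r2 + (h11 p - h22 p) * r1 = 0"
    using d2 structure_eqs(1,2,4)[of p] unfolding k r1_def[symmetric] r2_def[symmetric] by (simp add: algebra_simps)
qed

definition om_u where "om_u p = Complex (w1u p) (w2u p)"
definition om_v where "om_v p = Complex (w1v p) (w2v p)"
\<comment> \<open>the conjugate of the Hopf function relative to the frame\<close>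
definition hh where "hh p = Complex (A p) (- h12 p)"

lemma smooth_complex: "smooth om_u" "smooth om_v" "smooth hh"
  unfolding om_u_def[abs_def] om_v_def[abs_def] hh_def[abs_def] by (intro smooth_intros smooth_forms smooth_A smooth_h)+

lemma pd_hh: "pdu hh p = Complex (pdu A p) (- pdu h12 p)" "pdv hh p = Complex (pdv A p) (- pdv h12 p)"
proof -
  have "Re \<circ> hh = A" "Im \<circ> hh = (\<lambda>p. - h12 p)" by (auto simp: hh_def)
  then have e: "(\<lambda>p. Re (hh p)) = A" "(\<lambda>p. Im (hh p)) = (\<lambda>p. - h12 p)" by (simp_all add: o_def)
  show "pdu hh p = Complex (pdu A p) (- pdu h12 p)" "pdv hh p = Complex (pdv A p) (- pdv h12 p)"
    using pd_Re[OF smooth_complex(3), of p] pd_Im[OF smooth_complex(3), of p] pd_minus[OF smooth_h(2), of p]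
    unfolding e by (simp_all add: complex_eq_iff)
qed

text \<open>The two real equations combined into one. The factor 2 of the connection form reflects
  that the Hopf function turns by twice the angle of a frame rotation.\<close>

lemma codazzi:
  "pdu hh p * om_v p - pdv hh p * om_u p =
    2 * \<i> * hh p * (of_real (ru p) * om_v p - of_real (rv p) * om_u p)
    - (of_real (pdu (mean_curv x) p) * cnj (om_v p) - of_real (pdv (mean_curv x) p) * cnj (om_u p))"
proof -
  have d: "pdu h11 p = pdu (mean_curv x) p + pdu A p" "pdv h11 p = pdv (mean_curv x) p + pdv A p"
    "pdu h22 p = pdu (mean_curv x) p - pdu A p" "pdv h22 p = pdv (mean_curv x) p - pdv A p"
    unfolding h11_h22_eq using smooth_A smooth_H by (simp_all add: pd_add pd_diff)
  have A2: "h11 p - h22 p = 2 * A p" by (simp add: A_def)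
  show ?thesis
    using codazzi_real[of p] unfolding d A2
    by (simp add: complex_eq_iff pd_hh hh_def om_u_def om_v_def algebra_simps)
qed

end

text \<open>The factor \<open>1 + \<phi>\<^sup>2|h|\<^sup>2\<close> makes the coform elliptic for all values of \<open>h\<close>; near a zero of \<open>h\<close> it only
  changes terms that are divisible by \<open>h\<close>.\<close>
lemma weingarten_beltrami:
  fixes h hu hv ou ov :: complex and r1 r2 H1 H2 \<phi> :: real
  assumes C: "hu * ov - hv * ou = 2 * \<i> * h * (of_real r1 * ov - of_real r2 * ou) - (of_real H1 * cnj ov - of_real H2 * cnj ou)"
    and H: "H1 = \<phi> * (2 * Re (cnj h * hu))" "H2 = \<phi> * (2 * Re (cnj h * hv))"
  defines "su \<equiv> of_real (1 + \<phi>\<^sup>2 * (cmod h)\<^sup>2) * ou + of_real \<phi> * cnj h * cnj ou"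
    and "sv \<equiv> of_real (1 + \<phi>\<^sup>2 * (cmod h)\<^sup>2) * ov + of_real \<phi> * cnj h * cnj ov"
  shows "hu * sv - hv * su = h * (2 * \<i> * (of_real r1 * sv - of_real r2 * su)
      + of_real \<phi> * (of_real H1 * (ov - of_real \<phi> * cnj h * cnj ov) - of_real H2 * (ou - of_real \<phi> * cnj h * cnj ou)))"
proof -
  define P where "P = complex_of_real \<phi>"
  define V where "V = h * cnj h"
  have s: "su = (1 + P\<^sup>2 * V) * ou + P * cnj h * cnj ou" "sv = (1 + P\<^sup>2 * V) * ov + P * cnj h * cnj ov"
    unfolding su_def sv_def P_def V_def complex_norm_square[symmetric] by simp_all
  have re: "complex_of_real (2 * Re z) = z + cnj z" for z by (simp add: complex_add_cnj)
  \<comment> \<open>The term \<open>cnj h dh\<close> added by sigma is traded for \<open>dH\<close>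
    and the conjugate of \<open>dh\<close>. The former cancels the part of the Codazzi equation that
    is not divisible by \<open>h\<close>; the latter carries a factor \<open>h\<close> and is
    evaluated by the conjugated equation.\<close>
  have H': "P * cnj h * hu = of_real H1 - P * h * cnj hu" "P * cnj h * hv = of_real H2 - P * h * cnj hv"
    unfolding H P_def of_real_mult[of \<phi>] re by (simp_all add: algebra_simps)
  have "cnj (hu * ov - hv * ou) = cnj (2 * \<i> * h * (of_real r1 * ov - of_real r2 * ou) - (of_real H1 * cnj ov - of_real H2 * cnj ou))"
    unfolding C ..
  then have C': "cnj hu * cnj ov - cnj hv * cnj ou = - 2 * \<i> * cnj h * (of_real r1 * cnj ov - of_real r2 * cnj ou) - (of_real H1 * ov - of_real H2 * ou)"
    by simp
  have "hu * sv - hv * su = (1 + P\<^sup>2 * V) * (hu * ov - hv * ou) + (P * cnj h * hu * cnj ov - P * cnj h * hv * cnj ou)"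
    unfolding s by (simp add: algebra_simps)
  also have "\<dots> = (1 + P\<^sup>2 * V) * (hu * ov - hv * ou) + (of_real H1 * cnj ov - of_real H2 * cnj ou)
       - P * h * (cnj hu * cnj ov - cnj hv * cnj ou)"
    unfolding H' by (simp add: algebra_simps)
  also have "\<dots> = h * (2 * \<i> * (of_real r1 * sv - of_real r2 * su)
      + P * (of_real H1 * (ov - P * cnj h * cnj ov) - of_real H2 * (ou - P * cnj h * cnj ou)))"
    unfolding C C' s V_def by (simp add: algebra_simps power2_eq_square)
  finally show ?thesis unfolding P_def .
qed

lemma pd_compose:
  fixes g :: "real \<Rightarrow> real" and F :: "real \<times> real \<Rightarrow> real"
  assumes "(g has_real_derivative g') (at (F p))" "smooth F"
  shows "pdu (\<lambda>p. g (F p)) p = g' * pdu F p" "pdv (\<lambda>p. g (F p)) p = g' * pdv F p"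
proof -
  have D: "((\<lambda>p. g (F p)) has_derivative (\<lambda>v. g' * frechet_derivative F (at p) v)) (at p)"
    using has_derivative_compose[OF smooth_on_has_derivative[OF assms(2), of p] assms(1)[unfolded has_field_derivative_def]] by simp
  show "pdu (\<lambda>p. g (F p)) p = g' * pdu F p" "pdv (\<lambda>p. g (F p)) p = g' * pdv F p"
    unfolding frechet_derivative_pd[OF D] by (simp_all add: pdu_def pdv_def)
qed

lemma smooth_on_real_derivative:
  fixes f :: "real \<Rightarrow> real"
  assumes "smooth_on S f" "t \<in> S"
  shows "(f has_real_derivative frechet_derivative f (at t) 1) (at t)"
proof -
  note D = smooth_on_has_derivative[OF assms]
  have "frechet_derivative f (at t) v = frechet_derivative f (at t) 1 * v" for v
    using linear_scale[OF has_derivative_linear[OF D], of v 1] by (simp add: mult.commute)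
  then have "frechet_derivative f (at t) = (*) (frechet_derivative f (at t) 1)" by (rule ext)
  with D show ?thesis unfolding has_field_derivative_def by (rule has_derivative_eq_rhs)
qed

locale weingarten_torus = adapted_frame +
  fixes f :: "real \<Rightarrow> real" and \<epsilon> :: real
  assumes pe: "torus_periodic e1" "torus_periodic e2"
    and eps: "\<epsilon> > 0" and Sf: "smooth_on {-\<epsilon><..} f"
    and HV: "\<And>p. mean_curv x p = f ((mean_curv x p)\<^sup>2 - gauss_curv x p)"
begin

lemma per_n: "torus_periodic n"
  using torus_periodic_pd[OF torus_immersionD(2)[OF imm]]
  unfolding torus_periodic_def unit_normal_def torus_immersionD(3,4)[OF imm] by simp

lemma per_forms: "torus_periodic w1u" "torus_periodic w1v" "torus_periodic w2u" "torus_periodic w2v"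
  "torus_periodic k1u" "torus_periodic k1v" "torus_periodic k2u" "torus_periodic k2v"
  "torus_periodic ru" "torus_periodic rv" "torus_periodic W" "torus_periodic h11" "torus_periodic h12" "torus_periodic h22"
  "torus_periodic A" "torus_periodic om_u" "torus_periodic om_v" "torus_periodic hh"
  using torus_periodic_pd[OF torus_immersionD(2)[OF imm]] torus_periodic_pd[OF per_n] torus_periodic_pd[OF pe(1)] pe
  unfolding torus_periodic_def w1u_def w1v_def w2u_def w2v_def k1u_def k1v_def k2u_def k2v_def ru_def rv_def W_def
    h11_def h12_def h22_def A_def om_u_def om_v_def hh_def by simp_all

definition V where "V p = (A p)\<^sup>2 + (h12 p)\<^sup>2"
definition ph where "ph p = frechet_derivative f (at (V p)) 1"

lemma V_in: "V p \<in> {-\<epsilon><..}"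
proof -
  have "0 \<le> V p" by (simp add: V_def)
  then show ?thesis using eps by simp
qed

lemma H_eq: "mean_curv x p = f (V p)"
  using HV[of p] unfolding V_eq V_def .

lemma smooth_V: "smooth V" "smooth ph"
proof -
  show "smooth V" unfolding V_def[abs_def] by (intro smooth_intros smooth_A smooth_h)
  then show "smooth ph" unfolding ph_def[abs_def]
    by (intro smooth_on_compose[OF smooth_on_frechet_derivative[OF Sf]]) (use V_in in auto)
qed

lemma pd_H: "pdu (mean_curv x) p = ph p * (2 * Re (cnj (hh p) * pdu hh p))"
  "pdv (mean_curv x) p = ph p * (2 * Re (cnj (hh p) * pdv hh p))"
proof -
  have H: "mean_curv x = (\<lambda>p. f (V p))" using H_eq by auto
  have "pdu V p = 2 * Re (cnj (hh p) * pdu hh p)" "pdv V p = 2 * Re (cnj (hh p) * pdv hh p)"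
    unfolding V_def[abs_def] pd_hh using smooth_A smooth_h
    by (simp_all add: pd_add smooth_on_power pd_power2 hh_def)
  then show "pdu (mean_curv x) p = ph p * (2 * Re (cnj (hh p) * pdu hh p))"
    "pdv (mean_curv x) p = ph p * (2 * Re (cnj (hh p) * pdv hh p))"
    unfolding H pd_compose[OF smooth_on_real_derivative[OF Sf V_in] smooth_V(1)] ph_def by simp_all
qed

lemma hh_zero_free:
  assumes "hh p0 = 0"
  shows "hh p1 = 0"
proof -
  define s1 where "s1 p = of_real (1 + (ph p)\<^sup>2 * (cmod (hh p))\<^sup>2) * om_u p + of_real (ph p) * cnj (hh p) * cnj (om_u p)" for p
  define s2 where "s2 p = of_real (1 + (ph p)\<^sup>2 * (cmod (hh p))\<^sup>2) * om_v p + of_real (ph p) * cnj (hh p) * cnj (om_v p)" for p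
  define \<alpha> where "\<alpha> p = 2 * \<i> * (of_real (ru p) * s2 p - of_real (rv p) * s1 p)
      + of_real (ph p) * (of_real (pdu (mean_curv x) p) * (om_v p - of_real (ph p) * cnj (hh p) * cnj (om_v p))
        - of_real (pdv (mean_curv x) p) * (om_u p - of_real (ph p) * cnj (hh p) * cnj (om_u p)))" for p
  have cV: "(cmod (hh p))\<^sup>2 = V p" for p by (simp add: cmod_power2 hh_def V_def)
  have pV: "torus_periodic V" "torus_periodic ph" using per_forms by (simp_all add: torus_periodic_def V_def ph_def)
  have pH: "torus_periodic (mean_curv x)" using pV(1) by (simp add: torus_periodic_def H_eq)
  have S12: "smooth s1" "smooth s2"
    unfolding s1_def[abs_def] s2_def[abs_def] cV by (intro smooth_intros smooth_complex smooth_V)+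
  have S\<alpha>: "smooth \<alpha>"
    unfolding \<alpha>_def[abs_def] by (intro smooth_intros smooth_complex smooth_V smooth_forms smooth_H S12)
  have p12: "torus_periodic s1" "torus_periodic s2"
    using pV per_forms by (simp_all add: torus_periodic_def s1_def s2_def)
  have p\<alpha>: "torus_periodic \<alpha>"
    using pV per_forms p12 torus_periodic_pd[OF pH] by (simp add: torus_periodic_def \<alpha>_def)
  have eq: "pdu hh p * s2 p - pdv hh p * s1 p = hh p * \<alpha> p" for p
    unfolding s1_def s2_def \<alpha>_def by (rule weingarten_beltrami[OF codazzi pd_H])
  have J: "0 < Im (cnj (s1 p) * s2 p)" for p
  proof -
    define P where "P = 1 + (ph p)\<^sup>2 * V p"
    have "Im (cnj (s1 p) * s2 p) = (P\<^sup>2 - (ph p)\<^sup>2 * V p) * W p"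
      unfolding s1_def s2_def cV P_def[symmetric]
      by (simp add: om_u_def om_v_def hh_def V_def W_def power2_eq_square algebra_simps)
    moreover define y where "y = (ph p)\<^sup>2 * V p"
    moreover have "0 \<le> y" by (simp add: y_def V_def)
    \<comment> \<open>Ellipticity compares the squared coefficients \<open>(1 + y)^2\<close> of the
      coframe and \<open>y\<close> of its conjugate; the difference is positive for every
      \<open>y >= 0\<close>.\<close>
    moreover have "P\<^sup>2 - y = 1 + y + y\<^sup>2"
      unfolding P_def y_def[symmetric] by (simp add: power2_eq_square algebra_simps)
    then have "P\<^sup>2 - y > 0" using \<open>0 \<le> y\<close> zero_le_power2[of y] by linarith
    ultimately show ?thesis using W_pos[of p] by simp
  qed
  show ?thesis
    by (rule torus_zero_free[OF smooth_complex(3) S12 S\<alpha> per_forms(18) p12 p\<alpha> eq J assms])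
qed

lemma not_totally_umbilic: "\<exists>p. hh p \<noteq> 0"
proof (rule ccontr)
  assume "\<not> ?thesis"
  then have "hh p = 0" for p by blast
  then have z: "A p = 0" "h12 p = 0" for p by (simp_all add: hh_def complex_eq_iff)
  have V0: "V p = 0" for p by (simp add: V_def z)
  have H0: "h11 p = f 0" "h22 p = f 0" for p
    unfolding h11_h22_eq using H_eq[of p] z V0 by simp_all
  have k: "k1u p = f 0 * w1u p" "k1v p = f 0 * w1v p" "k2u p = f 0 * w2u p" "k2v p = f 0 * w2v p" for p
    unfolding k_eq H0 z by simp_all
  have gauss: "pdu rv p - pdv ru p = - (f 0)\<^sup>2 * W p" for p
    unfolding structure_eqs(5) k W_def by (simp add: power2_eq_square algebra_simps)
  have "integral Q (pdu rv) = 0" "integral Q (pdv ru) = 0"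
    by (rule integral_pu_eq_0[OF smooth_has_pu[OF smooth_forms(10)] _ per_forms(10)],
        intro smooth_on_continuous smooth_on_pdu smooth_forms,
        rule integral_pv_eq_0[OF smooth_has_pv[OF smooth_forms(9)] _ per_forms(9)],
        intro smooth_on_continuous smooth_on_pdv smooth_forms)
  moreover have "integral Q (\<lambda>p. pdu rv p - pdv ru p) = integral Q (pdu rv) - integral Q (pdv ru)"
    by (intro integral_diff integrable_Q smooth_on_continuous smooth_intros smooth_forms)
  ultimately have "- (f 0)\<^sup>2 * integral Q W = 0" unfolding gauss integral_mult_right by simp
  moreover have "integral Q W > 0"
  proof -
    obtain C where C: "C > 0" "\<And>p. \<bar>1 / W p\<bar> \<le> C"
    proof (rule torus_bounded[of "\<lambda>p. 1 / W p"])
      show "continuous_on UNIV (\<lambda>p. 1 / W p)" using W_ne smooth_on_continuous[OF smooth_forms(11)] by (intro continuous_intros) auto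
      show "torus_periodic (\<lambda>p. 1 / W p)" using per_forms(11) by (simp add: torus_periodic_def)
    qed blast
    have "1 / C \<le> W p" for p using C(2)[of p] C(1) W_pos[of p] by (simp add: field_simps)
    then have "integral Q (\<lambda>p. 1 / C) \<le> integral Q W"
      by (intro integral_Q_mono smooth_on_continuous smooth_forms continuous_intros)
    then show ?thesis unfolding integral_Q_const using C(1) by (meson divide_pos_pos less_le_trans zero_less_one)
  qed
  ultimately have f0: "f 0 = 0" by simp
  have "pdu n p = 0" "pdv n p = 0" for p
    using expand[of "pdu n p" p] expand[of "pdv n p" p] unfolding frame_derivs k f0 by simp_all
  then have "frechet_derivative n (at p) = (\<lambda>v. 0)" for p
    by (intro ext) (simp add: frechet_derivative_eq_pd[OF Sn])
  then have nd: "(n has_derivative (\<lambda>v. 0)) (at p)" for p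
    using smooth_on_has_derivative[OF Sn UNIV_I, of p] by simp
  have nc: "n p = n (0,0)" for p
    by (rule has_derivative_zero_unique[of UNIV n]) (use nd in auto)
  \<comment> \<open>A fixed tangent vector, hence orthogonal to the constant normal. At a maximum of
    the height in this direction it is also orthogonal to the tangent plane, so it would be
    zero.\<close>
  define a where "a = e1 (0,0)"
  define g where "g p = x p \<bullet> a" for p
  have Sg: "smooth g" unfolding g_def[abs_def] by (intro smooth_intros Sx)
  obtain p where p: "\<And>q. g q \<le> g p"
    by (rule torus_attains_sup[OF smooth_on_continuous[OF Sg]])
      (use torus_immersionD(2)[OF imm] in \<open>auto simp: torus_periodic_def g_def\<close>)
  have pdg: "pdu g p = pdu x p \<bullet> a" "pdv g p = pdv x p \<bullet> a"
    unfolding g_def[abs_def] by (simp_all add: pd_bounded_linear[OF bounded_linear_inner_left Sx])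
  obtain u t where ut: "p = (u, t)" by (cases p)
  have "pdu g (u, t) = 0"
    by (rule DERIV_local_max[of "\<lambda>s. g (s, t)" _ u 1]) (use smooth_has_pu[OF Sg] p ut in \<open>auto simp: has_pu_def\<close>)
  moreover have "pdv g (u, t) = 0"
    by (rule DERIV_local_max[of "\<lambda>s. g (u, s)" _ t 1]) (use smooth_has_pv[OF Sg] p ut in \<open>auto simp: has_pv_def\<close>)
  ultimately have z2: "w1u p * (a \<bullet> e1 p) + w2u p * (a \<bullet> e2 p) = 0" "w1v p * (a \<bullet> e1 p) + w2v p * (a \<bullet> e2 p) = 0"
    using pdg ut unfolding xu_expand by (simp_all add: inner_add_left inner_commute[of a])
  have "W p * (a \<bullet> e1 p) = w2v p * (w1u p * (a \<bullet> e1 p) + w2u p * (a \<bullet> e2 p)) - w2u p * (w1v p * (a \<bullet> e1 p) + w2v p * (a \<bullet> e2 p))"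
    "W p * (a \<bullet> e2 p) = w1u p * (w1v p * (a \<bullet> e1 p) + w2v p * (a \<bullet> e2 p)) - w1v p * (w1u p * (a \<bullet> e1 p) + w2u p * (a \<bullet> e2 p))"
    by (simp_all add: W_def algebra_simps)
  then have "a \<bullet> e1 p = 0" "a \<bullet> e2 p = 0" unfolding z2 using W_ne[of p] by simp_all
  moreover have "a \<bullet> n p = 0" using nc[of p] nn(2)[of "(0,0)"] by (simp add: a_def)
  ultimately have "a = 0" using expand[of a p] by simp
  then show False using on(1)[of "(0,0)"] by (simp add: a_def)
qed

lemma hh_ne: "hh p \<noteq> 0"
  using hh_zero_free not_totally_umbilic by blast

lemma no_umbilic: "\<not> umbilic x p"
  using umbilic_imp[of p] hh_ne[of p] by (auto simp: hh_def complex_eq_iff)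

end

section \<open>Principal line fields\<close>

text \<open>Contractibility of the plane gives a continuous logarithm. Near \<open>p\<close> it is
  \<open>g p\<close> plus the principal logarithm of \<open>k q / k p\<close>, a number close to 1,
  so it is differentiable with derivative \<open>dk / k\<close>.\<close>

lemma smooth_logarithm:
  fixes k :: "real \<times> real \<Rightarrow> complex"
  assumes S: "smooth k" and nz: "\<And>p. k p \<noteq> 0"
  obtains g where "smooth g" "\<And>p. k p = exp (g p)"
proof -
  obtain g where g: "continuous_on UNIV g" "\<And>p. p \<in> UNIV \<Longrightarrow> k p = exp (g p)"
    by (rule continuous_logarithm_on_contractible[OF smooth_on_continuous[OF S]])
      (use nz in \<open>auto intro: convex_imp_contractible\<close>)
  have D: "(g has_derivative (\<lambda>v. frechet_derivative k (at p) v / k p)) (at p)" for p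
  proof -
    have kd: "((\<lambda>q. k q / k p) has_derivative (\<lambda>v. frechet_derivative k (at p) v / k p)) (at p)"
      using smooth_on_has_derivative[OF S UNIV_I, of p] nz[of p] by (auto intro!: derivative_eq_intros)
    have Lnd: "(Ln has_derivative (*) 1) (at (k p / k p))"
      using has_field_derivative_Ln[of 1] nz[of p] by (simp add: has_field_derivative_def)
    have "((\<lambda>q. g p + Ln (k q / k p)) has_derivative (\<lambda>v. 0 + 1 * (frechet_derivative k (at p) v / k p))) (at p)"
      by (intro has_derivative_add has_derivative_const has_derivative_compose[OF kd Lnd])
    then have L: "((\<lambda>q. g p + Ln (k q / k p)) has_derivative (\<lambda>v. frechet_derivative k (at p) v / k p)) (at p)" by simp
    have "isCont g p" using g(1) continuous_on_eq_continuous_at[OF open_UNIV] by blast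
    then obtain e where e: "e > 0" "\<And>q. dist q p < e \<Longrightarrow> dist (g q) (g p) < 1"
      unfolding continuous_at_eps_delta using zero_less_one by blast
    \<comment> \<open>Continuity of \<open>g\<close> keeps the imaginary part of the increment below
      1, inside the strip where \<open>Ln\<close> inverts the exponential.\<close>
    have eq: "g p + Ln (k q / k p) = g q" if "q \<in> ball p e" for q
    proof -
      have "cmod (g q - g p) < 1" using e(2)[of q] that by (simp add: dist_norm norm_minus_commute)
      then have "\<bar>Im (g q - g p)\<bar> < 1" using abs_Im_le_cmod le_less_trans by blast
      then have "Ln (exp (g q - g p)) = g q - g p" using pi_gt3 by (intro Ln_exp) auto
      moreover have "k q / k p = exp (g q - g p)" using g(2) by (simp add: exp_diff)
      ultimately show ?thesis by simp
    qed
    show ?thesis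
      by (rule has_derivative_transform_within_open[OF L open_ball _ eq]) (use e in auto)
  qed
  have "smooth g"
    by (rule smooth_onI_derivative[OF open_UNIV D]) (intro smooth_on_divide smooth_on_frechet_derivative S; rule nz)
  then show ?thesis using that g(2) by blast
qed

section \<open>Closed forms on the plane and their periods\<close>

text \<open>The Poincare lemma, with the potential integrated along the ray from the origin.
  Closedness turns the partial derivatives of the integrand into the \<open>s\<close>-derivatives of
  \<open>s * a (s * u, s * t)\<close> and \<open>s * b (s * u, s * t)\<close>.\<close>

lemma closed_form_potential:
  fixes a b :: "real \<times> real \<Rightarrow> real"
  assumes S: "smooth a" "smooth b" and closed: "\<And>p. pdu b p = pdv a p"
  obtains z where "continuous_on UNIV z" "has_pu z a" "has_pv z b"
proof -
  note ca = continuous_on_compose2[OF smooth_on_continuous[OF S(1)]]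
    and cb = continuous_on_compose2[OF smooth_on_continuous[OF S(2)]]
    and cau = continuous_on_compose2[OF smooth_on_continuous[OF smooth_on_pdu[OF S(1)]]]
    and cav = continuous_on_compose2[OF smooth_on_continuous[OF smooth_on_pdv[OF S(1)]]]
    and cbv = continuous_on_compose2[OF smooth_on_continuous[OF smooth_on_pdv[OF S(2)]]]
  define z where "z p = integral (cbox 0 1) (\<lambda>s. fst p * a (s * fst p, s * snd p) + snd p * b (s * fst p, s * snd p))" for p :: "real \<times> real"
  have Da: "((\<lambda>u. a (F u, G u)) has_real_derivative pdu a (F u, G u) * F' + pdv a (F u, G u) * G') (at u)"
    if "(F has_real_derivative F') (at u)" "(G has_real_derivative G') (at u)" "smooth a" for a F G F' G' u
  proof -
    have FG: "((\<lambda>u. (F u, G u)) has_derivative (\<lambda>h. (F' * h, G' * h))) (at u)"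
      using that(1,2) unfolding has_field_derivative_def by (rule has_derivative_Pair)
    have "((\<lambda>u. a (F u, G u)) has_derivative (\<lambda>h. frechet_derivative a (at (F u, G u)) (F' * h, G' * h))) (at u)"
      by (rule has_derivative_compose[OF FG smooth_on_has_derivative[OF that(3) UNIV_I]])
    then show ?thesis
      unfolding frechet_derivative_eq_pd[OF that(3)] has_field_derivative_def
      by (rule has_derivative_eq_rhs) (auto simp: fun_eq_iff algebra_simps)
  qed
  have ftc: "integral (cbox 0 1) (\<lambda>s. c (s * u, s * t) + s * (u * pdu c (s * u, s * t) + t * pdv c (s * u, s * t))) = c (u, t)"
    if "smooth c" for c u t
  proof -
    have "((\<lambda>s. c (s * u, s * t) + s * (u * pdu c (s * u, s * t) + t * pdv c (s * u, s * t))) has_integral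
       (1 * c (1 * u, 1 * t) - 0 * c (0 * u, 0 * t))) {0..1}"
    proof (rule fundamental_theorem_of_calculus)
      fix s :: real
      have "((\<lambda>s. c (s * u, s * t)) has_real_derivative pdu c (s * u, s * t) * u + pdv c (s * u, s * t) * t) (at s)"
        by (rule Da[OF _ _ that]) (auto intro!: derivative_eq_intros)
      then have "((\<lambda>s. s * c (s * u, s * t)) has_real_derivative c (s * u, s * t) + s * (u * pdu c (s * u, s * t) + t * pdv c (s * u, s * t))) (at s)"
        by (auto intro!: derivative_eq_intros simp: algebra_simps)
      then show "((\<lambda>s. s * c (s * u, s * t)) has_vector_derivative c (s * u, s * t) + s * (u * pdu c (s * u, s * t) + t * pdv c (s * u, s * t))) (at s within {0..1})"
        by (simp add: has_real_derivative_iff_has_vector_derivative has_vector_derivative_at_within)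
    qed simp
    then show ?thesis by (simp add: integral_unique)
  qed
  have "continuous_on UNIV z"
    unfolding z_def by (rule integral_continuous_on_param) (auto simp: case_prod_beta intro!: continuous_intros ca cb)
  moreover have "has_pu z a"
    unfolding has_pu_def
  proof (intro allI)
    fix u t :: real
    have "((\<lambda>u. integral (cbox 0 1) (\<lambda>s. u * a (s * u, s * t) + t * b (s * u, s * t))) has_real_derivative
        integral (cbox 0 1) (\<lambda>s. a (s * u, s * t) + s * (u * pdu a (s * u, s * t) + t * pdv a (s * u, s * t)))) (at u within UNIV)"
    proof (rule leibniz_rule_field_derivative[where fx = "\<lambda>u s. a (s * u, s * t) + s * (u * pdu a (s * u, s * t) + t * pdv a (s * u, s * t))"])
      fix u s :: real
      have "((\<lambda>u. a (s * u, s * t)) has_real_derivative pdu a (s * u, s * t) * s + pdv a (s * u, s * t) * 0) (at u)"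
        by (rule Da[OF _ _ S(1)]) (auto intro!: derivative_eq_intros)
      moreover have "((\<lambda>u. b (s * u, s * t)) has_real_derivative pdu b (s * u, s * t) * s + pdv b (s * u, s * t) * 0) (at u)"
        by (rule Da[OF _ _ S(2)]) (auto intro!: derivative_eq_intros)
      ultimately show "((\<lambda>u. u * a (s * u, s * t) + t * b (s * u, s * t)) has_real_derivative
          a (s * u, s * t) + s * (u * pdu a (s * u, s * t) + t * pdv a (s * u, s * t))) (at u within UNIV)"
        unfolding closed by (auto intro!: derivative_eq_intros simp: algebra_simps)
    next
      show "(\<lambda>s. u * a (s * u, s * t) + t * b (s * u, s * t)) integrable_on cbox 0 1" for u
        by (intro integrable_continuous) (auto intro!: continuous_intros ca cb)
      show "continuous_on (UNIV \<times> cbox 0 1) (\<lambda>(u, s). a (s * u, s * t) + s * (u * pdu a (s * u, s * t) + t * pdv a (s * u, s * t)))"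
        by (auto simp: case_prod_beta intro!: continuous_intros ca cau cav)
    qed auto
    then show "((\<lambda>s. z (s, t)) has_real_derivative a (u, t)) (at u)"
      unfolding ftc[OF S(1)] z_def by simp
  qed
  moreover have "has_pv z b"
    unfolding has_pv_def
  proof (intro allI)
    fix u t :: real
    have "((\<lambda>t. integral (cbox 0 1) (\<lambda>s. u * a (s * u, s * t) + t * b (s * u, s * t))) has_real_derivative
        integral (cbox 0 1) (\<lambda>s. b (s * u, s * t) + s * (u * pdu b (s * u, s * t) + t * pdv b (s * u, s * t)))) (at t within UNIV)"
    proof (rule leibniz_rule_field_derivative[where fx = "\<lambda>t s. b (s * u, s * t) + s * (u * pdu b (s * u, s * t) + t * pdv b (s * u, s * t))"])
      fix t s :: real
      have "((\<lambda>t. a (s * u, s * t)) has_real_derivative pdu a (s * u, s * t) * 0 + pdv a (s * u, s * t) * s) (at t)"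
        by (rule Da[OF _ _ S(1)]) (auto intro!: derivative_eq_intros)
      moreover have "((\<lambda>t. b (s * u, s * t)) has_real_derivative pdu b (s * u, s * t) * 0 + pdv b (s * u, s * t) * s) (at t)"
        by (rule Da[OF _ _ S(2)]) (auto intro!: derivative_eq_intros)
      ultimately show "((\<lambda>t. u * a (s * u, s * t) + t * b (s * u, s * t)) has_real_derivative
          b (s * u, s * t) + s * (u * pdu b (s * u, s * t) + t * pdv b (s * u, s * t))) (at t within UNIV)"
        unfolding closed by (auto intro!: derivative_eq_intros simp: algebra_simps)
    next
      show "(\<lambda>s. u * a (s * u, s * t) + t * b (s * u, s * t)) integrable_on cbox 0 1" for t
        by (intro integrable_continuous) (auto intro!: continuous_intros ca cb)
      show "continuous_on (UNIV \<times> cbox 0 1) (\<lambda>(t, s). b (s * u, s * t) + s * (u * pdu b (s * u, s * t) + t * pdv b (s * u, s * t)))"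
        unfolding closed by (auto simp: case_prod_beta intro!: continuous_intros cb cav cbv)
    qed auto
    then show "((\<lambda>s. z (u, s)) has_real_derivative b (u, t)) (at t)"
      unfolding ftc[OF S(2)] z_def by simp
  qed
  ultimately show ?thesis by (rule that)
qed

lemma has_pd_zero_const:
  assumes "has_pu g (\<lambda>p. 0)" "has_pv g (\<lambda>p. 0)"
  shows "g p = g (0, 0)"
proof -
  obtain u t where p: "p = (u, t)" by (cases p)
  have "g (u, t) = g (0, t)"
    using DERIV_isconst_all[of "\<lambda>s. g (s, t)" u 0] assms(1) by (auto simp: has_pu_def)
  also have "\<dots> = g (0, 0)"
    using DERIV_isconst_all[of "\<lambda>s. g (0, s)" t 0] assms(2) by (auto simp: has_pv_def)
  finally show ?thesis by (simp add: p)
qed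

text \<open>If translation by some period reversed the sign of the form, all periods over the lattice of
  double translations would vanish, and a potential would have a critical point.\<close>
lemma nonvanishing_closed_form_periodic:
  fixes a b :: "real \<times> real \<Rightarrow> real" and s1 s2 :: real
  assumes S: "smooth a" "smooth b" and closed: "\<And>p. pdu b p = pdv a p"
    and nz: "\<And>p. a p \<noteq> 0 \<or> b p \<noteq> 0"
    and s: "s1 = 1 \<or> s1 = -1" "s2 = 1 \<or> s2 = -1"
    and t1: "\<And>u t. a (u + 1, t) = s1 * a (u, t)" "\<And>u t. b (u + 1, t) = s1 * b (u, t)"
    and t2: "\<And>u t. a (u, t + 1) = s2 * a (u, t)" "\<And>u t. b (u, t + 1) = s2 * b (u, t)"
  shows "s1 = 1 \<and> s2 = 1"
proof (rule ccontr)
  assume neg: "\<not> (s1 = 1 \<and> s2 = 1)"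
  obtain z where z: "continuous_on UNIV z" "has_pu z a" "has_pv z b"
    by (rule closed_form_potential[OF S closed])
  have zu: "((\<lambda>s. z (s, t)) has_real_derivative a (u, t)) (at u)"
    and zv: "((\<lambda>s. z (u, s)) has_real_derivative b (u, t)) (at t)" for u t
    using z(2,3) by (auto simp: has_pu_def has_pv_def)
  \<comment> \<open>The form is multiplied by \<open>s1\<close> or \<open>s2\<close> under a
    translation, so these defects of the potential have zero derivative; their constants
    \<open>m1\<close>, \<open>m2\<close> are the twisted periods.\<close>
  define d1 where "d1 p = z (fst p + 1, snd p) - s1 * z p" for p
  define d2 where "d2 p = z (fst p, snd p + 1) - s2 * z p" for p
  have D1: "((\<lambda>s. z (s + c, t)) has_real_derivative a (u + c, t)) (at u)" for u t c
    using zu[of t "u + c"] DERIV_shift[of "\<lambda>s. z (s, t)"] by simp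
  have D2: "((\<lambda>s. z (u, s + c)) has_real_derivative b (u, t + c)) (at t)" for u t c
    using zv[of u "t + c"] DERIV_shift[of "\<lambda>s. z (u, s)"] by simp
  have c1: "d1 p = d1 (0,0)" for p
  proof (rule has_pd_zero_const)
    have "((\<lambda>s. z (s + 1, t) - s1 * z (s, t)) has_real_derivative a (u + 1, t) - s1 * a (u, t)) (at u)"
      "((\<lambda>s. z (u + 1, s) - s1 * z (u, s)) has_real_derivative b (u + 1, t) - s1 * b (u, t)) (at t)" for u t
      by (intro DERIV_diff DERIV_cmult zu zv D1)+
    then show "has_pu d1 (\<lambda>p. 0)" "has_pv d1 (\<lambda>p. 0)"
      unfolding has_pu_def has_pv_def d1_def fst_conv snd_conv t1 by simp_all
  qed
  have c2: "d2 p = d2 (0,0)" for p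
  proof (rule has_pd_zero_const)
    have "((\<lambda>s. z (s, t + 1) - s2 * z (s, t)) has_real_derivative a (u, t + 1) - s2 * a (u, t)) (at u)"
      "((\<lambda>s. z (u, s + 1) - s2 * z (u, s)) has_real_derivative b (u, t + 1) - s2 * b (u, t)) (at t)" for u t
      by (intro DERIV_diff DERIV_cmult zu zv D2)+
    then show "has_pu d2 (\<lambda>p. 0)" "has_pv d2 (\<lambda>p. 0)"
      unfolding has_pu_def has_pv_def d2_def fst_conv snd_conv t2 by simp_all
  qed
  define m1 m2 where "m1 = d1 (0,0)" and "m2 = d2 (0,0)"
  have z1: "z (u + 1, t) = s1 * z (u, t) + m1" and z2: "z (u, t + 1) = s2 * z (u, t) + m2" for u t
    using c1[of "(u,t)"] c2[of "(u,t)"] by (simp_all add: d1_def d2_def m1_def m2_def)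
  \<comment> \<open>The two orders of translating the origin to \<open>(1, 1)\<close>
    compared.\<close>
  have comm: "s2 * m1 + m2 = s1 * m2 + m1"
    using z1[of 0 1] z2[of 0 0] z2[of 1 0] z1[of 0 0] by (simp add: algebra_simps)
  \<comment> \<open>In a direction with sign -1 the double translation cancels the constant. If the
    other direction has sign 1, \<open>comm\<close> forces its constant to vanish.\<close>
  have per: "z (u + 2, t) = z (u, t)" "z (u, t + 2) = z (u, t)" for u t
    using z1[of "u + 1" t] z1[of u t] z2[of u "t + 1"] z2[of u t] s neg comm
    by (auto simp: algebra_simps)
  \<comment> \<open>Halving the lattice of double translations back to the unit lattice makes the
    compactness lemma applicable.\<close>
  define y where "y p = z (2 * fst p, 2 * snd p)" for p
  have cy: "continuous_on UNIV y"
    unfolding y_def by (intro continuous_on_compose2[OF z(1)] continuous_intros) auto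
  have py: "torus_periodic y"
    unfolding torus_periodic_def y_def using per by (simp add: distrib_left)
  obtain p where p: "\<And>q. y q \<le> y p" by (rule torus_attains_sup[OF cy py]) blast
  define u t where "u = 2 * fst p" and "t = 2 * snd p"
  have mx: "z q \<le> z (u, t)" for q
    using p[of "(fst q / 2, snd q / 2)"] by (simp add: y_def u_def t_def)
  have "a (u, t) = 0" by (rule DERIV_local_max[OF zu zero_less_one]) (use mx in auto)
  moreover have "b (u, t) = 0" by (rule DERIV_local_max[OF zv zero_less_one]) (use mx in auto)
  ultimately show False using nz by blast
qed

text \<open>In a principal frame Codazzi reads
  \<open>2 a dw1 = - (2 a \<phi> + 1) dA \<and> w1\<close>, with \<phi> the derivative of
  \<open>f\<close> at \<open>a^2\<close>. So \<Xi> times \<open>w1\<close> is closed when the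
  logarithmic derivative of \<Xi> is \<open>\<phi> + 1 / (2 a)\<close>, which is solved by the
  square root times the exponential of an antiderivative of \<phi>.\<close>

lemma (in adapted_frame) principal_closed_form:
  assumes h0: "\<And>p. h12 p = 0" and pos: "\<And>p. A p > 0" and le: "\<And>p. A p \<le> N"
    and eps: "\<epsilon> > 0" and Sf: "smooth_on {-\<epsilon><..} f" and H: "\<And>p. mean_curv x p = f ((A p)\<^sup>2)"
  obtains \<Xi> :: "real \<Rightarrow> real" where "smooth (\<lambda>p. \<Xi> (A p))" "\<And>p. \<Xi> (A p) > 0"
    "\<And>p. pdu (\<lambda>p. \<Xi> (A p) * w1v p) p = pdv (\<lambda>p. \<Xi> (A p) * w1u p) p"
proof -
  define \<phi> where "\<phi> t = frechet_derivative f (at (t\<^sup>2)) 1" for t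
  have t2: "t\<^sup>2 \<in> {-\<epsilon><..}" for t :: real using less_le_trans[of "-\<epsilon>" 0 "t\<^sup>2"] eps by simp
  have S\<phi>: "smooth_on U \<phi>" if "open U" for U
    unfolding \<phi>_def[abs_def] using t2
    by (intro smooth_on_compose[OF smooth_on_frechet_derivative[OF Sf]] smooth_on_power smooth_on_ident that) auto
  \<comment> \<open>The interval reaches beyond the bound \<open>N\<close>, so that all values of
    \<open>A\<close> lie in its interior.\<close>
  obtain \<Psi> where \<Psi>: "\<And>t. t \<in> {0..N + 1} \<Longrightarrow> (\<Psi> has_vector_derivative \<phi> t) (at t within {0..N + 1})"
    using antiderivative_continuous[OF continuous_on_subset[OF smooth_on_continuous[OF S\<phi>[OF open_UNIV]] subset_UNIV], of 0 "N + 1"] by blast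
  have \<Psi>': "(\<Psi> has_real_derivative \<phi> t) (at t)" if "t \<in> {0<..<N + 1}" for t
    using \<Psi>[of t] that by (simp add: at_within_Icc_at has_real_derivative_iff_has_vector_derivative)
  have S\<Psi>: "smooth_on {0<..<N + 1} \<Psi>"
  proof (rule smooth_onI_derivative)
    show "(\<Psi> has_derivative (\<lambda>v. \<phi> t * v)) (at t)" if "t \<in> {0<..<N + 1}" for t
      using \<Psi>'[OF that] by (simp add: has_field_derivative_def)
    show "smooth_on {0<..<N + 1} (\<lambda>t. \<phi> t * v)" for v
      by (intro smooth_on_mult S\<phi> smooth_on_const) auto
  qed auto
  define \<Xi> where "\<Xi> t = sqrt t * exp (\<Psi> t)" for t
  have AN: "A p \<in> {0<..<N + 1}" for p using pos[of p] le[of p] by simp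
  have S\<Xi>: "smooth (\<lambda>p. \<Xi> (A p))"
    unfolding \<Xi>_def
    by (intro smooth_on_mult smooth_on_sqrt smooth_A smooth_on_compose[OF smooth_on_real_exp] smooth_on_compose[OF S\<Psi>])
      (use pos AN in auto)
  have \<Xi>pos: "\<Xi> (A p) > 0" for p using pos[of p] by (simp add: \<Xi>_def)
  have D\<Xi>: "(\<Xi> has_real_derivative \<Xi> t * (\<phi> t + 1 / (2 * t))) (at t)" if t: "t \<in> {0<..<N + 1}" for t
  proof -
    have "((\<lambda>t. sqrt t * exp (\<Psi> t)) has_real_derivative (inverse (sqrt t) / 2) * exp (\<Psi> t) + (exp (\<Psi> t) * \<phi> t) * sqrt t) (at t)"
      using \<Psi>'[OF t] t by (intro DERIV_mult DERIV_real_sqrt DERIV_fun_exp) auto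
    moreover have "inverse (sqrt t) = sqrt t / t" using t by (simp add: field_simps)
    ultimately show ?thesis unfolding \<Xi>_def by (simp add: algebra_simps)
  qed
  have "pdu (\<lambda>p. \<Xi> (A p) * w1v p) p - pdv (\<lambda>p. \<Xi> (A p) * w1u p) p = 0" for p
  proof -
    define a where "a = A p"
    have a: "a > 0" using pos by (simp add: a_def)
    define X where "X = pdu A p * w1v p - pdv A p * w1u p"
    have dP: "pdu (\<lambda>p. \<Xi> (A p)) p = \<Xi> a * (\<phi> a + 1 / (2 * a)) * pdu A p"
      "pdv (\<lambda>p. \<Xi> (A p)) p = \<Xi> a * (\<phi> a + 1 / (2 * a)) * pdv A p"
      unfolding a_def using pd_compose[OF D\<Xi>[OF AN] smooth_A] by simp_all
    have "h12 = (\<lambda>p. 0)" using h0 by auto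
    then have dh12: "pdu h12 p = 0" "pdv h12 p = 0" by (simp_all add: pdu_def pdv_def)
    have "(f has_real_derivative \<phi> a) (at (a\<^sup>2))"
      unfolding \<phi>_def by (rule smooth_on_real_derivative[OF Sf t2])
    moreover have "((\<lambda>t. t\<^sup>2) has_real_derivative 2 * a) (at a)" by (auto intro!: derivative_eq_intros)
    ultimately have D2: "((\<lambda>t. f (t\<^sup>2) + t) has_real_derivative \<phi> a * (2 * a) + 1) (at a)"
      by (intro DERIV_add DERIV_chain2[where f = f] DERIV_ident)
    have "h11 = (\<lambda>p. f ((A p)\<^sup>2) + A p)" unfolding h11_h22_eq using H by auto
    then have dh11: "pdu h11 p = (\<phi> a * (2 * a) + 1) * pdu A p" "pdv h11 p = (\<phi> a * (2 * a) + 1) * pdv A p"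
      using pd_compose[where g = "\<lambda>t. f (t\<^sup>2) + t", OF D2[unfolded a_def] smooth_A] unfolding a_def by simp_all
    have h: "h11 p - h22 p = 2 * a" by (simp add: A_def a_def)
    have "pdu h11 p * w1v p - pdv h11 p * w1u p + 2 * a * (pdu w1v p - pdv w1u p) = 0"
      using codazzi_real(1)[of p] unfolding h dh12 h0 structure_eqs(1) by simp
    then have cod: "2 * a * (pdu w1v p - pdv w1u p) = - (\<phi> a * (2 * a) + 1) * X"
      unfolding dh11 X_def by (simp add: algebra_simps)
    have e: "pdu (\<lambda>p. \<Xi> (A p) * w1v p) p - pdv (\<lambda>p. \<Xi> (A p) * w1u p) p
        = \<Xi> a * (pdu w1v p - pdv w1u p) + \<Xi> a * (\<phi> a + 1 / (2 * a)) * X"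
      unfolding pd_mult[OF S\<Xi> smooth_forms(2)] pd_mult[OF S\<Xi> smooth_forms(1)] dP X_def a_def[symmetric]
      by (simp add: algebra_simps)
    have "2 * a * (pdu (\<lambda>p. \<Xi> (A p) * w1v p) p - pdv (\<lambda>p. \<Xi> (A p) * w1u p) p)
        = \<Xi> a * (2 * a * (pdu w1v p - pdv w1u p)) + \<Xi> a * (2 * a * (\<phi> a + 1 / (2 * a))) * X"
    proof -
      have "2 * a * (y * t + y * z * v) = y * (2 * a * t) + y * (2 * a * z) * v" for y t z v
        by (simp add: algebra_simps)
      then show ?thesis unfolding e .
    qed
    also have "2 * a * (\<phi> a + 1 / (2 * a)) = \<phi> a * (2 * a) + 1" using a by (simp add: field_simps)
    finally have "2 * a * (pdu (\<lambda>p. \<Xi> (A p) * w1v p) p - pdv (\<lambda>p. \<Xi> (A p) * w1u p) p) = 0"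
      unfolding cod by (simp add: algebra_simps)
    then show ?thesis using a by simp
  qed
  then show ?thesis using that[OF S\<Xi> \<Xi>pos] by simp
qed

text \<open>The increment of the angle is a multiple of \<open>pi\<close>; its cosine is continuous
  with values 1 and -1, hence constant on the connected plane.\<close>

lemma half_angle_sign:
  fixes th :: "real \<times> real \<Rightarrow> real"
  assumes c: "continuous_on UNIV th" and eq: "\<And>p. cis (2 * th (p + v)) = cis (2 * th p)"
  obtains s :: real where "s = 1 \<or> s = -1" "\<And>p. cos (th (p + v)) = s * cos (th p)" "\<And>p. sin (th (p + v)) = s * sin (th p)"
proof -
  define D where "D p = th (p + v) - th p" for p
  have s0: "sin (D p) = 0" for p
  proof -
    have "cis (2 * D p) = cis (2 * th (p + v)) / cis (2 * th p)"
      by (simp add: D_def cis_divide right_diff_distrib)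
    then have "cis (2 * D p) = 1" using eq[of p] by simp
    then have "cos (2 * D p) = 1" by (metis cis.simps(1) one_complex.simps(1))
    then show ?thesis by (simp add: cos_double_sin)
  qed
  have c1: "cos (D p) = 1 \<or> cos (D p) = -1" for p
    using sin_zero_abs_cos_one[OF s0[of p]] by linarith
  have "(\<lambda>p. cos (D p)) constant_on UNIV"
  proof (rule continuous_finite_range_constant)
    show "continuous_on UNIV (\<lambda>p. cos (D p))"
      unfolding D_def by (intro continuous_intros continuous_on_compose2[OF c]) auto
    show "finite ((\<lambda>p. cos (D p)) ` UNIV)"
      by (rule finite_subset[of _ "{1, -1}"]) (use c1 in auto)
  qed (rule connected_UNIV)
  then obtain s where s: "\<And>p. cos (D p) = s" by (auto simp: constant_on_def)
  have "cos (th (p + v)) = s * cos (th p)" "sin (th (p + v)) = s * sin (th p)" for p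
    using cos_add[of "th p" "D p"] sin_add[of "th p" "D p"] s0[of p] s[of p] by (simp_all add: D_def)
  then show ?thesis using that[of s] c1[of "(0,0)"] s[of "(0,0)"] by simp
qed

theorem theorem7:
  fixes x :: "real \<times> real \<Rightarrow> real^3" and f :: "real \<Rightarrow> real" and \<epsilon> :: real
  assumes "torus_immersion x"
    and "\<epsilon> > 0"
    and "smooth_on {-\<epsilon><..} f"
    and "\<forall>p. mean_curv x p = f ((mean_curv x p)\<^sup>2 - gauss_curv x p)"
  shows "(\<forall>p. \<not> umbilic x p) \<and> (\<exists>e1 e2. positive_principal_frame x e1 e2)"
proof -
  obtain e1 e2 where fr: "adapted_frame x e1 e2" "torus_periodic e1" "torus_periodic e2"
    by (rule adapted_frame_exists[OF assms(1)])
  interpret adapted_frame x e1 e2 by (rule fr)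
  interpret weingarten_torus x e1 e2 f \<epsilon>
    by unfold_locales (use fr assms in auto)
  \<comment> \<open>Rotating the frame by an angle th multiplies \<open>A + i h12\<close> by
    \<open>exp (- 2 i th)\<close>, so half the argument of \<open>k\<close> turns it into a
    principal frame with \<open>h12 = 0\<close> and \<open>A\<close> equal to the modulus of
    \<open>k\<close>.\<close>
  define k where "k p = cnj (hh p)" for p
  have Sk: "smooth k" unfolding k_def[abs_def] by (intro smooth_intros smooth_complex)
  have knz: "k p \<noteq> 0" for p using hh_ne[of p] by (simp add: k_def)
  obtain g where g: "smooth g" "\<And>p. k p = exp (g p)"
    by (rule smooth_logarithm[OF Sk knz]) blast
  define th where "th p = Im (g p) / 2" for p
  have Sth: "smooth th" unfolding th_def[abs_def] by (intro smooth_intros g) simp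
  define r where "r p = cmod (k p)" for p
  have r: "r p > 0" for p using knz[of p] by (simp add: r_def)
  have kr: "k p = of_real (r p) * cis (2 * th p)" for p
    unfolding r_def g(2) th_def norm_exp_eq_Re by (simp add: exp_eq_polar)
  have Ah: "A p = r p * cos (2 * th p)" "h12 p = r p * sin (2 * th p)" for p
    using kr[of p] by (simp_all add: k_def hh_def complex_eq_iff)
  define E1 where "E1 p = cos (th p) *\<^sub>R e1 p + sin (th p) *\<^sub>R e2 p" for p
  define E2 where "E2 p = - sin (th p) *\<^sub>R e1 p + cos (th p) *\<^sub>R e2 p" for p
  have Scs: "smooth (\<lambda>p. cos (th p))" "smooth (\<lambda>p. sin (th p))"
    by (intro smooth_on_compose[OF smooth_on_real_sin_cos(2) Sth] smooth_on_compose[OF smooth_on_real_sin_cos(1) Sth] UNIV_I)+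
  have SE: "smooth E1" "smooth E2"
    unfolding E1_def[abs_def] E2_def[abs_def] by (intro smooth_intros Scs Se)+
  have Ee: "E1 p \<bullet> e1 p = cos (th p)" "E1 p \<bullet> e2 p = sin (th p)" "E2 p \<bullet> e1 p = - sin (th p)" "E2 p \<bullet> e2 p = cos (th p)" for p
    unfolding E1_def E2_def by (simp_all add: inner_add_left inner_diff_left on nn)
  interpret R: adapted_frame x E1 E2
  proof
    show "E1 p \<bullet> E1 p = 1" "E2 p \<bullet> E2 p = 1" "E1 p \<bullet> E2 p = 0" for p
      using sin_cos_squared_add[of "th p"] unfolding E1_def E2_def
      by (simp_all add: inner_add_left inner_add_right inner_diff_left inner_diff_right on nn power2_eq_square algebra_simps)
    show "cross3 (E1 p) (E2 p) = n p" for p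
    proof -
      have "cross3 (E1 p) (E2 p) = ((cos (th p))\<^sup>2 + (sin (th p))\<^sup>2) *\<^sub>R n p"
        unfolding E1_def E2_def cross_add_left cross_add_right cross_mult_left cross_mult_right cross_refl
          cross_skew[of "e2 p" "e1 p"] cr
        by (simp add: scaleR_add_left[symmetric] power2_eq_square[symmetric])
      then show ?thesis by simp
    qed
  qed (use SE assms in auto)
  have Rh: "R.h11 p = h11 p * (cos (th p))\<^sup>2 + 2 * h12 p * (cos (th p) * sin (th p)) + h22 p * (sin (th p))\<^sup>2"
    "R.h12 p = - 2 * A p * (cos (th p) * sin (th p)) + h12 p * ((cos (th p))\<^sup>2 - (sin (th p))\<^sup>2)"
    "R.h22 p = h11 p * (sin (th p))\<^sup>2 - 2 * h12 p * (cos (th p) * sin (th p)) + h22 p * (cos (th p))\<^sup>2" for p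
    unfolding R.h_eq_sff sff_frame R.dx_c Ee A_def by (simp_all add: power2_eq_square field_simps)
  have R12: "R.h12 p = 0" for p
    unfolding Rh Ah sin_double cos_double by (simp add: algebra_simps)
  have RA: "R.A p = r p" for p
  proof -
    have "R.A p = A p * ((cos (th p))\<^sup>2 - (sin (th p))\<^sup>2) + h12 p * (2 * sin (th p) * cos (th p))"
      unfolding R.A_def Rh A_def by (simp add: field_simps)
    also have "\<dots> = r p * ((cos (2 * th p))\<^sup>2 + (sin (2 * th p))\<^sup>2)"
      unfolding cos_double[symmetric] sin_double[symmetric] Ah by (simp only: power2_eq_square distrib_left mult_ac)
    finally show ?thesis by simp
  qed
  have pk: "torus_periodic k" using per_forms(18) by (simp add: torus_periodic_def k_def)
  have pr: "torus_periodic r" using pk by (simp add: torus_periodic_def r_def)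
  have cis2: "cis (2 * th p) = k p / of_real (r p)" for p using kr[of p] r[of p] by simp
  have cr: "continuous_on UNIV r" unfolding r_def by (intro continuous_intros smooth_on_continuous[OF Sk])
  obtain N where N: "\<And>p. \<bar>r p\<bar> \<le> N" by (rule torus_bounded[OF cr pr]) blast
  have HR: "mean_curv x p = f ((R.A p)\<^sup>2)" for p
    using HV[of p] unfolding R.V_eq[of p] by (simp add: R12)
  obtain \<Xi> where \<Xi>: "smooth (\<lambda>p. \<Xi> (R.A p))" "\<And>p. \<Xi> (R.A p) > 0"
    "\<And>p. pdu (\<lambda>p. \<Xi> (R.A p) * R.w1v p) p = pdv (\<lambda>p. \<Xi> (R.A p) * R.w1u p) p"
  proof (rule R.principal_closed_form[OF R12 _ _ assms(2,3) HR])
    show "0 < R.A p" "R.A p \<le> N" for p using r[of p] N[of p] by (simp_all add: RA)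
  qed blast
  have per_add: "F (p + (1,0)) = F p" "F (p + (0,1)) = F p" if "torus_periodic F" for F :: "real \<times> real \<Rightarrow> 'z" and p
    using that by (cases p; simp add: torus_periodic_def)+
  \<comment> \<open>Only the doubled angle is determined by periodic data; the frame itself may come
    back with the opposite sign.\<close>
  have c2: "cis (2 * th (p + (1,0))) = cis (2 * th p)" "cis (2 * th (p + (0,1))) = cis (2 * th p)" for p
    unfolding cis2 per_add[OF pk] per_add[OF pr] by simp_all
  obtain s1 where s1: "s1 = 1 \<or> s1 = -1" "\<And>p. cos (th (p + (1,0))) = s1 * cos (th p)" "\<And>p. sin (th (p + (1,0))) = s1 * sin (th p)"
    by (rule half_angle_sign[OF smooth_on_continuous[OF Sth] c2(1)]) blast
  obtain s2 where s2: "s2 = 1 \<or> s2 = -1" "\<And>p. cos (th (p + (0,1))) = s2 * cos (th p)" "\<And>p. sin (th (p + (0,1))) = s2 * sin (th p)"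
    by (rule half_angle_sign[OF smooth_on_continuous[OF Sth] c2(2)]) blast
  have E1p: "E1 (p + (1,0)) = s1 *\<^sub>R E1 p" "E1 (p + (0,1)) = s2 *\<^sub>R E1 p"
    "E2 (p + (1,0)) = s1 *\<^sub>R E2 p" "E2 (p + (0,1)) = s2 *\<^sub>R E2 p" for p
    unfolding E1_def E2_def s1 s2 per_add[OF fr(2)] per_add[OF fr(3)] by (simp_all add: algebra_simps)
  note px = torus_periodic_pd[OF torus_immersionD(2)[OF assms(1)]]
  \<comment> \<open>The closed multiple of the first principal coform. Since \<Xi> depends on the
    periodic modulus only, this form changes sign exactly when \<open>E1\<close> does.\<close>
  define a where "a p = \<Xi> (R.A p) * R.w1u p" for p
  define b where "b p = \<Xi> (R.A p) * R.w1v p" for p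
  have ab: "a (p + (1,0)) = s1 * a p" "b (p + (1,0)) = s1 * b p" "a (p + (0,1)) = s2 * a p" "b (p + (0,1)) = s2 * b p" for p
    unfolding a_def b_def R.w1u_def R.w1v_def RA per_add[OF pr] E1p per_add[OF px(1)] per_add[OF px(2)] by simp_all
  have "s1 = 1 \<and> s2 = 1"
  proof (rule nonvanishing_closed_form_periodic[of a b])
    show "smooth a" "smooth b"
      unfolding a_def[abs_def] b_def[abs_def] by (intro smooth_on_mult \<Xi>(1) R.smooth_forms)+
    show "pdu b p = pdv a p" for p unfolding a_def[abs_def] b_def[abs_def] by (rule \<Xi>(3))
    show "a p \<noteq> 0 \<or> b p \<noteq> 0" for p
      using R.W_ne[of p] \<Xi>(2)[of p] by (auto simp: a_def b_def R.W_def)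
  qed (use s1 s2 ab[of "(_, _)"] in auto)
  then have pE: "torus_periodic E1" "torus_periodic E2"
    using E1p[of "(_, _)"] by (auto simp: torus_periodic_def)
  have "positive_principal_frame x E1 E2"
    unfolding positive_principal_frame_def
  proof (intro conjI allI SE pE)
    fix p
    show "\<exists>c1 c2. E1 p = dx x p c1 \<and> E2 p = dx x p c2 \<and>
        norm (E1 p) = 1 \<and> norm (E2 p) = 1 \<and> E1 p \<bullet> E2 p = 0 \<and>
        cross3 (E1 p) (E2 p) = unit_normal x p \<and>
        sff x p c1 c2 = 0 \<and> sff x p c1 c1 > sff x p c2 c2"
    proof (intro exI conjI)
      show "E1 p = dx x p (R.c1 p)" "E2 p = dx x p (R.c2 p)" using R.dx_c by simp_all
      show "sff x p (R.c1 p) (R.c2 p) = 0" using R.h_eq_sff(2)[of p] R12[of p] by simp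
      have "R.h11 p - R.h22 p = 2 * r p" using RA[of p] by (simp add: R.A_def)
      then show "sff x p (R.c1 p) (R.c1 p) > sff x p (R.c2 p) (R.c2 p)"
        unfolding R.h_eq_sff[symmetric] using r[of p] by linarith
    qed (use R.on R.cr in \<open>auto simp: norm_eq_sqrt_inner\<close>)
  qed
  then show ?thesis using no_umbilic by blast
qed

end
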